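(* There are absolute constants $c,c'>0$ and a deterministic distributed algorithm in the CONGEST model such that for all parameters $\kappa\ge 2$ (an integer) and $\rho$ with $\frac1\kappa\le\rho<\frac12$, and every $n$-vertex connected unweighted undirected graph $G=(V,E)$, the algorithm constructs a $t$-spanner of $G$ with at most $n^{1+\frac1\kappa}$ edges, in at most $c'\cdot n^{\rho}\cdot t$ rounds, where $$t=\left(\frac4\rho+1\right)^{\log(\kappa\rho)+\frac1\rho+c}$$ (that is, the exponent is $\log(\kappa\rho)+\frac1\rho+O(1)$ and the running time is $O(n^\rho\cdot t)$).
   Context: All logarithms are to base $2$. A subgraph $G'=(V,H)$ of $G=(V,E)$ is a $t$-spanner of $G$ ($t\ge 1$) if $d_{G'}(u,v)\le t\cdot d_G(u,v)$ for all $u,v\in V$, where $d_G,d_{G'}$ are the hop-distances in $G$ and $G'$. CONGEST model: each vertex of the input graph $G$ hosts a processor; vertices have distinct IDs in $\{1,2,\dots,O(n)\}$. Computation proceeds in synchronous rounds; in each round every vertex may send to each of its neighbors in $G$ a message containing $O(1)$ vertex IDs (i.e. $O(\log n)$ bits). Every vertex knows $n$, $\kappa$ and $\rho$. The running time is the number of rounds of communication. Constructing a spanner means that at termination every vertex knows which of its incident edges belong to the spanner. *)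

theory Defs
  imports Complex_Main "HOL-Library.Extended_Real"
begin

section \<open>Graphs, hop distance, spanners\<close>

text \<open>Vertices are natural numbers (every finite graph has such a copy), so that one algorithm can be
  quantified over all finite graphs. An undirected edge is a two-element vertex set.\<close>

definition simple_graph :: "nat set \<Rightarrow> nat set set \<Rightarrow> bool" where
  "simple_graph V E \<longleftrightarrow> finite V \<and> (\<forall>e\<in>E. e \<subseteq> V \<and> card e = 2)"

definition adj :: "nat set set \<Rightarrow> (nat \<times> nat) set" where
  "adj E = {(u, v). {u, v} \<in> E}"

definition connected_graph :: "nat set \<Rightarrow> nat set set \<Rightarrow> bool" where
  "connected_graph V E \<longleftrightarrow> V \<noteq> {} \<and> (\<forall>u\<in>V. \<forall>v\<in>V. (u, v) \<in> (adj E)\<^sup>*)"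

text \<open>Minimum number of edges of a walk; infinite if there is none.\<close>

definition hop_dist :: "nat set set \<Rightarrow> nat \<Rightarrow> nat \<Rightarrow> enat" where
  "hop_dist E u v = (INF k \<in> {k. (u, v) \<in> adj E ^^ k}. enat k)"

definition is_spanner :: "real \<Rightarrow> nat set \<Rightarrow> nat set set \<Rightarrow> nat set set \<Rightarrow> bool" where
  "is_spanner t V E H \<longleftrightarrow> 1 \<le> t \<and> H \<subseteq> E \<and>
     (\<forall>u\<in>V. \<forall>v\<in>V. ereal_of_enat (hop_dist H u v) \<le> ereal t * ereal_of_enat (hop_dist E u v))"


section \<open>The CONGEST model\<close>

text \<open>\<open>ident v\<close> is the identifier of vertex \<open>v\<close>. The list \<open>nbrs v\<close> enumerates the neighbours of
  \<open>v\<close>; positions in it are the communication ports of \<open>v\<close>. The enumeration is arbitrary, and a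
  processor initially knows only its own identifier and its number of ports, not the identifiers of
  its neighbours.\<close>

record network =
  verts :: "nat set"
  edges :: "nat set set"
  ident :: "nat \<Rightarrow> nat"
  nbrs :: "nat \<Rightarrow> nat list"

text \<open>\<open>C\<close> is the constant hidden in the identifier range \<open>{1, \<dots>, O(n)}\<close>.\<close>

definition congest_network :: "nat \<Rightarrow> network \<Rightarrow> bool" where
  "congest_network C N \<longleftrightarrow>
     simple_graph (verts N) (edges N) \<and>
     inj_on (ident N) (verts N) \<and>
     ident N ` verts N \<subseteq> {1..C * card (verts N)} \<and>
     (\<forall>v\<in>verts N. distinct (nbrs N v) \<and> set (nbrs N v) = {u. {u, v} \<in> edges N})"

text \<open>A message is a list of values from the identifier range; the empty list means that nothing is
  sent.\<close>

type_synonym msg = "nat list"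

text \<open>A deterministic protocol: everything a processor does is a function of its identifier, its
  degree, and its transcript, which lists the received messages round by round (oldest round first)
  and, within a round, port by port. Local computation is unrestricted. \<open>send\<close> gives the message
  for a port in the next round; \<open>decide\<close> is \<open>None\<close> as long as the processor is running, and
  \<open>Some S\<close> when it terminates with the ports in \<open>S\<close> selected.\<close>

record protocol =
  send :: "nat \<Rightarrow> nat \<Rightarrow> msg list list \<Rightarrow> nat \<Rightarrow> msg"
  decide :: "nat \<Rightarrow> nat \<Rightarrow> msg list list \<Rightarrow> nat set option"

definition port_to :: "network \<Rightarrow> nat \<Rightarrow> nat \<Rightarrow> nat" where
  "port_to N u v = (THE p. p < length (nbrs N u) \<and> nbrs N u ! p = v)"

definition decision :: "protocol \<Rightarrow> network \<Rightarrow> nat \<Rightarrow> msg list list \<Rightarrow> nat set option" where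
  "decision P N v tr = decide P (ident N v) (length (nbrs N v)) tr"

definition outgoing :: "protocol \<Rightarrow> network \<Rightarrow> nat \<Rightarrow> msg list list \<Rightarrow> nat \<Rightarrow> msg" where
  "outgoing P N v tr p =
     (if decision P N v tr = None then send P (ident N v) (length (nbrs N v)) tr p else [])"

text \<open>Transcript of vertex \<open>v\<close> after a given number of rounds. A terminated processor sends nothing
  and its transcript is frozen, so its decision is final.\<close>

primrec transcript :: "protocol \<Rightarrow> network \<Rightarrow> nat \<Rightarrow> nat \<Rightarrow> msg list list" where
  "transcript P N 0 = (\<lambda>v. [])"
| "transcript P N (Suc r) = (\<lambda>v.
     if decision P N v (transcript P N r v) = None
     then transcript P N r v @
       [map (\<lambda>u. outgoing P N u (transcript P N r u) (port_to N u v)) (nbrs N v)]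
     else transcript P N r v)"

lemma decision_final:
  assumes "decision P N v (transcript P N r v) = Some S" and "r \<le> r'"
  shows "decision P N v (transcript P N r' v) = Some S"
  using assms(2,1) by (induction r' rule: dec_induct) auto

text \<open>Every message ever sent consists of at most \<open>B\<close> values from the identifier range.\<close>

definition respects_bandwidth :: "nat \<Rightarrow> nat \<Rightarrow> protocol \<Rightarrow> network \<Rightarrow> bool" where
  "respects_bandwidth B C P N \<longleftrightarrow>
     (\<forall>r. \<forall>v\<in>verts N. \<forall>p<length (nbrs N v).
        let m = outgoing P N v (transcript P N r v) p
        in length m \<le> B \<and> set m \<subseteq> {1..C * card (verts N)})"

text \<open>Within \<open>R\<close> rounds every vertex terminates knowing exactly its incident edges in \<open>H\<close>.\<close>

definition constructs_within :: "protocol \<Rightarrow> network \<Rightarrow> nat \<Rightarrow> nat set set \<Rightarrow> bool" where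
  "constructs_within P N R H \<longleftrightarrow>
     (\<forall>v\<in>verts N. decision P N v (transcript P N R v) =
        Some {p. p < length (nbrs N v) \<and> {v, nbrs N v ! p} \<in> H})"

end

theory Submission
  imports Defs "HOL-Library.FuncSet"
begin

text \<open>
  Clusters, initially single vertices, are merged in phases, and the radius grows from \<open>R\<close> to \<open>5 R + 2\<close> per
  phase. In a phase with degree \<open>d\<close> a cluster with fewer than \<open>d\<close> adjacent clusters retires, paying one edge for
  each of them, unless it is absorbed. Every other cluster chooses \<open>d\<close> neighbours. A cluster chosen
  by \<open>32 d\<^sup>2\<close> others becomes a centre and attracts its choosers; there are few such centres. Among the
  remaining clusters the choices overlap boundedly often, so a selective family of time slots yields a
  maximal set of clusters with disjoint choices; these are the other centres, and every remaining cluster meets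
  the choices of one of them. Hence a phase divides the number of clusters by about \<open>d + 1\<close>.

  A cluster-level step is a maximum flooded inside each cluster. The degrees are 1 as long as edges
  cannot be afforded, then grow so that the logarithm of the saved factor is multiplied by \<open>7 / 4\<close> per phase, and
  stay at \<open>n powr (\<rho> / 10)\<close> for the last \<open>20 / \<rho>\<close> or so phases. As \<open>5 \<le> (7 / 4)\<^sup>3\<close> and \<open>8 \<le> 4 / \<rho> + 1\<close>, the
  growing part fits into the exponent \<open>log 2 (\<kappa> \<rho>)\<close>, and the last part into \<open>1 / \<rho> + c\<close>.
\<close>

section \<open>Synchronous programs\<close>

text \<open>The obstacle is congestion inside a cluster: a flood with one value per message delivers
  only an aggregate, so a cluster can neither list its neighbours at once nor see all requests made
  to it. Hence every cluster-level step is a maximum, and a set is collected one element per flood.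
  Conflicts must be resolved deterministically and fast; a selective family does so only if few
  clusters compete, which is why a cluster chosen too often is promoted outright. The threshold
  \<open>32 * d * d\<close> balances both needs: at most \<open>d\<close> choices per cluster leave
  at most \<open>card U / (32 * d)\<close> promoted centres, at most a sixteenth of
  \<open>card U / (d + 1)\<close>, whence the factor \<open>17 / 16\<close>, while a candidate has
  at most \<open>64 * d ^ 3\<close> rivals. A family built from codes needs about
  \<open>(m / \<rho>) ^ 2 * n powr (\<rho> / 10)\<close> slots against \<open>m\<close> rivals. For
  \<open>d \<le> n powr (\<rho> / 10)\<close> this is about the seventh power of
  \<open>n powr (\<rho> / 10)\<close>, so it fits into \<open>n powr \<rho>\<close>.\<close>

type_synonym 's step = "('s \<Rightarrow> nat \<Rightarrow> msg) \<times> ('s \<Rightarrow> msg list \<Rightarrow> 's)"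

text \<open>Illegal messages are replaced by silence, which makes the bandwidth bound hold by construction.\<close>

definition clip :: "nat \<Rightarrow> nat \<Rightarrow> msg \<Rightarrow> msg" where
  "clip B K m = (if length m \<le> B \<and> set m \<subseteq> {1..K} then m else [])"

definition inbox :: "nat \<Rightarrow> nat \<Rightarrow> network \<Rightarrow> ('s \<Rightarrow> nat \<Rightarrow> msg) \<Rightarrow> (nat \<Rightarrow> 's) \<Rightarrow> nat \<Rightarrow> msg list" where
  "inbox B K N f s v = map (\<lambda>u. clip B K (f (s u) (port_to N u v))) (nbrs N v)"

definition exec1 :: "nat \<Rightarrow> nat \<Rightarrow> network \<Rightarrow> 's step \<Rightarrow> (nat \<Rightarrow> 's) \<Rightarrow> nat \<Rightarrow> 's" where
  "exec1 B K N st s = (\<lambda>v. snd st (s v) (inbox B K N (fst st) s v))"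

definition exec :: "nat \<Rightarrow> nat \<Rightarrow> network \<Rightarrow> 's step list \<Rightarrow> (nat \<Rightarrow> 's) \<Rightarrow> nat \<Rightarrow> 's" where
  "exec B K N prog = fold (exec1 B K N) prog"

lemma exec_simps [simp]:
  "exec B K N [] s = s"
  "exec B K N (st # prog) s = exec B K N prog (exec1 B K N st s)"
  "exec B K N (p @ q) s = exec B K N q (exec B K N p s)"
  by (simp_all add: exec_def)

text \<open>A processor is a function of its transcript, so its state is recomputed by replaying the
  program; \<open>zip\<close> cuts off the steps not yet executed.\<close>

definition local_state :: "(nat \<Rightarrow> nat \<Rightarrow> 's) \<Rightarrow> 's step list \<Rightarrow> nat \<Rightarrow> nat \<Rightarrow> msg list list \<Rightarrow> 's" where
  "local_state init prog i d tr = fold (\<lambda>(st, ms) s. snd st s ms) (zip prog tr) (init i d)"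

definition protocol_of ::
    "nat \<Rightarrow> nat \<Rightarrow> (nat \<Rightarrow> nat \<Rightarrow> 's) \<Rightarrow> 's step list \<Rightarrow> ('s \<Rightarrow> nat set) \<Rightarrow> protocol" where
  "protocol_of B K init prog out =
     \<lparr> send = (\<lambda>i d tr p. clip B K (fst (prog ! length tr) (local_state init prog i d tr) p)),
       decide = (\<lambda>i d tr. if length tr < length prog then None
                          else Some (out (local_state init prog i d tr) \<inter> {..<d})) \<rparr>"

lemma respects_bandwidth_protocol_of:
  "respects_bandwidth B C (protocol_of B (C * card (verts N)) init prog out) N"
  by (auto simp: respects_bandwidth_def outgoing_def protocol_of_def clip_def Let_def)

definition init_state :: "network \<Rightarrow> (nat \<Rightarrow> nat \<Rightarrow> 's) \<Rightarrow> nat \<Rightarrow> 's" where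
  "init_state N init = (\<lambda>v. init (ident N v) (length (nbrs N v)))"

text \<open>All vertices must be followed together, because the next transcript entry of
  \<open>v\<close> depends on the replayed states of its neighbours. Nobody stops before the program
  is exhausted, so all transcripts have equal length.\<close>

lemma transcript_protocol_of:
  fixes N :: network and B K init prog out
  defines "P \<equiv> protocol_of B K init prog out"
  assumes "r \<le> length prog"
  shows "length (transcript P N r v) = r \<and>
    local_state init prog (ident N v) (length (nbrs N v)) (transcript P N r v) =
      exec B K N (take r prog) (init_state N init) v"
  using assms(2)
proof (induction r arbitrary: v)
  case 0
  then show ?case by (simp add: local_state_def init_state_def)
next
  case (Suc r)
  have len: "length (transcript P N r u) = r" for u using Suc by simp
  have st: "local_state init prog (ident N u) (length (nbrs N u)) (transcript P N r u) =
      exec B K N (take r prog) (init_state N init) u" for u using Suc by simp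
  have none: "decision P N u (transcript P N r u) = None" for u
    using len[of u] Suc.prems by (simp add: decision_def P_def protocol_of_def)
  have out: "outgoing P N u (transcript P N r u) p =
      clip B K (fst (prog ! r) (exec B K N (take r prog) (init_state N init) u) p)" for u p
    using none[of u] len[of u] st[of u] by (simp add: outgoing_def P_def protocol_of_def)
  let ?in = "inbox B K N (fst (prog ! r)) (exec B K N (take r prog) (init_state N init)) v"
  have tr: "transcript P N (Suc r) v = transcript P N r v @ [?in]"
    by (simp add: none out inbox_def)
  have tk: "take (Suc r) prog = take r prog @ [prog ! r]"
    using Suc.prems by (simp add: take_Suc_conv_app_nth)
  have z: "zip prog (transcript P N r v @ [?in]) = zip prog (transcript P N r v) @ [(prog ! r, ?in)]"
  proof -
    have "drop r prog = prog ! r # drop (Suc r) prog" using Suc.prems by (simp add: Cons_nth_drop_Suc)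
    moreover have "zip prog (transcript P N r v) = zip (take r prog) (transcript P N r v)"
      using zip_append2[of prog "transcript P N r v" "[]"] len[of v] by simp
    ultimately show ?thesis using len[of v] by (simp only: zip_append2 zip_Cons_Cons zip.simps(1))
  qed
  show ?case
    using len[of v] st[of v] unfolding tr tk
    by (simp add: local_state_def z exec1_def)
qed

lemma constructs_within_protocol_of:
  assumes "\<And>v. v \<in> verts N \<Longrightarrow> out (exec B K N prog (init_state N init) v) \<inter> {..<length (nbrs N v)} =
     {p. p < length (nbrs N v) \<and> {v, nbrs N v ! p} \<in> H}"
  shows "constructs_within (protocol_of B K init prog out) N (length prog) H"
  unfolding constructs_within_def
proof
  fix v assume v: "v \<in> verts N"
  note * = transcript_protocol_of[of "length prog" prog B K init out N v]
  show "decision (protocol_of B K init prog out) N v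
      (transcript (protocol_of B K init prog out) N (length prog) v) =
     Some {p. p < length (nbrs N v) \<and> {v, nbrs N v ! p} \<in> H}"
    using * assms[OF v] by (simp add: decision_def) (simp add: protocol_of_def)
qed

section \<open>Aggregation inside clusters\<close>

text \<open>A flooded value is paired with the cluster identifier, so that floods of adjacent clusters do not
  mix. The value 0 stands for the absence of a value and is not transmitted.\<close>

definition flood_step :: "('s \<Rightarrow> nat) \<Rightarrow> ('s \<times> nat) step" where
  "flood_step clf =
     ((\<lambda>\<sigma> p. if snd \<sigma> = 0 then [clf (fst \<sigma>)] else [clf (fst \<sigma>), snd \<sigma>]),
      (\<lambda>\<sigma> ms. (fst \<sigma>, Max (insert (snd \<sigma>) {x. [clf (fst \<sigma>), x] \<in> set ms}))))"

text \<open>The last round is silent: it writes the aggregate into the state and resets the flooding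
  register to 0, so that aggregations can be chained.\<close>

definition agg :: "('s \<Rightarrow> nat) \<Rightarrow> ('s \<Rightarrow> nat \<Rightarrow> msg) \<Rightarrow> ('s \<Rightarrow> msg list \<Rightarrow> nat) \<Rightarrow> ('s \<Rightarrow> nat \<Rightarrow> 's) \<Rightarrow>
    nat \<Rightarrow> ('s \<times> nat) step list" where
  "agg clf m val store T =
     ((\<lambda>\<sigma> p. m (fst \<sigma>) p), (\<lambda>\<sigma> ms. (fst \<sigma>, val (fst \<sigma>) ms))) #
     replicate T (flood_step clf) @
     [((\<lambda>\<sigma> p. []), (\<lambda>\<sigma> ms. (store (fst \<sigma>) (snd \<sigma>), 0)))]"

lemma length_agg [simp]: "length (agg clf m val store T) = T + 2"
  by (simp add: agg_def)

lemma finite_pair_msgs: "finite {x. [a, x] \<in> set ms}"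
proof -
  have "{x. [a, x] \<in> set ms} \<subseteq> (\<lambda>m. m ! 1) ` set ms" by force
  then show ?thesis by (rule finite_subset) simp
qed

lemma Max_image_Un_UN:
  fixes f :: "'a \<Rightarrow> 'b :: linorder"
  assumes "finite A" "A \<noteq> {}" "finite I" "\<And>i. i \<in> I \<Longrightarrow> finite (X i) \<and> X i \<noteq> {}"
  shows "Max (insert (Max (f ` A)) ((\<lambda>i. Max (f ` X i)) ` I)) = Max (f ` (A \<union> (\<Union>i\<in>I. X i)))"
proof (rule antisym)
  let ?L = "insert (Max (f ` A)) ((\<lambda>i. Max (f ` X i)) ` I)" and ?R = "f ` (A \<union> (\<Union>i\<in>I. X i))"
  show "Max ?L \<le> Max ?R"
  proof (rule Max.boundedI)
    fix y assume "y \<in> ?L"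
    then show "y \<le> Max ?R"
      using assms by (auto intro!: Max_mono)
  qed (use assms in auto)
  show "Max ?R \<le> Max ?L"
  proof (rule Max.boundedI)
    fix y assume "y \<in> ?R"
    then consider a where "a \<in> A" "y = f a" | i a where "i \<in> I" "a \<in> X i" "y = f a" by auto
    then show "y \<le> Max ?L"
    proof cases
      case 1
      then have "y \<le> Max (f ` A)" using assms by simp
      also have "\<dots> \<le> Max ?L" using assms by (intro Max_ge) auto
      finally show ?thesis .
    next
      case 2
      then have "y \<le> Max (f ` X i)" using assms(4)[OF 2(1)] by simp
      also have "\<dots> \<le> Max ?L" using assms 2 by (intro Max_ge) auto
      finally show ?thesis .
    qed
  qed (use assms in auto)
qed

section \<open>Ports, neighbours and identifiers of the network\<close>

locale congest =
  fixes C :: nat and N :: network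
  assumes net: "congest_network C N"
begin

abbreviation "V \<equiv> verts N"
abbreviation "E \<equiv> edges N"
abbreviation "K \<equiv> C * card V"

lemma finV: "finite V" and edge_sub: "e \<in> E \<Longrightarrow> e \<subseteq> V \<and> card e = 2"
  using net by (auto simp: congest_network_def simple_graph_def)

lemma edgeV: "{u, v} \<in> E \<Longrightarrow> u \<in> V \<and> v \<in> V \<and> u \<noteq> v"
  using edge_sub[of "{u, v}"] by (auto simp: card_insert_if split: if_splits)

lemma nbrs_set: "v \<in> V \<Longrightarrow> set (nbrs N v) = {u. {u, v} \<in> E}"
  and nbrs_distinct: "v \<in> V \<Longrightarrow> distinct (nbrs N v)"
  using net by (auto simp: congest_network_def)

lemma ident_bounds: "v \<in> V \<Longrightarrow> ident N v \<in> {1..K}"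
  and ident_inj: "v \<in> V \<Longrightarrow> w \<in> V \<Longrightarrow> ident N v = ident N w \<Longrightarrow> v = w"
  using net by (auto simp: congest_network_def inj_on_def)

lemma nth_nbrs:
  assumes "v \<in> V" "p < length (nbrs N v)"
  shows "nbrs N v ! p \<in> V" "{v, nbrs N v ! p} \<in> E" "v \<noteq> nbrs N v ! p"
proof -
  have "nbrs N v ! p \<in> set (nbrs N v)" using assms by simp
  then show "{v, nbrs N v ! p} \<in> E" using nbrs_set[OF assms(1)] by (simp add: insert_commute)
  then show "nbrs N v ! p \<in> V" "v \<noteq> nbrs N v ! p" using edgeV by blast+
qed

lemma ex_port:
  assumes "{v, u} \<in> E"
  shows "\<exists>p<length (nbrs N v). nbrs N v ! p = u"
proof -
  have "u \<in> set (nbrs N v)" using assms edgeV[OF assms] nbrs_set[of v] by (simp add: insert_commute)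
  then show ?thesis by (metis in_set_conv_nth)
qed

lemma port_to_nth:
  assumes "{v, u} \<in> E"
  shows "port_to N u v < length (nbrs N u)" "nbrs N u ! port_to N u v = v"
proof -
  have u: "u \<in> V" using edgeV[OF assms] by blast
  have "\<exists>!p. p < length (nbrs N u) \<and> nbrs N u ! p = v"
    using ex_port[of u v] assms nbrs_distinct[OF u] nth_eq_iff_index_eq by (metis insert_commute)
  from theI'[OF this] show "port_to N u v < length (nbrs N u)" "nbrs N u ! port_to N u v = v"
    by (auto simp: port_to_def)
qed

lemma length_inbox [simp]: "length (inbox B k N f s v) = length (nbrs N v)"
  by (simp add: inbox_def)

lemma nth_inbox:
  "p < length (nbrs N v) \<Longrightarrow>
    inbox B k N f s v ! p = clip B k (f (s (nbrs N v ! p)) (port_to N (nbrs N v ! p) v))"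
  by (simp add: inbox_def)

lemma set_inbox:
  assumes "v \<in> V"
  shows "set (inbox B k N f s v) = {clip B k (f (s u) (port_to N u v)) | u. {v, u} \<in> E}"
  unfolding inbox_def set_map nbrs_set[OF assms] by (auto simp: insert_commute)

section \<open>Walks inside one cluster and flooding along them\<close>

definition same_cluster :: "(nat \<Rightarrow> nat) \<Rightarrow> (nat \<times> nat) set" where
  "same_cluster cl = {(v, w). {v, w} \<in> E \<and> cl v = cl w}"

definition near :: "(nat \<Rightarrow> nat) \<Rightarrow> nat \<Rightarrow> nat \<Rightarrow> nat set" where
  "near cl k v = {w. \<exists>j\<le>k. (v, w) \<in> same_cluster cl ^^ j}"

lemma same_cluster_sym: "(v, w) \<in> same_cluster cl \<Longrightarrow> (w, v) \<in> same_cluster cl"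
  by (auto simp: same_cluster_def insert_commute)

lemma near_0 [simp]: "near cl 0 v = {v}"
  by (auto simp: near_def)

lemma near_self [simp]: "v \<in> near cl k v"
  by (auto simp: near_def intro: exI[of _ 0])

lemma near_mono: "w \<in> near cl j v \<Longrightarrow> j \<le> k \<Longrightarrow> w \<in> near cl k v"
  unfolding near_def by (blast intro: le_trans)

lemma near_trans:
  assumes "w \<in> near cl j v" "x \<in> near cl k w"
  shows "x \<in> near cl (j + k) v"
proof -
  obtain a b where "a \<le> j" "b \<le> k" "(v, w) \<in> same_cluster cl ^^ a" "(w, x) \<in> same_cluster cl ^^ b"
    using assms by (auto simp: near_def)
  then have "a + b \<le> j + k" "(v, x) \<in> same_cluster cl ^^ (a + b)" by (auto simp: relpow_add)
  then show ?thesis by (auto simp: near_def)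
qed

lemma near_sym: "w \<in> near cl k v \<Longrightarrow> v \<in> near cl k w"
proof -
  have "(v, w) \<in> same_cluster cl ^^ j \<Longrightarrow> (w, v) \<in> same_cluster cl ^^ j" for j
  proof (induction j arbitrary: w)
    case (Suc j)
    then obtain x where "(v, x) \<in> same_cluster cl ^^ j" "(x, w) \<in> same_cluster cl" by auto
    then show ?case using Suc.IH same_cluster_sym by (blast intro: relpow_Suc_I2)
  qed simp
  then show "w \<in> near cl k v \<Longrightarrow> v \<in> near cl k w" by (auto simp: near_def)
qed

lemma near_edge: "{v, w} \<in> E \<Longrightarrow> cl v = cl w \<Longrightarrow> w \<in> near cl 1 v"
  unfolding near_def same_cluster_def by (auto intro!: exI[of _ 1])

lemma near_Suc_right: "near cl (Suc k) v = (\<Union>u\<in>near cl k v. insert u {w. (u, w) \<in> same_cluster cl})"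
proof (rule sym)
  show "(\<Union>u\<in>near cl k v. insert u {w. (u, w) \<in> same_cluster cl}) = near cl (Suc k) v"
  proof (intro equalityI subsetI)
    fix w assume "w \<in> (\<Union>u\<in>near cl k v. insert u {w. (u, w) \<in> same_cluster cl})"
    then obtain u where u: "u \<in> near cl k v" "w = u \<or> (u, w) \<in> same_cluster cl" by auto
    then have "w \<in> near cl 1 u" using near_edge by (auto simp: same_cluster_def)
    from near_trans[OF u(1) this] show "w \<in> near cl (Suc k) v" by simp
  next
    fix w assume "w \<in> near cl (Suc k) v"
    then obtain j where j: "j \<le> Suc k" "(v, w) \<in> same_cluster cl ^^ j" by (auto simp: near_def)
    show "w \<in> (\<Union>u\<in>near cl k v. insert u {w. (u, w) \<in> same_cluster cl})"
    proof (cases j)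
      case 0 then show ?thesis using j by auto
    next
      case (Suc i)
      then obtain u where "(v, u) \<in> same_cluster cl ^^ i" "(u, w) \<in> same_cluster cl" using j by auto
      then show ?thesis using Suc j by (auto simp: near_def)
    qed
  qed
qed

lemma near_induct [consumes 1, case_names self edge]:
  assumes "w \<in> near cl k v" "P v" "\<And>u w. P u \<Longrightarrow> {u, w} \<in> E \<Longrightarrow> cl u = cl w \<Longrightarrow> P w"
  shows "P w"
  using assms(1)
proof (induction k arbitrary: w)
  case 0
  then show ?case using assms(2) by simp
next
  case (Suc k)
  then obtain u where "u \<in> near cl k v" "w = u \<or> {u, w} \<in> E \<and> cl u = cl w"
    unfolding near_Suc_right same_cluster_def by blast
  then show ?case using Suc.IH[of u] assms(3)[of u w] by blast
qed

lemma near_subset: "v \<in> V \<Longrightarrow> near cl k v \<subseteq> V"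
proof
  fix w assume "w \<in> near cl k v" "v \<in> V" then show "w \<in> V"
    by (induction rule: near_induct) (blast dest: edgeV)+
qed

lemma near_cl: "w \<in> near cl k v \<Longrightarrow> cl w = cl v"
  by (induction rule: near_induct) simp_all

text \<open>Merging clusters only adds pairs to \<open>same_cluster\<close>, so distances
  established before a phase remain valid after it.\<close>

lemma near_cong:
  assumes "\<And>v w. v \<in> V \<Longrightarrow> w \<in> V \<Longrightarrow> cl v = cl w \<Longrightarrow> cl' v = cl' w"
  shows "w \<in> near cl k v \<Longrightarrow> w \<in> near cl' k v"
proof (induction k arbitrary: w)
  case (Suc k)
  then obtain u where "u \<in> near cl k v" "w = u \<or> (u, w) \<in> same_cluster cl" by (auto simp: near_Suc_right)
  moreover have "(u, w) \<in> same_cluster cl'" if "(u, w) \<in> same_cluster cl"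
    using that assms edgeV[of u w] by (auto simp: same_cluster_def)
  ultimately show ?case using Suc.IH by (auto simp: near_Suc_right)
qed simp

text \<open>Not transmitting the value 0 is harmless, since the own register enters the maximum and
  is at least 0. The bounds in \<open>ok\<close> keep messages from being clipped.\<close>

lemma flood_step:
  assumes ok: "\<And>v. v \<in> V \<Longrightarrow> clf (r v) \<in> {1..K} \<and> a v \<le> K" and s: "\<And>v. v \<in> V \<Longrightarrow> s v = (r v, a v)"
    and v: "v \<in> V"
  shows "exec1 2 K N (flood_step clf) s v =
    (r v, Max (insert (a v) (a ` {u. (v, u) \<in> same_cluster (\<lambda>v. clf (r v))})))"
proof -
  let ?I = "inbox 2 K N (fst (flood_step clf)) s v" and ?A = "{u. (v, u) \<in> same_cluster (\<lambda>v. clf (r v))}"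
  let ?m = "\<lambda>u. clip 2 K (fst (flood_step clf) (s u) (port_to N u v))"
  have c: "clip 2 K (fst (flood_step clf) (s u) p) = (if a u = 0 then [clf (r u)] else [clf (r u), a u])"
    if "u \<in> V" for u p
    using ok[OF that] s[OF that] by (auto simp: flood_step_def clip_def)
  have set: "{x. [clf (r v), x] \<in> set ?I} = {a u | u. u \<in> ?A \<and> a u \<noteq> 0}"
    unfolding set_inbox[OF v] same_cluster_def
  proof (intro equalityI subsetI)
    fix x assume "x \<in> {x. [clf (r v), x] \<in> {?m u |u. {v, u} \<in> E}}"
    then obtain u where u: "{v, u} \<in> E" "[clf (r v), x] = ?m u" by auto
    then have "u \<in> V" using edgeV by blast
    with u(2) c have "clf (r u) = clf (r v) \<and> x = a u \<and> a u \<noteq> 0" by (auto split: if_splits)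
    then show "x \<in> {a u |u. u \<in> {u. (v, u) \<in> {(v, w). {v, w} \<in> E \<and> clf (r v) = clf (r w)}} \<and> a u \<noteq> 0}" using u by auto
  next
    fix x assume "x \<in> {a u |u. u \<in> {u. (v, u) \<in> {(v, w). {v, w} \<in> E \<and> clf (r v) = clf (r w)}} \<and> a u \<noteq> 0}"
    then obtain u where u: "x = a u" "{v, u} \<in> E" "clf (r v) = clf (r u)" "a u \<noteq> 0" by auto
    then have "u \<in> V" using edgeV by blast
    then have "[clf (r v), x] = ?m u" using c u by auto
    then show "x \<in> {x. [clf (r v), x] \<in> {?m u |u. {v, u} \<in> E}}"
      using u by blast
  qed
  have fin: "finite (a ` ?A)"
    by (rule finite_imageI, rule finite_subset[OF _ finV]) (use edgeV in \<open>auto simp: same_cluster_def\<close>)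
  have "Max (insert (a v) {x. [clf (r v), x] \<in> set ?I}) = Max (insert (a v) (a ` ?A))"
  proof (rule antisym)
    show "Max (insert (a v) {x. [clf (r v), x] \<in> set ?I}) \<le> Max (insert (a v) (a ` ?A))"
      by (rule Max_mono) (use fin in \<open>auto simp: set\<close>)
    show "Max (insert (a v) (a ` ?A)) \<le> Max (insert (a v) {x. [clf (r v), x] \<in> set ?I})"
    proof (rule Max.boundedI)
      fix y assume y: "y \<in> insert (a v) (a ` ?A)"
      show "y \<le> Max (insert (a v) {x. [clf (r v), x] \<in> set ?I})"
      proof (cases "y = 0")
        case False
        then have "y \<in> insert (a v) {x. [clf (r v), x] \<in> set ?I}" using y unfolding set by auto
        then show ?thesis by (rule Max_ge[rotated]) (simp add: finite_pair_msgs)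
      qed simp
    qed (use fin in auto)
  qed
  then show ?thesis using s[OF v] by (simp add: exec1_def flood_step_def)
qed

text \<open>The induction peels off the first round, which replaces the registers \<open>a\<close>
  by \<open>a'\<close>; therefore \<open>a\<close> is arbitrary. A maximum of \<open>a'\<close> over
  radius \<open>T\<close> is one of \<open>a\<close> over radius \<open>Suc T\<close>.\<close>

lemma flood_steps:
  assumes ok: "\<And>v. v \<in> V \<Longrightarrow> clf (r v) \<in> {1..K} \<and> a v \<le> K" and s: "\<And>v. v \<in> V \<Longrightarrow> s v = (r v, a v)"
  shows "v \<in> V \<Longrightarrow> exec 2 K N (replicate T (flood_step clf)) s v =
    (r v, Max (a ` near (\<lambda>v. clf (r v)) T v))"
  using ok s
proof (induction T arbitrary: s a v)
  case 0
  then show ?case by simp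
next
  case (Suc T)
  let ?cl = "\<lambda>v. clf (r v)"
  define a' where "a' v = Max (insert (a v) (a ` {u. (v, u) \<in> same_cluster ?cl}))" for v
  have finA: "finite {u. (v, u) \<in> same_cluster ?cl}" for v
    by (rule finite_subset[OF _ finV]) (use edgeV in \<open>auto simp: same_cluster_def\<close>)
  have s': "exec1 2 K N (flood_step clf) s v = (r v, a' v)" if "v \<in> V" for v
    unfolding a'_def by (rule flood_step[where clf=clf and r=r and a=a and s=s, OF Suc.prems(2,3) that])
  have "a' v \<le> K" if "v \<in> V" for v
    unfolding a'_def using that Suc.prems(2) finA edgeV by (subst Max_le_iff) (auto simp: same_cluster_def)
  with Suc.prems have ok': "clf (r v) \<in> {1..K} \<and> a' v \<le> K" if "v \<in> V" for v using that by blast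
  have "exec 2 K N (replicate (Suc T) (flood_step clf)) s v = (r v, Max (a' ` near ?cl T v))"
    using Suc.IH[of v a' "exec1 2 K N (flood_step clf) s", OF Suc.prems(1) ok' s'] by simp
  also have "Max (a' ` near ?cl T v) = Max (a ` near ?cl (Suc T) v)"
  proof -
    have fin: "finite (near ?cl T v)" using near_subset[OF Suc.prems(1)] finV finite_subset by blast
    have "a' u = Max (a ` insert u {w. (u, w) \<in> same_cluster ?cl})" for u by (simp add: a'_def)
    \<comment> \<open>The point \<open>v\<close> is added to both sides only to match
      \<open>Max_image_Un_UN\<close>; it changes neither maximum.\<close>
    moreover have "Max (insert (Max (a ` {v})) ((\<lambda>u. Max (a ` insert u {w. (u, w) \<in> same_cluster ?cl})) ` near ?cl T v)) =
        Max (a ` ({v} \<union> near ?cl (Suc T) v))"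
      unfolding near_Suc_right by (rule Max_image_Un_UN) (use fin finA in auto)
    moreover have "{v} \<union> near ?cl (Suc T) v = near ?cl (Suc T) v" by auto
    moreover have "Max (insert (a v) (a' ` near ?cl T v)) = Max (a' ` near ?cl T v)"
    proof -
      have "a v \<le> a' v" unfolding a'_def using finA by (intro Max_ge) auto
      also have "\<dots> \<le> Max (a' ` near ?cl T v)" using fin by (intro Max_ge) auto
      finally have "a v \<le> Max (a' ` near ?cl T v)" .
      moreover have "near ?cl T v \<noteq> {}" by (metis near_self empty_iff)
      ultimately show ?thesis using fin by (simp add: max_absorb2)
    qed
    ultimately show ?thesis by simp
  qed
  finally show ?case .
qed

lemma inbox_fst:
  assumes "v \<in> V" "\<And>v. v \<in> V \<Longrightarrow> s v = (r v, 0)"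
  shows "inbox B k N (\<lambda>\<sigma> p. m (fst \<sigma>) p) s v = inbox B k N m r v"
  unfolding inbox_def
proof (rule map_cong[OF refl])
  fix u assume "u \<in> set (nbrs N v)"
  then have "u \<in> V" using nbrs_set[OF assms(1)] edgeV by blast
  then show "clip B k (m (fst (s u)) (port_to N u v)) = clip B k (m (r u) (port_to N u v))"
    using assms(2) by simp
qed

text \<open>The hypothesis \<open>diam\<close> turns the flooded ball into the whole cluster, so all
  members of a cluster receive the same maximum.\<close>

lemma agg:
  assumes s: "\<And>v. v \<in> V \<Longrightarrow> s v = (r v, 0)" and cl: "\<And>v. v \<in> V \<Longrightarrow> clf (r v) \<in> {1..K}"
    and pr: "\<And>v. v \<in> V \<Longrightarrow> val (r v) (inbox 2 K N m r v) \<le> K"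
    and diam: "\<And>v w. v \<in> V \<Longrightarrow> w \<in> V \<Longrightarrow> clf (r w) = clf (r v) \<Longrightarrow> w \<in> near (\<lambda>v. clf (r v)) T v"
    and v: "v \<in> V"
  shows "exec 2 K N (agg clf m val store T) s v =
    (store (r v) (Max ((\<lambda>w. val (r w) (inbox 2 K N m r w)) ` {w \<in> V. clf (r w) = clf (r v)})), 0)"
proof -
  let ?a = "\<lambda>w. val (r w) (inbox 2 K N m r w)"
  define s1 where "s1 = exec1 2 K N ((\<lambda>\<sigma> p. m (fst \<sigma>) p), (\<lambda>\<sigma> ms. (fst \<sigma>, val (fst \<sigma>) ms))) s"
  have s1: "s1 v = (r v, ?a v)" if "v \<in> V" for v
    using s[OF that] inbox_fst[where s=s and r=r, OF that s, of 2 K m] unfolding s1_def exec1_def by simp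
  define s2 where "s2 = exec 2 K N (replicate T (flood_step clf)) s1"
  have "s2 v = (r v, Max (?a ` near (\<lambda>v. clf (r v)) T v))"
    unfolding s2_def by (rule flood_steps[where clf=clf and r=r and s=s1 and a="?a", OF _ s1 v]) (use cl pr in blast)+
  moreover have "near (\<lambda>v. clf (r v)) T v = {w \<in> V. clf (r w) = clf (r v)}"
  proof (intro equalityI subsetI)
    fix w assume "w \<in> near (\<lambda>v. clf (r v)) T v"
    then show "w \<in> {w \<in> V. clf (r w) = clf (r v)}"
      using near_subset[OF v] near_cl[of w "\<lambda>v. clf (r v)" T v] by blast
  qed (use diam[OF v] in blast)
  ultimately show ?thesis
    by (simp add: agg_def s1_def[symmetric] s2_def[symmetric]) (simp add: exec1_def)
qed

end

section \<open>A superclustering phase on an abstract cluster graph\<close>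

text \<open>One step of the machine: every cluster sends a number to each adjacent cluster, folds the received
  numbers by a maximum (this is what flooding a cluster can compute), and stores the result; 0 means
  that nothing was received. In the state, \<open>chosen\<close> are up to \<open>d\<close> adjacent clusters, \<open>chosen_by\<close> up to
  \<open>D\<close> clusters that chose this one, \<open>heavy_choice\<close> a chosen cluster whose \<open>chosen_by\<close> is full,
  \<open>refused\<close> is nonzero if some cluster denied the last request, \<open>owner\<close> is the selected cluster whose
  supercluster this one entered, and \<open>far_owner\<close> the owner of a chosen cluster.\<close>

record cstate =
  chosen :: "nat set"
  chosen_by :: "nat set"
  heavy_choice :: nat
  refused :: nat
  owner :: nat
  far_owner :: nat

record cstep =
  cmsg :: "nat \<Rightarrow> cstate \<Rightarrow> nat \<Rightarrow> nat"
  cself :: "nat \<Rightarrow> cstate \<Rightarrow> nat"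
  crecv :: "nat \<Rightarrow> cstate \<Rightarrow> nat \<Rightarrow> nat \<Rightarrow> nat"
  cstore :: "cstate \<Rightarrow> nat \<Rightarrow> cstate"

definition cexec1 :: "(nat \<Rightarrow> nat set) \<Rightarrow> cstep \<Rightarrow> (nat \<Rightarrow> cstate) \<Rightarrow> nat \<Rightarrow> cstate" where
  "cexec1 nb q c = (\<lambda>u. cstore q (c u)
     (Max (insert (cself q u (c u)) ((\<lambda>z. crecv q u (c u) z (cmsg q z (c z) u)) ` nb u))))"

definition cexec :: "(nat \<Rightarrow> nat set) \<Rightarrow> cstep list \<Rightarrow> (nat \<Rightarrow> cstate) \<Rightarrow> nat \<Rightarrow> cstate" where
  "cexec nb qs = fold (cexec1 nb) qs"

lemma cexec_simps [simp]:
  "cexec nb [] c = c"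
  "cexec nb (q # qs) c = cexec nb qs (cexec1 nb q c)"
  "cexec nb (ps @ qs) c = cexec nb qs (cexec nb ps c)"
  by (simp_all add: cexec_def)

text \<open>In slot \<open>s\<close> the clusters \<open>z\<close> with \<open>hit z s\<close> request themselves and their chosen clusters. A cluster
  grants only if no other cluster that could request it uses the slot.\<close>

definition grants :: "(nat \<Rightarrow> nat \<Rightarrow> bool) \<Rightarrow> nat \<Rightarrow> nat \<Rightarrow> cstate \<Rightarrow> nat \<Rightarrow> bool" where
  "grants hit s y c u \<longleftrightarrow> owner c = 0 \<and> (\<forall>z\<in>insert y (chosen_by c). hit z s \<longrightarrow> z = u)"

text \<open>Only these compete in the slots: a cluster with \<open>D\<close> known choosers is a
  centre anyway, and one with a heavy choice has a centre to join.\<close>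

definition candidate :: "nat \<Rightarrow> nat \<Rightarrow> cstate \<Rightarrow> bool" where
  "candidate d D c \<longleftrightarrow> card (chosen c) = d \<and> card (chosen_by c) \<noteq> D \<and> heavy_choice c = 0"

definition selected :: "nat \<Rightarrow> nat \<Rightarrow> (nat \<Rightarrow> nat \<Rightarrow> bool) \<Rightarrow> nat \<Rightarrow> nat \<Rightarrow> cstate \<Rightarrow> bool" where
  "selected d D hit s u c \<longleftrightarrow> candidate d D c \<and> hit u s \<and> refused c = 0"

definition choose_step :: cstep where
  "choose_step = \<lparr>cmsg = \<lambda>z cz u. 0, cself = \<lambda>u c. 0,
     crecv = \<lambda>u c z b. if z \<in> chosen c then 0 else z,
     cstore = \<lambda>c x. if x = 0 then c else c\<lparr>chosen := insert x (chosen c)\<rparr>\<rparr>"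

definition chooser_step :: "nat \<Rightarrow> cstep" where
  "chooser_step d = \<lparr>cmsg = \<lambda>z cz u. if card (chosen cz) = d \<and> u \<in> chosen cz then 1 else 0, cself = \<lambda>u c. 0,
     crecv = \<lambda>u c z b. if b \<noteq> 0 \<and> z \<notin> chosen_by c then z else 0,
     cstore = \<lambda>c x. if x = 0 then c else c\<lparr>chosen_by := insert x (chosen_by c)\<rparr>\<rparr>"

definition heavy_step :: "nat \<Rightarrow> cstep" where
  "heavy_step D = \<lparr>cmsg = \<lambda>z cz u. if card (chosen_by cz) = D then 1 else 0, cself = \<lambda>u c. 0,
     crecv = \<lambda>u c z b. if b \<noteq> 0 \<and> z \<in> chosen c then z else 0,
     cstore = \<lambda>c x. c\<lparr>heavy_choice := x\<rparr>\<rparr>"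

definition ask_step :: "(nat \<Rightarrow> nat \<Rightarrow> bool) \<Rightarrow> nat \<Rightarrow> cstep" where
  "ask_step hit s = \<lparr>cmsg = \<lambda>z cz u. if grants hit s z cz u then 0 else 1,
     cself = \<lambda>u c. if grants hit s u c u then 0 else 1,
     crecv = \<lambda>u c z b. if z \<in> chosen c then b else 0,
     cstore = \<lambda>c x. c\<lparr>refused := x\<rparr>\<rparr>"

definition select_step :: "nat \<Rightarrow> nat \<Rightarrow> (nat \<Rightarrow> nat \<Rightarrow> bool) \<Rightarrow> nat \<Rightarrow> cstep" where
  "select_step d D hit s = \<lparr>cmsg = \<lambda>z cz u. if selected d D hit s z cz \<and> u \<in> chosen cz then z else 0,
     cself = \<lambda>u c. if selected d D hit s u c then u else 0,
     crecv = \<lambda>u c z b. b,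
     cstore = \<lambda>c x. if x = 0 then c else c\<lparr>owner := x\<rparr>\<rparr>"

definition join_step :: cstep where
  "join_step = \<lparr>cmsg = \<lambda>z cz u. owner cz, cself = \<lambda>u c. 0,
     crecv = \<lambda>u c z b. if z \<in> chosen c then b else 0,
     cstore = \<lambda>c x. c\<lparr>far_owner := x\<rparr>\<rparr>"

definition slot_steps :: "nat \<Rightarrow> nat \<Rightarrow> (nat \<Rightarrow> nat \<Rightarrow> bool) \<Rightarrow> nat \<Rightarrow> cstep list" where
  "slot_steps d D hit s = [ask_step hit s, select_step d D hit s]"

definition phase_steps :: "nat \<Rightarrow> nat \<Rightarrow> nat \<Rightarrow> (nat \<Rightarrow> nat \<Rightarrow> bool) \<Rightarrow> cstep list" where
  "phase_steps d D M hit = replicate d choose_step @ replicate D (chooser_step d) @ [heavy_step D] @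
     concat (map (slot_steps d D hit) [0..<M]) @ [join_step]"

definition cinit :: cstate where
  "cinit = \<lparr>chosen = {}, chosen_by = {}, heavy_choice = 0, refused = 0, owner = 0, far_owner = 0\<rparr>"

text \<open>Ownership is tested before the degree: a cluster in a selected ball follows its owner
  even if it has few neighbours. Clusters that join through \<open>far_owner\<close> rely on this,
  because their connecting cluster must end up in the same supercluster. The value 0 means
  retirement.\<close>

definition new_center :: "nat \<Rightarrow> nat \<Rightarrow> nat \<Rightarrow> cstate \<Rightarrow> nat" where
  "new_center d D u c =
     (if card (chosen_by c) = D \<or> owner c = u then u
      else if owner c \<noteq> 0 then owner c
      else if card (chosen c) = d then (if heavy_choice c \<noteq> 0 then heavy_choice c else far_owner c)
      else 0)"

lemma replicate_Suc_snoc: "replicate (Suc k) x = replicate k x @ [x]"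
  by (simp add: replicate_append_same)

lemma Max_insert_image_nat:
  fixes f :: "'a \<Rightarrow> nat"
  assumes "finite A" and "Max (insert a (f ` A)) = m"
  shows "a \<le> m" "\<And>z. z \<in> A \<Longrightarrow> f z \<le> m" "m = a \<or> (\<exists>z\<in>A. m = f z)"
  using assms(2) Max_ge[of "insert a (f ` A)"] Max_in[of "insert a (f ` A)"] assms(1)
  by auto

text \<open>The size \<open>(d + 1) * D\<close> in \<open>sel\<close> bounds the rivals of a
  candidate: its ball has at most \<open>d + 1\<close> clusters, each of which counts together with
  fewer than \<open>D\<close> choosers.\<close>

locale cluster_graph =
  fixes U :: "nat set" and nb :: "nat \<Rightarrow> nat set" and d D M :: nat and hit :: "nat \<Rightarrow> nat \<Rightarrow> bool"
  assumes finU: "finite U" and U0: "0 \<notin> U"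
    and nbU: "\<And>u. u \<in> U \<Longrightarrow> nb u \<subseteq> U"
    and nb_sym: "\<And>u z. u \<in> U \<Longrightarrow> z \<in> nb u \<Longrightarrow> u \<in> nb z"
    and nb_irrefl: "\<And>u. u \<in> U \<Longrightarrow> u \<notin> nb u"
    and d1: "1 \<le> d" and D1: "1 \<le> D"
    and sel: "\<And>u Z. u \<in> U \<Longrightarrow> Z \<subseteq> U - {u} \<Longrightarrow> card Z \<le> (d + 1) * D \<Longrightarrow>
        \<exists>s<M. hit u s \<and> (\<forall>z\<in>Z. \<not> hit z s)"
begin

lemma fin_nb: "u \<in> U \<Longrightarrow> finite (nb u)"
  using nbU finU by (meson finite_subset)

lemma nb0: "u \<in> U \<Longrightarrow> z \<in> nb u \<Longrightarrow> z \<noteq> 0"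
  using nbU U0 by (metis subset_iff)

text \<open>The outcome of \<open>k\<close> rounds that each pick one new element of
  \<open>A\<close>. A cardinality below \<open>k\<close> certifies that all of \<open>A\<close> is
  known; both retirement and the conflict test rest on this.\<close>

definition collected :: "nat \<Rightarrow> nat set \<Rightarrow> nat set \<Rightarrow> bool" where
  "collected k A S \<longleftrightarrow> S \<subseteq> A \<and> (card S = k \<or> card S < k \<and> S = A)"

lemma collected_Suc:
  assumes fin: "finite A" and c: "collected k A S" and "0 \<notin> A"
    and x: "x = Max (insert 0 ((\<lambda>z. if z \<in> A - S then z else 0) ` B))" and "finite B" "A \<subseteq> B"
  shows "collected (Suc k) A (if x = 0 then S else insert x S)"
proof -
  note M = Max_insert_image_nat[OF \<open>finite B\<close> x[symmetric]]
  have fS: "finite S" "S \<subseteq> A" using c fin by (auto simp: collected_def intro: finite_subset)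
  show ?thesis
  proof (cases "x = 0")
    case True
    have "A - S = {}" using M(2) True assms(3,6) by (force split: if_splits)
    then have "S = A" using fS by auto
    then show ?thesis using True c by (auto simp: collected_def)
  next
    case False
    then have "x \<in> A - S" using M(3) by (auto split: if_splits)
    moreover have "card S = k" using calculation c by (auto simp: collected_def)
    ultimately show ?thesis using False fS by (auto simp: collected_def)
  qed
qed

definition stage1 :: "nat \<Rightarrow> (nat \<Rightarrow> cstate) \<Rightarrow> bool" where
  "stage1 k c \<longleftrightarrow> (\<forall>u\<in>U. collected k (nb u) (chosen (c u)) \<and> c u = cinit\<lparr>chosen := chosen (c u)\<rparr>)"

lemma stage1_choose:
  assumes "stage1 k c" shows "stage1 (Suc k) (cexec1 nb choose_step c)"
  unfolding stage1_def
proof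
  fix u assume u: "u \<in> U"
  let ?c' = "cexec1 nb choose_step c u"
  define x where "x = Max (insert 0 ((\<lambda>z. if z \<in> chosen (c u) then 0 else z) ` nb u))"
  have e: "?c' = (if x = 0 then c u else (c u)\<lparr>chosen := insert x (chosen (c u))\<rparr>)"
    by (simp add: cexec1_def choose_step_def x_def)
  have c: "collected k (nb u) (chosen (c u))" "c u = cinit\<lparr>chosen := chosen (c u)\<rparr>" using assms u unfolding stage1_def by blast+
  have "x = Max (insert 0 ((\<lambda>z. if z \<in> nb u - chosen (c u) then z else 0) ` nb u))"
    unfolding x_def by (rule arg_cong[where f=Max], rule arg_cong[where f="insert 0"], rule image_cong) auto
  from collected_Suc[OF fin_nb[OF u] c(1) _ this fin_nb[OF u] order_refl] nb0[OF u]
  have "collected (Suc k) (nb u) (if x = 0 then chosen (c u) else insert x (chosen (c u)))" by blast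
  then show "collected (Suc k) (nb u) (chosen ?c') \<and> ?c' = cinit\<lparr>chosen := chosen ?c'\<rparr>"
    using c(2) unfolding e by (cases "c u") (auto simp: cinit_def)
qed

lemma stage1_iter: "stage1 k (cexec nb (replicate k choose_step) (\<lambda>_. cinit))"
proof (induction k)
  case 0
  show ?case by (auto simp: stage1_def collected_def cinit_def)
next
  case (Suc k)
  then show ?case
    by (simp only: replicate_Suc_snoc cexec_simps stage1_choose)
qed

text \<open>Choices of clusters with fewer than \<open>d\<close> neighbours are ignored, as such
  clusters never compete.\<close>

definition choosers :: "(nat \<Rightarrow> cstate) \<Rightarrow> nat \<Rightarrow> nat set" where
  "choosers c y = {z \<in> nb y. card (chosen (c z)) = d \<and> y \<in> chosen (c z)}"

definition stage2 :: "nat \<Rightarrow> (nat \<Rightarrow> cstate) \<Rightarrow> bool" where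
  "stage2 k c \<longleftrightarrow> (\<forall>u\<in>U. collected d (nb u) (chosen (c u)) \<and> collected k (choosers c u) (chosen_by (c u)) \<and>
     c u = cinit\<lparr>chosen := chosen (c u), chosen_by := chosen_by (c u)\<rparr>)"

lemma stage2_0: "stage1 d c \<Longrightarrow> stage2 0 c"
  unfolding stage1_def stage2_def
proof
  fix u assume *: "\<forall>u\<in>U. collected d (nb u) (chosen (c u)) \<and> c u = cinit\<lparr>chosen := chosen (c u)\<rparr>" "u \<in> U"
  then have "c u = cinit\<lparr>chosen := chosen (c u)\<rparr>" by blast
  from arg_cong[OF this, of chosen_by] have "chosen_by (c u) = {}" by (simp add: cinit_def)
  moreover have "collected d (nb u) (chosen (c u))" "c u = cinit\<lparr>chosen := chosen (c u)\<rparr>" using * by blast+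
  ultimately show "collected d (nb u) (chosen (c u)) \<and> collected 0 (choosers c u) (chosen_by (c u)) \<and>
     c u = cinit\<lparr>chosen := chosen (c u), chosen_by := chosen_by (c u)\<rparr>" by (cases "c u") (simp add: collected_def cinit_def)
qed

lemma stage2_chooser:
  assumes "stage2 k c" shows "stage2 (Suc k) (cexec1 nb (chooser_step d) c)"
proof -
  let ?c' = "cexec1 nb (chooser_step d) c"
  define x where "x u = Max (insert 0 ((\<lambda>z. if z \<in> choosers c u - chosen_by (c u) then z else 0) ` nb u))" for u
  have e: "?c' u = (if x u = 0 then c u else (c u)\<lparr>chosen_by := insert (x u) (chosen_by (c u))\<rparr>)" for u
  proof -
    have "(\<lambda>z. if z \<in> choosers c u - chosen_by (c u) then z else 0) ` nb u =
       (\<lambda>z. if (if card (chosen (c z)) = d \<and> u \<in> chosen (c z) then 1 else 0) \<noteq> (0::nat) \<and> z \<notin> chosen_by (c u) then z else 0) ` nb u"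
      by (rule image_cong) (auto simp: choosers_def)
    then show ?thesis by (simp add: cexec1_def chooser_step_def x_def)
  qed
  have che: "chosen (?c' u) = chosen (c u)" for u by (simp add: e)
  have cho: "choosers ?c' = choosers c" by (auto simp: choosers_def che fun_eq_iff)
  show ?thesis unfolding stage2_def cho che
  proof
    fix u assume u: "u \<in> U"
    have c: "collected d (nb u) (chosen (c u))" "collected k (choosers c u) (chosen_by (c u))"
      "c u = cinit\<lparr>chosen := chosen (c u), chosen_by := chosen_by (c u)\<rparr>" using assms u unfolding stage2_def by blast+
    have "choosers c u \<subseteq> nb u" by (auto simp: choosers_def)
    with collected_Suc[OF _ c(2) _ x_def[of u] fin_nb[OF u]] nb0[OF u]
    have "collected (Suc k) (choosers c u) (if x u = 0 then chosen_by (c u) else insert (x u) (chosen_by (c u)))"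
      using finite_subset[OF _ fin_nb[OF u]] by blast
    then show "collected d (nb u) (chosen (c u)) \<and> collected (Suc k) (choosers c u) (chosen_by (?c' u)) \<and>
     ?c' u = cinit\<lparr>chosen := chosen (c u), chosen_by := chosen_by (?c' u)\<rparr>"
      using c(1,3) unfolding e by (cases "c u") (auto simp: cinit_def)
  qed
qed

lemma stage2_iter: "stage2 0 c \<Longrightarrow> stage2 k (cexec nb (replicate k (chooser_step d)) c)"
proof (induction k)
  case (Suc k)
  then show ?case
    by (simp only: replicate_Suc_snoc cexec_simps stage2_chooser)
qed simp

definition heavies :: "(nat \<Rightarrow> cstate) \<Rightarrow> nat set" where
  "heavies c = {y \<in> U. card (chosen_by (c y)) = D}"

definition cands :: "(nat \<Rightarrow> cstate) \<Rightarrow> nat set" where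
  "cands c = {u \<in> U. candidate d D (c u)}"

definition stage3 :: "(nat \<Rightarrow> cstate) \<Rightarrow> bool" where
  "stage3 c \<longleftrightarrow> (\<forall>u\<in>U. collected d (nb u) (chosen (c u)) \<and> collected D (choosers c u) (chosen_by (c u)) \<and>
     (heavy_choice (c u) = 0 \<and> chosen (c u) \<inter> heavies c = {} \<or> heavy_choice (c u) \<in> chosen (c u) \<inter> heavies c))"

lemma stage3_heavy:
  assumes "stage2 D c"
  shows "stage3 (cexec1 nb (heavy_step D) c)" "\<forall>u\<in>U. owner (cexec1 nb (heavy_step D) c u) = 0"
proof -
  let ?c' = "cexec1 nb (heavy_step D) c"
  define x where "x u = Max (insert 0 ((\<lambda>z. if card (chosen_by (c z)) = D \<and> z \<in> chosen (c u) then z else 0) ` nb u))" for u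
  have e: "?c' u = (c u)\<lparr>heavy_choice := x u\<rparr>" for u
  proof -
    have "(\<lambda>z. if card (chosen_by (c z)) = D \<and> z \<in> chosen (c u) then z else 0) ` nb u =
       (\<lambda>z. if (if card (chosen_by (c z)) = D then 1 else 0) \<noteq> (0::nat) \<and> z \<in> chosen (c u) then z else 0) ` nb u"
      by (rule image_cong) auto
    then show ?thesis by (simp add: cexec1_def heavy_step_def x_def)
  qed
  have fld: "chosen (?c' u) = chosen (c u)" "chosen_by (?c' u) = chosen_by (c u)" "heavy_choice (?c' u) = x u" "owner (?c' u) = owner (c u)" for u
    by (simp_all add: e)
  have cho: "choosers ?c' = choosers c" by (auto simp: choosers_def fld fun_eq_iff)
  have hev: "heavies ?c' = heavies c" by (auto simp: heavies_def fld)
  show "\<forall>u\<in>U. owner (?c' u) = 0"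
  proof
    fix u assume "u \<in> U"
    then have "c u = cinit\<lparr>chosen := chosen (c u), chosen_by := chosen_by (c u)\<rparr>" using assms unfolding stage2_def by blast
    from arg_cong[OF this, of owner] have "owner (c u) = 0" by (simp add: cinit_def)
    then show "owner (?c' u) = 0" by (simp add: fld)
  qed
  show "stage3 ?c'" unfolding stage3_def cho hev fld
  proof
    fix u assume u: "u \<in> U"
    have c: "collected d (nb u) (chosen (c u))" "collected D (choosers c u) (chosen_by (c u))"
      using assms u unfolding stage2_def by blast+
    then have sub: "chosen (c u) \<subseteq> nb u" by (auto simp: collected_def)
    note M = Max_insert_image_nat[OF fin_nb[OF u] x_def[of u, symmetric]]
    have "x u = 0 \<and> chosen (c u) \<inter> heavies c = {} \<or> x u \<in> chosen (c u) \<inter> heavies c"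
    proof (cases "x u = 0")
      case True
      have False if "z \<in> chosen (c u) \<inter> heavies c" for z
      proof -
        have "z \<in> nb u" "z \<noteq> 0" using that sub nb0[OF u] by auto
        then show False using M(2)[of z] that True by (simp add: heavies_def)
      qed
      then show ?thesis using True by auto
    next
      case False
      then show ?thesis using M(3) sub nbU[OF u] by (auto simp: heavies_def split: if_splits)
    qed
    with c show "collected d (nb u) (chosen (c u)) \<and> collected D (choosers c u) (chosen_by (c u)) \<and>
      (x u = 0 \<and> chosen (c u) \<inter> heavies c = {} \<or> x u \<in> chosen (c u) \<inter> heavies c)" by blast
  qed
qed

section \<open>Greedy selection of disjoint balls\<close>

definition ball :: "(nat \<Rightarrow> cstate) \<Rightarrow> nat \<Rightarrow> nat set" where
  "ball c u = insert u (chosen (c u))"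

text \<open>Invariant of the selection. The first clause makes the balls of selected clusters
  disjoint, since \<open>owner\<close> is single-valued. The second is maximality: a candidate that
  has had a slot free of rivals is selected itself or has its ball met by a selected one.\<close>

definition slots :: "nat \<Rightarrow> (nat \<Rightarrow> cstate) \<Rightarrow> bool" where
  "slots k c \<longleftrightarrow>
     (\<forall>y\<in>U. owner (c y) \<noteq> 0 \<longrightarrow> owner (c y) \<in> cands c \<and> (\<forall>z\<in>ball c (owner (c y)). owner (c z) = owner (c y)) \<and> y \<in> ball c (owner (c y))) \<and>
     (\<forall>u\<in>cands c. \<forall>s<k. hit u s \<and> (\<forall>y\<in>ball c u. \<forall>z\<in>insert y (chosen_by (c y)). hit z s \<longrightarrow> z = u) \<longrightarrow>
        (\<exists>y\<in>ball c u. owner (c y) \<noteq> 0))"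

lemma slot:
  assumes s3: "stage3 c" and sl: "slots k c"
  defines "c' \<equiv> cexec nb (slot_steps d D hit k) c"
  shows "stage3 c'" "slots (Suc k) c'"
proof -
  define c1 where "c1 = cexec1 nb (ask_step hit k) c"
  have c'_eq: "c' = cexec1 nb (select_step d D hit k) c1" by (simp add: c'_def c1_def slot_steps_def)
  define x1 where "x1 u = Max (insert (if grants hit k u (c u) u then 0 else 1::nat)
     ((\<lambda>z. if z \<in> chosen (c u) then (if grants hit k z (c z) u then 0 else 1) else 0) ` nb u))" for u
  have e1: "c1 u = (c u)\<lparr>refused := x1 u\<rparr>" for u
    by (simp add: c1_def cexec1_def ask_step_def x1_def)
  have fl1: "chosen (c1 u) = chosen (c u)" "chosen_by (c1 u) = chosen_by (c u)" "heavy_choice (c1 u) = heavy_choice (c u)" "owner (c1 u) = owner (c u)"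
    "refused (c1 u) = x1 u" for u by (simp_all add: e1)
  have chnb: "chosen (c u) \<subseteq> nb u" if "u \<in> U" for u using s3 that by (auto simp: stage3_def collected_def)
  have ballU: "ball c u \<subseteq> U" if "u \<in> U" for u using chnb[OF that] nbU[OF that] that by (auto simp: ball_def)
  have x10: "x1 u = 0 \<longleftrightarrow> (\<forall>y\<in>ball c u. grants hit k y (c y) u)" if u: "u \<in> U" for u
  proof -
    note M = Max_insert_image_nat[OF fin_nb[OF u] x1_def[of u, symmetric]]
    show ?thesis
    proof
      assume z: "x1 u = 0"
      show "\<forall>y\<in>ball c u. grants hit k y (c y) u"
        using M(1,2) chnb[OF u] unfolding z ball_def by (force split: if_splits)
    next
      assume "\<forall>y\<in>ball c u. grants hit k y (c y) u"
      then show "x1 u = 0" using M(3) by (auto simp: ball_def)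
    qed
  qed
  define S where "S = {u \<in> U. selected d D hit k u (c1 u)}"
  have cand1: "candidate d D (c1 u) = candidate d D (c u)" for u by (simp add: candidate_def fl1)
  have S: "u \<in> S \<longleftrightarrow> u \<in> cands c \<and> hit u k \<and> (\<forall>y\<in>ball c u. grants hit k y (c y) u)" for u
    using x10 by (auto simp: S_def selected_def cand1 cands_def fl1)
  define x2 where "x2 u = Max (insert (if selected d D hit k u (c1 u) then u else 0)
     ((\<lambda>z. if selected d D hit k z (c1 z) \<and> u \<in> chosen (c z) then z else 0) ` nb u))" for u
  have e2: "c' u = (if x2 u = 0 then c1 u else (c1 u)\<lparr>owner := x2 u\<rparr>)" for u
    by (simp add: c'_eq cexec1_def select_step_def x2_def fl1)
  have fl2: "chosen (c' u) = chosen (c u)" "chosen_by (c' u) = chosen_by (c u)" "heavy_choice (c' u) = heavy_choice (c u)"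
     "owner (c' u) = (if x2 u = 0 then owner (c u) else x2 u)" for u by (simp_all add: e2 fl1)
  have cho: "choosers c' = choosers c" by (auto simp: choosers_def fl2 fun_eq_iff)
  have hev: "heavies c' = heavies c" by (auto simp: heavies_def fl2)
  have cnd: "cands c' = cands c" by (auto simp: cands_def candidate_def fl2)
  have bal: "ball c' = ball c" by (auto simp: ball_def fl2 fun_eq_iff)
  show "stage3 c'" using s3 by (simp add: stage3_def cho hev fl2)
  \<comment> \<open>Several clusters may be selected in the same slot. The ball of a candidate
    contains no heavy cluster, so \<open>chosen_by\<close> of a common member \<open>y\<close> lists
    all its choosers, and the grant that \<open>y\<close> gave to \<open>u\<close> has excluded
    \<open>u'\<close>.\<close>
  have uniq: "u = u'" if "u \<in> S" "u' \<in> S" "y \<in> ball c u" "y \<in> ball c u'" for u u' y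
  proof -
    have U: "u \<in> U" "u' \<in> U" using that by (auto simp: S_def)
    have cu: "u \<in> cands c" using that S by auto
    have y: "y \<in> U" using ballU U that by auto
    have "y \<notin> heavies c"
      using cu that(3) s3 U U0 by (auto simp: cands_def candidate_def ball_def heavies_def stage3_def)
    then have "chosen_by (c y) = choosers c y" using s3 y by (auto simp: stage3_def collected_def heavies_def)
    moreover have "u' \<in> insert y (choosers c y)"
      using that(4) chnb[OF U(2)] nb_sym[OF U(2)] that(2) S[of u']
      by (auto simp: ball_def choosers_def cands_def candidate_def)
    moreover have "grants hit k y (c y) u" "hit u' k" using S that by auto
    ultimately show ?thesis by (auto simp: grants_def)
  qed
  \<comment> \<open>By \<open>uniq\<close> the maximum formed at \<open>y\<close> meets a single
    nonzero identifier, so nothing is lost by taking a maximum.\<close>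
  have x2S: "x2 y = u" if "u \<in> S" "y \<in> ball c u" for u y
  proof -
    have U: "u \<in> U" using that by (auto simp: S_def)
    have y: "y \<in> U" using ballU U that by auto
    note M = Max_insert_image_nat[OF fin_nb[OF y] x2_def[of y, symmetric]]
    have nz: "u \<noteq> 0" using U U0 by metis
    have "u \<le> x2 y"
    proof (cases "y = u")
      case True then show ?thesis using M(1) that(1) by (auto simp: S_def)
    next
      case False
      then have "y \<in> chosen (c u)" using that by (auto simp: ball_def)
      moreover have "u \<in> nb y" using chnb[OF U] nb_sym[OF U] calculation by auto
      ultimately show ?thesis using M(2)[of u] that(1) by (auto simp: S_def)
    qed
    then have "x2 y \<noteq> 0" using nz by auto
    with M(3) have "x2 y \<in> S \<and> y \<in> ball c (x2 y)"
      using y nbU[OF y] by (auto simp: S_def ball_def split: if_splits)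
    then show ?thesis using uniq that by blast
  qed
  have x2n: "\<exists>u\<in>S. y \<in> ball c u \<and> x2 y = u" if y: "y \<in> U" "x2 y \<noteq> 0" for y
  proof -
    note M = Max_insert_image_nat[OF fin_nb[OF y(1)] x2_def[of y, symmetric]]
    from M(3) y have "x2 y \<in> S \<and> y \<in> ball c (x2 y)"
      using nbU[OF y(1)] by (auto simp: S_def ball_def split: if_splits)
    then show ?thesis by blast
  qed
  \<comment> \<open>A grant requires an unowned cluster, so a new ball never overwrites an older
    one.\<close>
  have fresh: "owner (c y) = 0" if "u \<in> S" "y \<in> ball c u" for u y
    using S that by (auto simp: grants_def)
  have A: "owner (c' y) \<in> cands c \<and> (\<forall>z\<in>ball c (owner (c' y)). owner (c' z) = owner (c' y)) \<and> y \<in> ball c (owner (c' y))"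
    if y: "y \<in> U" "owner (c' y) \<noteq> 0" for y
  proof (cases "x2 y = 0")
    case False
    then obtain u where u: "u \<in> S" "y \<in> ball c u" "x2 y = u" using x2n y by blast
    then show ?thesis using x2S S U0 False by (auto simp: fl2 S_def)
  next
    case True
    then have oy: "owner (c' y) = owner (c y)" "owner (c y) \<noteq> 0" using y by (auto simp: fl2)
    then have *: "owner (c y) \<in> cands c" "\<forall>z\<in>ball c (owner (c y)). owner (c z) = owner (c y)" "y \<in> ball c (owner (c y))"
      using sl y(1) unfolding slots_def by blast+
    have "owner (c' z) = owner (c y)" if z: "z \<in> ball c (owner (c y))" for z
    proof -
      have "z \<in> U" using ballU *(1) z by (auto simp: cands_def)
      moreover have oz: "owner (c z) = owner (c y)" using *(2) z by blast
      ultimately have "x2 z = 0" using x2n[of z] fresh[of _ z] oy(2) by metis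
      then show ?thesis by (simp add: fl2(4) oz)
    qed
    then show ?thesis unfolding oy(1) using *(1,3) by blast
  qed
  have B: "\<exists>y\<in>ball c u. owner (c' y) \<noteq> 0"
    if u: "u \<in> cands c" "s < Suc k" "hit u s" "\<forall>y\<in>ball c u. \<forall>z\<in>insert y (chosen_by (c y)). hit z s \<longrightarrow> z = u" for u s
  proof (cases "\<exists>y\<in>ball c u. owner (c y) \<noteq> 0")
    case True
    then show ?thesis by (auto simp: fl2)
  next
    case False
    then have "\<not> s < k" using sl u(1,3,4) unfolding slots_def by blast
    then have "s = k" using u(2) by simp
    then have "u \<in> S" using u False by (auto simp: S grants_def)
    then show ?thesis using x2S[of u u] U0 by (auto simp: ball_def fl2 S_def)
  qed
  show "slots (Suc k) c'" unfolding slots_def cnd bal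
  proof (rule conjI)
    show "\<forall>y\<in>U. owner (c' y) \<noteq> 0 \<longrightarrow> owner (c' y) \<in> cands c \<and>
        (\<forall>z\<in>ball c (owner (c' y)). owner (c' z) = owner (c' y)) \<and> y \<in> ball c (owner (c' y))"
      using A by blast
    show "\<forall>u\<in>cands c. \<forall>s<Suc k. hit u s \<and> (\<forall>y\<in>ball c u. \<forall>z\<in>insert y (chosen_by (c' y)). hit z s \<longrightarrow> z = u) \<longrightarrow>
        (\<exists>y\<in>ball c u. owner (c' y) \<noteq> 0)"
      using B unfolding fl2(2) by blast
  qed
qed

lemma slots_iter:
  "stage3 c \<Longrightarrow> slots 0 c \<Longrightarrow>
    stage3 (cexec nb (concat (map (slot_steps d D hit) [0..<k])) c) \<and>
    slots k (cexec nb (concat (map (slot_steps d D hit) [0..<k])) c)"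
  by (induction k) (simp_all add: slot)

section \<open>Number of centres and correctness of the assignment to them\<close>

abbreviation "result \<equiv> cexec nb (phase_steps d D M hit) (\<lambda>_. cinit)"

abbreviation "ncen u \<equiv> new_center d D u (result u)"

lemma result_slots:
  obtains c where "stage3 c" "slots M c" "result = cexec1 nb join_step c"
proof -
  define c1 where "c1 = cexec nb (replicate d choose_step) (\<lambda>_. cinit)"
  define c2 where "c2 = cexec nb (replicate D (chooser_step d)) c1"
  define c3 where "c3 = cexec1 nb (heavy_step D) c2"
  define c4 where "c4 = cexec nb (concat (map (slot_steps d D hit) [0..<M])) c3"
  have "stage2 D c2" unfolding c2_def c1_def using stage1_iter stage2_0 stage2_iter by blast
  note * = stage3_heavy[OF this, folded c3_def]
  have "slots 0 c3" using *(2) by (auto simp: slots_def)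
  with *(1) have "stage3 c4" "slots M c4" unfolding c4_def using slots_iter by blast+
  moreover have "result = cexec1 nb join_step c4"
    by (simp add: phase_steps_def c1_def c2_def c3_def c4_def)
  ultimately show thesis using that by blast
qed

definition centers :: "(nat \<Rightarrow> cstate) \<Rightarrow> nat set" where
  "centers c = heavies c \<union> {u \<in> U. owner (c u) = u}"

lemma card_centers:
  assumes s3: "stage3 c" and sl: "slots M c" and DD: "D = 32 * d * d"
  shows "real (card (centers c)) \<le> real (card U) * (17 / 16) / real (d + 1)"
proof -
  have fch: "finite (chosen (c u))" "card (chosen (c u)) \<le> d" "chosen (c u) \<subseteq> U" if "u \<in> U" for u
  proof -
    have *: "chosen (c u) \<subseteq> nb u" "card (chosen (c u)) = d \<or> card (chosen (c u)) < d"
      using s3 that unfolding stage3_def collected_def by blast+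
    then show "finite (chosen (c u))" "card (chosen (c u)) \<le> d" "chosen (c u) \<subseteq> U"
      using finite_subset[OF *(1) fin_nb[OF that]] nbU[OF that] by auto
  qed
  \<comment> \<open>Double counting of pairs of a cluster and one of its choices: a heavy cluster
    accounts for at least \<open>D\<close> of them, and every cluster makes at most
    \<open>d\<close>.\<close>
  have "card (heavies c) * D = (\<Sum>y\<in>heavies c. card (chosen_by (c y)))" by (simp add: heavies_def)
  also have "\<dots> \<le> (\<Sum>y\<in>heavies c. card {z\<in>U. y \<in> chosen (c z)})"
  proof (rule sum_mono, rule card_mono)
    fix y assume "y \<in> heavies c"
    then have y: "y \<in> U" by (simp add: heavies_def)
    then have "chosen_by (c y) \<subseteq> choosers c y" using s3 unfolding stage3_def collected_def by blast
    then show "chosen_by (c y) \<subseteq> {z\<in>U. y \<in> chosen (c z)}"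
      using nbU[OF y] unfolding choosers_def by blast
  qed (use finU in auto)
  also have "\<dots> \<le> (\<Sum>y\<in>U. card {z\<in>U. y \<in> chosen (c z)})"
    by (rule sum_mono2) (use finU in \<open>auto simp: heavies_def\<close>)
  also have "\<dots> = (\<Sum>z\<in>U. card {y\<in>U. y \<in> chosen (c z)})"
    by (rule sum_multicount_gen[OF finU finU]) simp
  also have "\<dots> \<le> (\<Sum>z\<in>U. d)"
  proof (rule sum_mono)
    fix z assume z: "z \<in> U"
    have "{y\<in>U. y \<in> chosen (c z)} = chosen (c z)" using fch[OF z] by auto
    then show "card {y\<in>U. y \<in> chosen (c z)} \<le> d" using fch[OF z] by simp
  qed
  finally have "card (heavies c) * (32 * d * d) \<le> card U * d" by (simp add: DD)
  then have h: "card (heavies c) * (32 * d) \<le> card U" using d1 by (simp add: mult.assoc[symmetric])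
  define S where "S = {u \<in> U. owner (c u) = u}"
  have Sc: "u \<in> cands c" "\<forall>z\<in>ball c u. owner (c z) = u" if "u \<in> S" for u
  proof -
    have *: "u \<in> U" "owner (c u) = u" using that by (simp_all add: S_def)
    then have "owner (c u) \<noteq> 0" using U0 by metis
    then have "owner (c u) \<in> cands c \<and> (\<forall>z\<in>ball c (owner (c u)). owner (c z) = owner (c u))"
      using sl *(1) unfolding slots_def by blast
    then show "u \<in> cands c" "\<forall>z\<in>ball c u. owner (c z) = u" unfolding *(2) by blast+
  qed
  have fS: "finite S" using finU by (auto simp: S_def)
  have "card S * (d + 1) = (\<Sum>u\<in>S. card (ball c u))"
  proof -
    have "card (ball c u) = d + 1" if "u \<in> S" for u
    proof -
      have u: "u \<in> U" using that by (auto simp: S_def)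
      have "u \<notin> chosen (c u)" using nb_irrefl[OF u] s3 u by (auto simp: stage3_def collected_def)
      then show ?thesis using Sc(1)[OF that] fch[OF u] by (auto simp: ball_def cands_def candidate_def)
    qed
    then show ?thesis by simp
  qed
  also have "\<dots> = card (\<Union>u\<in>S. ball c u)"
  proof (rule card_UN_disjoint[symmetric, OF fS])
    show "\<forall>u\<in>S. finite (ball c u)" using fch by (auto simp: ball_def S_def)
    show "\<forall>u\<in>S. \<forall>v\<in>S. u \<noteq> v \<longrightarrow> ball c u \<inter> ball c v = {}"
      using Sc(2) by (metis disjoint_iff)
  qed
  also have "\<dots> \<le> card U" using fch(3) by (intro card_mono[OF finU]) (auto simp: S_def ball_def)
  finally have s: "card S * (d + 1) \<le> card U" .
  have "card (centers c) \<le> card (heavies c) + card S" unfolding centers_def S_def by (rule card_Un_le)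
  then have "real (card (centers c)) * real (d + 1) \<le> (real (card (heavies c)) + real (card S)) * real (d + 1)"
    by (intro mult_right_mono) linarith+
  also have "\<dots> \<le> real (card U) / 16 + real (card U)"
  proof -
    have "real (card (heavies c)) * real (d + 1) \<le> real (card (heavies c)) * (2 * real d)"
      using d1 by (intro mult_left_mono) auto
    moreover have "real (card (heavies c) * (32 * d)) \<le> real (card U)" using h by (rule of_nat_mono)
    moreover have "real (card S * (d + 1)) \<le> real (card U)" using s by (rule of_nat_mono)
    ultimately show ?thesis by (simp add: algebra_simps)
  qed
  finally show ?thesis by (simp add: field_simps)
qed

text \<open>A centre is at most two hops away, and on a path of two hops the middle cluster joins
  the same centre. Thus the connecting walk stays inside the new supercluster, which is what the
  radius bound needs.\<close>

lemma phase_correct: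
  shows ncen_center: "\<And>u. u \<in> U \<Longrightarrow> ncen u \<noteq> 0 \<Longrightarrow> ncen u \<in> U \<and> ncen (ncen u) = ncen u \<and>
      (u = ncen u \<or> u \<in> nb (ncen u) \<or> (\<exists>z\<in>nb (ncen u). u \<in> nb z \<and> ncen z = ncen u))"
    and ncen_retired: "\<And>u. u \<in> U \<Longrightarrow> ncen u = 0 \<Longrightarrow> chosen (result u) = nb u \<and> card (nb u) < d"
    and card_ncen: "D = 32 * d * d \<Longrightarrow>
      real (card (ncen ` U - {0})) \<le> real (card U) * (17 / 16) / real (d + 1)"
proof -
  obtain c where s3: "stage3 c" and sl: "slots M c" and res: "result = cexec1 nb join_step c"
    by (rule result_slots)
  define x where "x u = Max (insert 0 ((\<lambda>z. if z \<in> chosen (c u) then owner (c z) else 0) ` nb u))" for u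
  have e: "result u = (c u)\<lparr>far_owner := x u\<rparr>" for u unfolding res
    by (simp add: cexec1_def join_step_def x_def)
  have nc: "ncen u = (if card (chosen_by (c u)) = D \<or> owner (c u) = u then u else if owner (c u) \<noteq> 0 then owner (c u)
      else if card (chosen (c u)) = d then (if heavy_choice (c u) \<noteq> 0 then heavy_choice (c u) else x u) else 0)" for u
    by (simp add: new_center_def e)
  have chnb: "chosen (c u) \<subseteq> nb u" "card (chosen (c u)) \<le> d" if "u \<in> U" for u
  proof -
    have "chosen (c u) \<subseteq> nb u" "card (chosen (c u)) = d \<or> card (chosen (c u)) < d"
      using s3 that unfolding stage3_def collected_def by blast+
    then show "chosen (c u) \<subseteq> nb u" "card (chosen (c u)) \<le> d" by auto
  qed
  have ballU: "ball c u \<subseteq> U" if "u \<in> U" for u using chnb[OF that] nbU[OF that] that by (auto simp: ball_def)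
  have own: "owner (c y) \<in> cands c" "\<forall>z\<in>ball c (owner (c y)). owner (c z) = owner (c y)" "y \<in> ball c (owner (c y))"
    "owner (c (owner (c y))) = owner (c y)" "owner (c y) \<in> U"
    if y: "y \<in> U" "owner (c y) \<noteq> 0" for y
  proof -
    show *: "owner (c y) \<in> cands c" "\<forall>z\<in>ball c (owner (c y)). owner (c z) = owner (c y)" "y \<in> ball c (owner (c y))"
      using y sl unfolding slots_def by blast+
    show "owner (c (owner (c y))) = owner (c y)" by (rule bspec[OF *(2)]) (simp add: ball_def)
    show "owner (c y) \<in> U" using *(1) unfolding cands_def by blast
  qed
  have cand_ow: "\<exists>y\<in>ball c u. owner (c y) \<noteq> 0" if u: "u \<in> cands c" for u
  proof -
    have uU: "u \<in> U" using u by (auto simp: cands_def)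
    \<comment> \<open>\<open>Z\<close> contains every cluster that could spoil a slot for
      \<open>u\<close>. No cluster of the ball is heavy, so each contributes itself and fewer than
      \<open>D\<close> choosers.\<close>
    define Z where "Z = (\<Union>y\<in>ball c u. insert y (chosen_by (c y))) - {u}"
    have crU: "chosen_by (c y) \<subseteq> U" "card (chosen_by (c y)) \<le> D" if "y \<in> U" for y
    proof -
      have "chosen_by (c y) \<subseteq> choosers c y" "card (chosen_by (c y)) = D \<or> card (chosen_by (c y)) < D"
        using s3 that unfolding stage3_def collected_def by blast+
      then show "chosen_by (c y) \<subseteq> U" "card (chosen_by (c y)) \<le> D" using nbU[OF that] by (auto simp: choosers_def)
    qed
    have "card (insert y (chosen_by (c y))) \<le> D" if y: "y \<in> ball c u" for y
    proof -
      have yU: "y \<in> U" using ballU[OF uU] y by blast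
      have "y \<notin> heavies c"
      proof (cases "y = u")
        case True then show ?thesis using u by (simp add: cands_def candidate_def heavies_def)
      next
        case False
        then have "y \<in> chosen (c u)" using y by (simp add: ball_def)
        moreover have "heavy_choice (c u) = 0" using u by (simp add: cands_def candidate_def)
        moreover have "heavy_choice (c u) = 0 \<and> chosen (c u) \<inter> heavies c = {} \<or> heavy_choice (c u) \<in> heavies c"
          using s3 uU unfolding stage3_def by blast
        moreover have "0 \<notin> heavies c" using U0 by (simp add: heavies_def)
        ultimately show ?thesis by auto
      qed
      then have "card (chosen_by (c y)) < D" using crU[OF yU] yU by (simp add: heavies_def order_le_less)
      then show ?thesis using D1 by (intro card_insert_le_m1) auto
    qed
    then have "(\<Sum>y\<in>ball c u. card (insert y (chosen_by (c y)))) \<le> card (ball c u) * D"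
      using sum_bounded_above[of "ball c u" "\<lambda>y. card (insert y (chosen_by (c y)))" D] by simp
    then have "card (\<Union>y\<in>ball c u. insert y (chosen_by (c y))) \<le> card (ball c u) * D"
      using card_UN_le[OF finite_subset[OF ballU[OF uU] finU], of "\<lambda>y. insert y (chosen_by (c y))"] by linarith
    moreover have "card (ball c u) \<le> d + 1"
      unfolding ball_def by (rule card_insert_le_m1) (use chnb[OF uU] in auto)
    ultimately have le: "card (\<Union>y\<in>ball c u. insert y (chosen_by (c y))) \<le> (d + 1) * D"
      by (meson le_trans mult_le_mono1)
    have ZU: "(\<Union>y\<in>ball c u. insert y (chosen_by (c y))) \<subseteq> U"
      using ballU[OF uU] crU(1) by (intro UN_least insert_subsetI) blast+
    have "card Z \<le> card (\<Union>y\<in>ball c u. insert y (chosen_by (c y)))"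
      unfolding Z_def by (rule card_mono[OF finite_subset[OF ZU finU]]) (rule Diff_subset)
    moreover have "Z \<subseteq> U - {u}" using ZU unfolding Z_def by blast
    ultimately obtain s where s: "s < M" "hit u s" "\<forall>z\<in>Z. \<not> hit z s"
      using sel[OF uU, of Z] le by fastforce
    then have "\<forall>y\<in>ball c u. \<forall>z\<in>insert y (chosen_by (c y)). hit z s \<longrightarrow> z = u"
      unfolding Z_def by blast
    then show ?thesis using sl u s(1,2) unfolding slots_def by blast
  qed
  have xprop: "\<exists>y\<in>chosen (c u). x u = owner (c y) \<and> owner (c y) \<noteq> 0" if u: "u \<in> U" "x u \<noteq> 0" for u
    using Max_insert_image_nat(3)[OF fin_nb[OF u(1)] x_def[of u, symmetric]] u(2)
    by (auto split: if_splits)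
  have xpos: "x u \<noteq> 0" if u: "u \<in> cands c" "owner (c u) = 0" for u
  proof -
    have uU: "u \<in> U" using u by (auto simp: cands_def)
    obtain y where "y \<in> chosen (c u)" "owner (c y) \<noteq> 0" using cand_ow[OF u(1)] u(2) by (auto simp: ball_def)
    then show ?thesis using Max_insert_image_nat(2)[OF fin_nb[OF uU] x_def[of u, symmetric], of y] chnb[OF uU] by auto
  qed
  have hvp: "heavy_choice (c u) = 0 \<and> chosen (c u) \<inter> heavies c = {} \<or> heavy_choice (c u) \<in> chosen (c u) \<inter> heavies c" if "u \<in> U" for u
    using s3 that unfolding stage3_def by blast
  have cen: "ncen u = u" if "u \<in> centers c" for u using that by (auto simp: nc centers_def heavies_def)
  have own_cen: "owner (c y) \<in> centers c" if "y \<in> U" "owner (c y) \<noteq> 0" for y using own(4,5)[OF that] by (simp add: centers_def)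
  have main: "ncen u \<in> centers c \<and>
      (u = ncen u \<or> u \<in> nb (ncen u) \<or> (\<exists>z\<in>nb (ncen u). u \<in> nb z \<and> ncen z = ncen u))"
    if u: "u \<in> U" "ncen u \<noteq> 0" for u
  proof -
    consider "u \<in> centers c" | "u \<notin> centers c" "owner (c u) \<noteq> 0"
      | "u \<notin> centers c" "owner (c u) = 0" "card (chosen (c u)) = d" "heavy_choice (c u) \<noteq> 0"
      | "u \<notin> centers c" "owner (c u) = 0" "card (chosen (c u)) = d" "heavy_choice (c u) = 0" "x u \<noteq> 0"
      using u unfolding nc centers_def heavies_def by (auto split: if_splits)
    then show ?thesis
    proof cases
      case 1 then show ?thesis using cen by auto
    next
      case 2
      then have "ncen u = owner (c u)" using u by (auto simp: nc centers_def heavies_def)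
      moreover have "u \<in> nb (owner (c u))"
        using own(3,5)[OF u(1) 2(2)] chnb(1)[of "owner (c u)"] 2(1) u unfolding ball_def centers_def by auto
      ultimately show ?thesis using own_cen[OF u(1) 2(2)] by simp
    next
      case 3
      then have n: "ncen u = heavy_choice (c u)" using u U0 by (auto simp: nc centers_def heavies_def)
      have "heavy_choice (c u) \<in> chosen (c u) \<inter> heavies c" using hvp[OF u(1)] 3 by auto
      moreover have "u \<in> nb (heavy_choice (c u))" using calculation chnb[OF u(1)] nb_sym[OF u(1)] by auto
      ultimately show ?thesis using n by (auto simp: centers_def)
    next
      case 4
      then have n: "ncen u = x u" using u U0 by (auto simp: nc centers_def heavies_def)
      obtain y where y: "y \<in> chosen (c u)" "x u = owner (c y)" "owner (c y) \<noteq> 0" using xprop u 4 by blast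
      have ynb: "y \<in> nb u" "y \<in> U" using y chnb[OF u(1)] nbU[OF u(1)] by auto
      have uy: "u \<in> nb y" using nb_sym[OF u(1)] ynb by auto
      \<comment> \<open>A heavy \<open>y\<close> would be its own centre instead of following its
        owner.\<close>
      have "y \<notin> heavies c" using hvp[OF u(1)] 4(4) y(1) U0 unfolding heavies_def by auto
      then have "ncen y = owner (c y)" using y(3) ynb by (auto simp: nc heavies_def)
      moreover have "y = owner (c y) \<or> y \<in> nb (owner (c y))"
        using own(3,5)[OF ynb(2) y(3)] chnb(1)[of "owner (c y)"] unfolding ball_def by blast
      ultimately show ?thesis using n y uy own_cen[OF ynb(2) y(3)] by auto
    qed
  qed
  have cenU: "centers c \<subseteq> U" by (auto simp: centers_def heavies_def)
  show "ncen u \<in> U \<and> ncen (ncen u) = ncen u \<and>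
      (u = ncen u \<or> u \<in> nb (ncen u) \<or> (\<exists>z\<in>nb (ncen u). u \<in> nb z \<and> ncen z = ncen u))"
    if "u \<in> U" "ncen u \<noteq> 0" for u
    using main[OF that] cen cenU by blast
  show "chosen (result u) = nb u \<and> card (nb u) < d" if u: "u \<in> U" "ncen u = 0" for u
  proof -
    have *: "card (chosen_by (c u)) \<noteq> D" "owner (c u) = 0" "card (chosen (c u)) = d \<Longrightarrow> heavy_choice (c u) = 0 \<and> x u = 0"
      using u U0 by (auto simp: nc split: if_splits)
    \<comment> \<open>With \<open>d\<close> choices and no heavy one, \<open>u\<close> would be a
      candidate, and a candidate always finds an owner in its ball. So a retiring cluster has run
      out of neighbours to choose.\<close>
    have "card (chosen (c u)) \<noteq> d"
    proof
      assume h: "card (chosen (c u)) = d"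
      then have "u \<in> cands c" using * u by (simp add: cands_def candidate_def)
      then have "x u \<noteq> 0" using *(2) by (rule xpos)
      then show False using *(3)[OF h] by simp
    qed
    moreover have "card (chosen (c u)) = d \<or> card (chosen (c u)) < d \<and> chosen (c u) = nb u"
      using s3 u(1) unfolding stage3_def collected_def by blast
    ultimately show ?thesis by (auto simp: e)
  qed
  show "real (card (ncen ` U - {0})) \<le> real (card U) * (17 / 16) / real (d + 1)" if DD: "D = 32 * d * d"
  proof -
    have "card (ncen ` U - {0}) \<le> card (centers c)"
      using main finite_subset[OF cenU finU] by (intro card_mono) auto
    then show ?thesis using card_centers[OF s3 sl DD] by (meson of_nat_mono order_trans)
  qed
qed

end

section \<open>One phase in the network\<close>

text \<open>\<open>vpc\<close> lists, port by port, the clusters of the active neighbours (0 for the others); \<open>vpend\<close> are the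
  ports to be marked in case the cluster retires, \<open>vmk\<close> the ports of spanner edges.\<close>

record vstate =
  vid :: nat
  vcl :: nat
  vact :: bool
  vpc :: "nat list"
  vcs :: cstate
  vpend :: "nat set"
  vmk :: "nat set"

definition msg_val :: "msg \<Rightarrow> nat" where
  "msg_val m = (if m = [] then 0 else hd m)"

definition contact_step :: "(vstate \<times> nat) step" where
  "contact_step =
     ((\<lambda>\<sigma> p. if vact (fst \<sigma>) then [vcl (fst \<sigma>)] else []),
      (\<lambda>\<sigma> ms. ((fst \<sigma>)\<lparr>vpc := map (\<lambda>m. if vact (fst \<sigma>) then msg_val m else 0) ms, vcs := cinit, vpend := {}\<rparr>, 0)))"

definition foreign :: "vstate \<Rightarrow> nat \<Rightarrow> bool" where
  "foreign \<sigma> p \<longleftrightarrow> vpc \<sigma> ! p \<noteq> 0 \<and> vpc \<sigma> ! p \<noteq> vcl \<sigma>"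

definition sim_msg :: "cstep \<Rightarrow> vstate \<Rightarrow> nat \<Rightarrow> msg" where
  "sim_msg q \<sigma> p = (if foreign \<sigma> p \<and> cmsg q (vcl \<sigma>) (vcs \<sigma>) (vpc \<sigma> ! p) \<noteq> 0
     then [cmsg q (vcl \<sigma>) (vcs \<sigma>) (vpc \<sigma> ! p)] else [])"

definition sim_prop :: "cstep \<Rightarrow> vstate \<Rightarrow> msg list \<Rightarrow> nat" where
  "sim_prop q \<sigma> ms = (if vact \<sigma> then
     Max (insert (cself q (vcl \<sigma>) (vcs \<sigma>))
       ((\<lambda>p. crecv q (vcl \<sigma>) (vcs \<sigma>) (vpc \<sigma> ! p) (msg_val (ms ! p))) ` {p. p < length ms \<and> foreign \<sigma> p}))
     else 0)"

definition sim_store :: "cstep \<Rightarrow> vstate \<Rightarrow> nat \<Rightarrow> vstate" where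
  "sim_store q \<sigma> x = \<sigma>\<lparr>vcs := cstore q (vcs \<sigma>) x\<rparr>"

text \<open>All members of an active cluster hold the same chosen set, so its sorted list gives them
  a common numbering; 0 marks the end of the list.\<close>

definition target :: "nat \<Rightarrow> cstate \<Rightarrow> nat" where
  "target k c = (if k < card (chosen c) then sorted_list_of_set (chosen c) ! k else 0)"

definition mark_prop :: "nat \<Rightarrow> vstate \<Rightarrow> msg list \<Rightarrow> nat" where
  "mark_prop k \<sigma> ms = (if vact \<sigma> \<and> target k (vcs \<sigma>) \<noteq> 0 \<and> target k (vcs \<sigma>) \<in> set (vpc \<sigma>) then vid \<sigma> else 0)"

definition port_of :: "'a list \<Rightarrow> 'a \<Rightarrow> nat" where
  "port_of pc z = (LEAST p. p < length pc \<and> pc ! p = z)"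

definition mark_store :: "nat \<Rightarrow> vstate \<Rightarrow> nat \<Rightarrow> vstate" where
  "mark_store k \<sigma> x = (if x = vid \<sigma> then \<sigma>\<lparr>vpend := insert (port_of (vpc \<sigma>) (target k (vcs \<sigma>))) (vpend \<sigma>)\<rparr> else \<sigma>)"

definition regroup :: "nat \<Rightarrow> nat \<Rightarrow> vstate \<Rightarrow> vstate" where
  "regroup d D \<sigma> = (if vact \<sigma> then
     (if new_center d D (vcl \<sigma>) (vcs \<sigma>) = 0 then \<sigma>\<lparr>vact := False, vmk := vmk \<sigma> \<union> vpend \<sigma>\<rparr>
      else \<sigma>\<lparr>vcl := new_center d D (vcl \<sigma>) (vcs \<sigma>)\<rparr>) else \<sigma>)"

lemma port_of:
  assumes "z \<in> set pc"
  shows "port_of pc z < length pc \<and> pc ! port_of pc z = z"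
  unfolding port_of_def by (rule LeastI_ex) (use assms in \<open>auto simp: in_set_conv_nth\<close>)

definition sim_step :: "nat \<Rightarrow> cstep \<Rightarrow> (vstate \<times> nat) step list" where
  "sim_step T q = agg vcl (sim_msg q) (sim_prop q) (sim_store q) T"

definition mark_step :: "nat \<Rightarrow> nat \<Rightarrow> (vstate \<times> nat) step list" where
  "mark_step T k = agg vcl (\<lambda>_ _. []) (mark_prop k) (mark_store k) T"

definition phase_prog :: "nat \<Rightarrow> nat \<Rightarrow> nat \<Rightarrow> (nat \<Rightarrow> nat \<Rightarrow> bool) \<Rightarrow> nat \<Rightarrow> (vstate \<times> nat) step list" where
  "phase_prog d D M hit T =
     contact_step # concat (map (sim_step T) (phase_steps d D M hit)) @ concat (map (mark_step T) [0..<d]) @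
     [((\<lambda>\<sigma> p. []), (\<lambda>\<sigma> ms. (regroup d D (fst \<sigma>), 0)))]"

lemma length_phase_prog:
  "length (phase_prog d D M hit T) = 2 + (2 * d + D + 2 + 2 * M) * (T + 2)"
proof -
  have "length (concat (map (slot_steps d D hit) [0..<M])) = 2 * M"
    by (induction M) (simp_all add: slot_steps_def)
  then have "length (phase_steps d D M hit) = d + D + 2 + 2 * M" by (simp add: phase_steps_def)
  moreover have "length (concat (map (sim_step T) qs)) = length qs * (T + 2)" for qs
    by (induction qs) (simp_all add: sim_step_def)
  moreover have "length (concat (map (mark_step T) ks)) = length ks * (T + 2)" for ks
    by (induction ks) (simp_all add: mark_step_def)
  ultimately show ?thesis by (simp add: phase_prog_def algebra_simps)
qed

context congest
begin

definition sim :: "(nat \<Rightarrow> vstate \<times> nat) \<Rightarrow> (nat \<Rightarrow> vstate) \<Rightarrow> bool" where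
  "sim s r \<longleftrightarrow> (\<forall>v\<in>V. s v = (r v, 0))"

definition marked :: "(nat \<Rightarrow> vstate) \<Rightarrow> nat set set" where
  "marked r = {{v, nbrs N v ! p} | v p. v \<in> V \<and> p \<in> vmk (r v)}"

text \<open>The last clause drives the stretch proof: once nothing is active, every edge lies inside
  a cluster or is bypassed by a marked edge between the same two clusters.\<close>

definition clustering :: "nat \<Rightarrow> (nat \<Rightarrow> vstate) \<Rightarrow> bool" where
  "clustering R r \<longleftrightarrow>
     (\<forall>v\<in>V. vid (r v) = ident N v) \<and>
     (\<forall>v\<in>V. \<exists>c\<in>V. ident N c = vcl (r v) \<and> vcl (r c) = vcl (r v) \<and> v \<in> near (\<lambda>v. vcl (r v)) R c) \<and>
     (\<forall>v\<in>V. \<forall>w\<in>V. vcl (r v) = vcl (r w) \<longrightarrow> vact (r v) = vact (r w)) \<and>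
     (\<forall>v\<in>V. vmk (r v) \<subseteq> {..<length (nbrs N v)}) \<and>
     (\<forall>v w. {v, w} \<in> E \<longrightarrow> vact (r v) \<and> vact (r w) \<or> vcl (r v) = vcl (r w) \<or>
        (\<exists>v1 w1. {v1, w1} \<in> marked r \<and> v1 \<in> V \<and> w1 \<in> V \<and> vcl (r v1) = vcl (r v) \<and> vcl (r w1) = vcl (r w)))"

definition active_clusters :: "(nat \<Rightarrow> vstate) \<Rightarrow> nat set" where
  "active_clusters r = (\<lambda>v. vcl (r v)) ` {v \<in> V. vact (r v)}"

end

section \<open>Simulation of the abstract cluster machine in the network\<close>

locale phase = congest +
  fixes r :: "nat \<Rightarrow> vstate" and R d D M :: nat and hit :: "nat \<Rightarrow> nat \<Rightarrow> bool"
  assumes clustering: "clustering R r"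
    and d1: "1 \<le> d" and D_eq: "D = 32 * d * d"
    and selective: "\<And>u Z. u \<in> {1..K} \<Longrightarrow> Z \<subseteq> {1..K} - {u} \<Longrightarrow> card Z \<le> (d + 1) * D \<Longrightarrow>
        \<exists>s<M. hit u s \<and> (\<forall>z\<in>Z. \<not> hit z s)"
begin

abbreviation "cl \<equiv> \<lambda>v. vcl (r v)"
definition "A = {v \<in> V. vact (r v)}"
abbreviation "U \<equiv> active_clusters r"

definition nb :: "nat \<Rightarrow> nat set" where
  "nb u = {z. z \<noteq> u \<and> (\<exists>v\<in>A. \<exists>w\<in>A. {v, w} \<in> E \<and> cl v = u \<and> cl w = z)}"

lemma U_def: "U = cl ` A" by (simp add: active_clusters_def A_def)

lemma AV: "v \<in> A \<Longrightarrow> v \<in> V" by (simp add: A_def)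

lemma vid_r: "v \<in> V \<Longrightarrow> vid (r v) = ident N v"
  using clustering by (simp add: clustering_def)

lemma center:
  assumes "v \<in> V"
  obtains c where "c \<in> V" "ident N c = cl v" "cl c = cl v" "v \<in> near cl R c"
  using assms clustering unfolding clustering_def by blast

lemma act_cl: "v \<in> V \<Longrightarrow> w \<in> V \<Longrightarrow> cl v = cl w \<Longrightarrow> v \<in> A \<longleftrightarrow> w \<in> A"
  using clustering unfolding clustering_def A_def by blast

lemma cl_bounds: "v \<in> V \<Longrightarrow> cl v \<in> {1..K}"
  by (metis center ident_bounds)

lemma diam:
  assumes v: "v \<in> V" and w: "w \<in> V" and eq: "cl w = cl v"
  shows "w \<in> near cl (2 * R) v"
proof -
  obtain c where c: "c \<in> V" "ident N c = cl v" "v \<in> near cl R c" using center[OF v] by metis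
  obtain c' where c': "c' \<in> V" "ident N c' = cl w" "w \<in> near cl R c'" using center[OF w] by metis
  have "c = c'" using c c' eq ident_inj by metis
  then show ?thesis using near_trans[OF near_sym[OF c(3)]] c'(3) by (simp add: mult_2)
qed

lemma finA: "finite A" using finV by (simp add: A_def)

lemma UK: "U \<subseteq> {1..K}" using cl_bounds unfolding U_def A_def by blast

lemma U_cl: "v \<in> A \<Longrightarrow> cl v \<in> U" by (simp add: U_def)

sublocale cg: cluster_graph U nb d D M hit
proof
  show "finite U" using finA by (simp add: U_def)
  show "0 \<notin> U" using UK by auto
  show "nb u \<subseteq> U" for u by (auto simp: nb_def U_def)
  show "u \<in> nb z" if zu: "z \<in> nb u" for u z
  proof -
    obtain v w where "z \<noteq> u" "v \<in> A" "w \<in> A" "{v, w} \<in> E" "cl v = u" "cl w = z"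
      using zu unfolding nb_def by auto
    moreover have "{w, v} \<in> E" using calculation(4) by (simp add: insert_commute)
    ultimately show ?thesis unfolding nb_def by blast
  qed
  show "u \<notin> nb u" for u by (simp add: nb_def)
  show "1 \<le> d" by (rule d1)
  show "1 \<le> D" using d1 by (simp add: D_eq)
  show "\<exists>s<M. hit u s \<and> (\<forall>z\<in>Z. \<not> hit z s)" if "u \<in> U" "Z \<subseteq> U - {u}" "card Z \<le> (d + 1) * D" for u Z
    by (rule selective) (use that UK in auto)
qed

definition pc :: "nat \<Rightarrow> nat list" where
  "pc v = map (\<lambda>w. if v \<in> A \<and> w \<in> A then cl w else 0) (nbrs N v)"

lemma length_pc [simp]: "length (pc v) = length (nbrs N v)" by (simp add: pc_def)

lemma pc_nth: "p < length (nbrs N v) \<Longrightarrow> pc v ! p = (if v \<in> A \<and> nbrs N v ! p \<in> A then cl (nbrs N v ! p) else 0)"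
  by (simp add: pc_def)

definition vst :: "(nat \<Rightarrow> cstate) \<Rightarrow> (nat \<Rightarrow> nat set) \<Rightarrow> nat \<Rightarrow> vstate" where
  "vst c P v = (r v)\<lparr>vpc := pc v, vcs := c v, vpend := P v\<rparr>"

lemma vst_simps [simp]:
  "vid (vst c P v) = vid (r v)" "vcl (vst c P v) = cl v" "vact (vst c P v) = vact (r v)" "vpc (vst c P v) = pc v"
  "vcs (vst c P v) = c v" "vpend (vst c P v) = P v" "vmk (vst c P v) = vmk (r v)"
  by (simp_all add: vst_def)

lemma contact:
  assumes "sim s r"
  shows "sim (exec1 2 K N contact_step s) (vst (\<lambda>_. cinit) (\<lambda>_. {}))"
  unfolding sim_def
proof
  fix v assume v: "v \<in> V"
  have sv: "s w = (r w, 0)" if "w \<in> V" for w using assms that by (simp add: sim_def)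
  have m: "msg_val (clip 2 K (fst contact_step (s w) p)) = (if w \<in> A then cl w else 0)" if "w \<in> V" for w p
    using sv[OF that] cl_bounds[OF that] that by (simp add: contact_step_def clip_def msg_val_def A_def)
  have "map (\<lambda>m. if vact (r v) then msg_val m else 0) (inbox 2 K N (fst contact_step) s v) = pc v"
    unfolding inbox_def pc_def map_map
  proof (rule map_cong[OF refl])
    fix w assume "w \<in> set (nbrs N v)"
    then have w: "w \<in> V" using nbrs_set[OF v] edgeV by blast
    show "((\<lambda>m. if vact (r v) then msg_val m else 0) \<circ> (\<lambda>u. clip 2 K (fst contact_step (s u) (port_to N u v)))) w =
       (if v \<in> A \<and> w \<in> A then cl w else 0)"
      using m[OF w] v by (simp add: A_def)
  qed
  then show "exec1 2 K N contact_step s v = (vst (\<lambda>_. cinit) (\<lambda>_. {}) v, 0)"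
    using sv[OF v] by (simp add: exec1_def contact_step_def vst_def)
qed

text \<open>Values above \<open>K\<close> would be clipped in transit, so every sent or flooded
  value has to stay in this range.\<close>

definition legal :: "cstep \<Rightarrow> (nat \<Rightarrow> cstate) \<Rightarrow> bool" where
  "legal q cs \<longleftrightarrow> (\<forall>u\<in>U. cself q u (cs u) \<le> K \<and>
     (\<forall>z\<in>nb u. cmsg q z (cs z) u \<le> K \<and> crecv q u (cs u) z (cmsg q z (cs z) u) \<le> K))"

text \<open>Each member evaluates the step over its own foreign ports, and the flood combines these
  maxima into the one over \<open>nb\<close>. Many ports may lead to the same adjacent cluster,
  which a maximum does not notice.\<close>

lemma sim_step:
  assumes s: "sim s (vst c P)" and c: "\<And>v. v \<in> A \<Longrightarrow> c v = cs (cl v)" and leg: "legal q cs"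
  shows "\<exists>c'. sim (exec 2 K N (sim_step (2 * R) q) s) (vst c' P) \<and> (\<forall>v\<in>A. c' v = cexec1 nb q cs (cl v))"
proof -
  let ?I = "inbox 2 K N (sim_msg q) (vst c P)"
  let ?g = "\<lambda>u z. crecv q u (cs u) z (cmsg q z (cs z) u)"
  let ?F = "\<lambda>v. {p. p < length (nbrs N v) \<and> foreign (vst c P v) p}"
  let ?S = "\<lambda>v. insert (cself q (cl v) (cs (cl v))) (?g (cl v) ` nb (cl v))"
  have forA: "nbrs N v ! p \<in> A \<and> cl (nbrs N v ! p) = pc v ! p \<and> pc v ! p \<in> nb (cl v)"
    if v: "v \<in> A" and p: "p \<in> ?F v" for v p
  proof -
    have l: "p < length (nbrs N v)" and f: "pc v ! p \<noteq> 0" "pc v ! p \<noteq> cl v" using p by (simp_all add: foreign_def)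
    then have n: "nbrs N v ! p \<in> A" "pc v ! p = cl (nbrs N v ! p)" using pc_nth[OF l] by (auto split: if_splits)
    moreover have "{v, nbrs N v ! p} \<in> E" using nth_nbrs[OF AV[OF v] l] by blast
    ultimately show ?thesis using v f unfolding nb_def by auto
  qed
  \<comment> \<open>Both ends of the edge regard each other as foreign, so the neighbour did address
    its message to cluster \<open>cl v\<close>; silence decodes to the value 0.\<close>
  have in_val: "msg_val (?I v ! p) = cmsg q (pc v ! p) (cs (pc v ! p)) (cl v)" if v: "v \<in> A" and p: "p \<in> ?F v" for v p
  proof -
    let ?w = "nbrs N v ! p"
    have l: "p < length (nbrs N v)" using p by simp
    have w: "?w \<in> A" "cl ?w = pc v ! p" "pc v ! p \<in> nb (cl v)" using forA[OF v p] by auto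
    have e: "{v, ?w} \<in> E" using nth_nbrs[OF AV[OF v] l] by blast
    have pt: "pc ?w ! port_to N ?w v = cl v" using pc_nth[of "port_to N ?w v" ?w] port_to_nth[OF e] v w by simp
    have fo: "foreign (vst c P ?w) (port_to N ?w v)"
      using pt w(2) p cl_bounds[OF AV[OF v]] by (simp add: foreign_def)
    have "cmsg q (pc v ! p) (cs (pc v ! p)) (cl v) \<le> K" using leg U_cl[OF v] w(3) by (simp add: legal_def)
    then show ?thesis
      using l fo pt w c[OF w(1)] by (auto simp: nth_inbox sim_msg_def clip_def msg_val_def)
  qed
  have prA: "sim_prop q (vst c P v) (?I v) = Max (insert (cself q (cl v) (cs (cl v))) ((\<lambda>p. ?g (cl v) (pc v ! p)) ` ?F v))"
    if v: "v \<in> A" for v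
  proof -
    have "(\<lambda>p. crecv q (cl v) (cs (cl v)) (pc v ! p) (msg_val (?I v ! p))) ` ?F v = (\<lambda>p. ?g (cl v) (pc v ! p)) ` ?F v"
      by (rule image_cong[OF refl]) (simp only: in_val[OF v])
    then show ?thesis using v c[OF v] by (simp add: sim_prop_def A_def)
  qed
  have prK: "sim_prop q (vst c P v) (?I v) \<le> K" if v: "v \<in> V" for v
  proof (cases "v \<in> A")
    case True
    have "?g (cl v) (pc v ! p) \<le> K" if "p \<in> ?F v" for p
      using leg U_cl[OF True] forA[OF True that] by (simp add: legal_def)
    moreover have "cself q (cl v) (cs (cl v)) \<le> K" using leg U_cl[OF True] by (simp add: legal_def)
    ultimately show ?thesis unfolding prA[OF True] by (subst Max_le_iff) auto
  next
    case False
    then show ?thesis using v by (simp add: sim_prop_def A_def)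
  qed
  define x where "x v = Max ((\<lambda>w. sim_prop q (vst c P w) (?I w)) ` {w \<in> V. cl w = cl v})" for v
  have ex: "exec 2 K N (sim_step (2 * R) q) s v = (sim_store q (vst c P v) (x v), 0)" if v: "v \<in> V" for v
    unfolding sim_step_def x_def
    using agg[where clf=vcl and r="vst c P" and s=s and val="sim_prop q" and m="sim_msg q" and store="sim_store q"
      and T="2 * R", OF _ _ prK _ v] s cl_bounds diam by (simp add: sim_def)
  have xA: "x v = Max (?S v)" if v: "v \<in> A" for v
  proof -
    let ?W = "{w \<in> V. cl w = cl v}"
    have WA: "w \<in> A" if "w \<in> ?W" for w using that act_cl[of w v] v AV by auto
    have vW: "v \<in> ?W" using v AV by simp
    have finF: "finite (?F w)" for w by simp
    have finnb: "finite (nb (cl v))" by (rule cg.fin_nb[OF U_cl[OF v]])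
    show ?thesis
    proof (rule antisym)
      show "x v \<le> Max (?S v)"
        unfolding x_def
      proof (rule Max.boundedI)
        fix y assume "y \<in> (\<lambda>w. sim_prop q (vst c P w) (?I w)) ` ?W"
        then obtain w where w: "w \<in> ?W" "y = sim_prop q (vst c P w) (?I w)" by blast
        have "insert (cself q (cl w) (cs (cl w))) ((\<lambda>p. ?g (cl w) (pc w ! p)) ` ?F w) \<subseteq>
            ?S v"
        proof (rule insert_subsetI)
          show "cself q (cl w) (cs (cl w)) \<in> ?S v" using w(1) by simp
          show "(\<lambda>p. ?g (cl w) (pc w ! p)) ` ?F w \<subseteq> ?S v"
          proof (rule image_subsetI)
            fix p assume "p \<in> ?F w"
            from forA[OF WA[OF w(1)] this] have "pc w ! p \<in> nb (cl v)" using w(1) by simp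
            then show "?g (cl w) (pc w ! p) \<in> ?S v" using w(1) by simp
          qed
        qed
        then show "y \<le> Max (?S v)"
          unfolding w(2) prA[OF WA[OF w(1)]] by (rule Max_mono) (use finnb in auto)
      qed (use finV vW in auto)
      have le: "sim_prop q (vst c P w) (?I w) \<le> x v" if "w \<in> ?W" for w
        unfolding x_def by (rule Max_ge) (use that finV in auto)
      show "Max (?S v) \<le> x v"
      proof (rule Max.boundedI)
        fix y assume "y \<in> ?S v"
        then consider "y = cself q (cl v) (cs (cl v))" | z where "z \<in> nb (cl v)" "y = ?g (cl v) z" by blast
        then show "y \<le> x v"
        proof cases
          case 1
          then have "y \<le> sim_prop q (vst c P v) (?I v)" unfolding prA[OF v] using finF by (intro Max_ge) auto
          then show ?thesis using le[OF vW] by linarith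
        next
          case 2
          then obtain w w' where w: "w \<in> A" "w' \<in> A" "{w, w'} \<in> E" "cl w = cl v" "cl w' = z" "z \<noteq> cl v"
            unfolding nb_def by blast
          then have wW: "w \<in> ?W" using AV by simp
          obtain p where p: "p < length (nbrs N w)" "nbrs N w ! p = w'" using ex_port[OF w(3)] by blast
          have "pc w ! p = z" using pc_nth[OF p(1)] p(2) w by simp
          then have "p \<in> ?F w" using p(1) w cl_bounds[OF AV[OF w(2)]] by (simp add: foreign_def)
          moreover have "y = ?g (cl w) (pc w ! p)" using 2 w(4) \<open>pc w ! p = z\<close> by simp
          ultimately have "y \<le> sim_prop q (vst c P w) (?I w)" unfolding prA[OF w(1)] using finF by (intro Max_ge) auto
          then show ?thesis using le[OF wW] by linarith
        qed
      qed (use finnb in auto)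
    qed
  qed
  define c' where "c' v = cstore q (c v) (x v)" for v
  have "sim (exec 2 K N (sim_step (2 * R) q) s) (vst c' P)"
    unfolding sim_def using ex by (simp add: sim_store_def c'_def vst_def)
  moreover have "c' v = cexec1 nb q cs (cl v)" if "v \<in> A" for v
    using xA[OF that] c[OF that] by (simp add: c'_def cexec1_def)
  ultimately show ?thesis by blast
qed

text \<open>\<open>owner\<close> is the only field ever sent as a value; all other messages are bits
  or the identifier of the sender.\<close>

definition bounded_ow :: "(nat \<Rightarrow> cstate) \<Rightarrow> bool" where
  "bounded_ow cs \<longleftrightarrow> (\<forall>u\<in>U. owner (cs u) \<le> K)"

lemma bounded_ow_cexec1:
  assumes b: "bounded_ow cs" and leg: "legal q cs"
    and st: "\<And>c x. owner (cstore q c x) = owner c \<or> owner (cstore q c x) = x"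
  shows "bounded_ow (cexec1 nb q cs)"
  unfolding bounded_ow_def
proof
  fix u assume u: "u \<in> U"
  let ?x = "Max (insert (cself q u (cs u)) ((\<lambda>z. crecv q u (cs u) z (cmsg q z (cs z) u)) ` nb u))"
  have "?x \<le> K" using leg u cg.fin_nb[OF u] by (subst Max_le_iff) (auto simp: legal_def)
  moreover have "owner (cs u) \<le> K" using b u by (simp add: bounded_ow_def)
  ultimately show "owner (cexec1 nb q cs u) \<le> K" using st[of "cs u" ?x] unfolding cexec1_def by auto
qed

lemma legal_steps:
  assumes q: "q \<in> set (phase_steps d D M hit)" and b: "bounded_ow cs"
  shows "legal q cs \<and> bounded_ow (cexec1 nb q cs)"
proof -
  have K: "1 \<le> K \<and> u \<le> K" "\<And>z. z \<in> nb u \<Longrightarrow> z \<le> K \<and> owner (cs z) \<le> K" if "u \<in> U" for u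
  proof -
    have "u \<in> {1..K}" using UK that by (rule subsetD)
    then show "1 \<le> K \<and> u \<le> K" unfolding atLeastAtMost_iff by linarith
    fix z assume "z \<in> nb u"
    then have z: "z \<in> U" using cg.nbU[OF that] by (rule rev_subsetD)
    moreover have "z \<in> {1..K}" using UK z by (rule subsetD)
    ultimately show "z \<le> K \<and> owner (cs z) \<le> K" using b by (auto simp: bounded_ow_def)
  qed
  have "q = choose_step \<or> q = chooser_step d \<or> q = heavy_step D \<or> (\<exists>s. q = ask_step hit s \<or> q = select_step d D hit s) \<or>
      q = join_step"
    using q by (auto simp: phase_steps_def slot_steps_def)
  then consider "q = choose_step" | "q = chooser_step d" | "q = heavy_step D" | s where "q = ask_step hit s"
    | s where "q = select_step d D hit s" | "q = join_step" by blast
  then have "legal q cs \<and> (\<forall>c x. owner (cstore q c x) = owner c \<or> owner (cstore q c x) = x)"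
  proof cases
    case 1 then show ?thesis using K by (simp add: legal_def choose_step_def)
  next
    case 2 then show ?thesis using K by (simp add: legal_def chooser_step_def)
  next
    case 3 then show ?thesis using K by (simp add: legal_def heavy_step_def)
  next
    case 4 then show ?thesis using K by (simp add: legal_def ask_step_def)
  next
    case 5 then show ?thesis using K by (simp add: legal_def select_step_def)
  next
    case 6 then show ?thesis using K by (simp add: legal_def join_step_def)
  qed
  then show ?thesis using bounded_ow_cexec1[OF b] by blast
qed

lemma sim_steps:
  assumes "set qs \<subseteq> set (phase_steps d D M hit)" "sim s (vst c P)" "\<And>v. v \<in> A \<Longrightarrow> c v = cs (cl v)" "bounded_ow cs"
  shows "\<exists>c'. sim (exec 2 K N (concat (map (sim_step (2 * R)) qs)) s) (vst c' P) \<and> (\<forall>v\<in>A. c' v = cexec nb qs cs (cl v))"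
  using assms
proof (induction qs arbitrary: s c cs)
  case Nil
  then show ?case by auto
next
  case (Cons q qs)
  have l: "legal q cs" "bounded_ow (cexec1 nb q cs)" using legal_steps[of q] Cons.prems by auto
  from sim_step[OF Cons.prems(2,3) l(1)] obtain c' where
    c': "sim (exec 2 K N (sim_step (2 * R) q) s) (vst c' P)" "\<forall>v\<in>A. c' v = cexec1 nb q cs (cl v)" by blast
  have "set qs \<subseteq> set (phase_steps d D M hit)" using Cons.prems(1) by simp
  from Cons.IH[OF this c'(1) bspec[OF c'(2)] l(2)] show ?case by simp
qed

end

section \<open>Edges paid for by retiring clusters\<close>

context phase
begin

lemma vertex_of_ident: "v \<in> V \<Longrightarrow> (THE w. w \<in> V \<and> ident N w = ident N v) = v"
  by (rule the_equality) (auto dest: ident_inj)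

text \<open>A retiring cluster is charged one edge per adjacent cluster: the elected vertex is the only member
  that contributes an edge towards \<open>target k (cs u)\<close>.\<close>

definition elected :: "(nat \<Rightarrow> cstate) \<Rightarrow> nat \<Rightarrow> nat \<Rightarrow> nat" where
  "elected cs k u = Max ((\<lambda>w. if w \<in> A \<and> target k (cs u) \<noteq> 0 \<and> target k (cs u) \<in> set (pc w) then ident N w else 0) `
     {w \<in> V. cl w = u})"

definition pending :: "(nat \<Rightarrow> cstate) \<Rightarrow> nat \<Rightarrow> nat \<Rightarrow> nat set" where
  "pending cs k v = (\<lambda>j. port_of (pc v) (target j (cs (cl v)))) ` {j. j < k \<and> elected cs j (cl v) = ident N v}"

lemma elected:
  assumes u: "u \<in> U" and nz: "elected cs k u \<noteq> 0"
  obtains w where "w \<in> A" "cl w = u" "ident N w = elected cs k u" "target k (cs u) \<noteq> 0" "target k (cs u) \<in> set (pc w)"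
proof -
  let ?f = "\<lambda>w. if w \<in> A \<and> target k (cs u) \<noteq> 0 \<and> target k (cs u) \<in> set (pc w) then ident N w else 0"
  have ne: "{w \<in> V. cl w = u} \<noteq> {}" using u AV unfolding U_def by auto
  have "Max (?f ` {w \<in> V. cl w = u}) \<in> ?f ` {w \<in> V. cl w = u}"
    by (rule Max_in) (use ne finV in auto)
  then obtain w where "w \<in> V" "cl w = u" "?f w = elected cs k u" unfolding elected_def by auto
  then show thesis using nz that by (auto split: if_splits)
qed

lemma elected_nonzero:
  assumes w: "w \<in> A" "target k (cs (cl w)) \<noteq> 0" "target k (cs (cl w)) \<in> set (pc w)"
  shows "elected cs k (cl w) \<noteq> 0"
proof -
  let ?f = "\<lambda>x. if x \<in> A \<and> target k (cs (cl w)) \<noteq> 0 \<and> target k (cs (cl w)) \<in> set (pc x) then ident N x else 0"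
  have "?f w \<le> elected cs k (cl w)" unfolding elected_def
    by (rule Max_ge) (use w AV finV in auto)
  moreover have "?f w \<noteq> 0" using w ident_bounds[OF AV[OF w(1)]] by auto
  ultimately show ?thesis by linarith
qed

lemma mark_step:
  assumes s: "sim s (vst c P)" and c: "\<And>v. v \<in> A \<Longrightarrow> c v = cs (cl v)" and P: "\<And>v. v \<in> A \<Longrightarrow> P v = pending cs k v"
  shows "\<exists>P'. sim (exec 2 K N (mark_step (2 * R) k) s) (vst c P') \<and> (\<forall>v\<in>A. P' v = pending cs (Suc k) v)"
proof -
  let ?I = "inbox 2 K N (\<lambda>_ _. []) (vst c P)"
  define x where "x v = Max ((\<lambda>w. mark_prop k (vst c P w) (?I w)) ` {w \<in> V. cl w = cl v})" for v
  have prK: "mark_prop k (vst c P v) (?I v) \<le> K" if v: "v \<in> V" for v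
    using vid_r[OF v] ident_bounds[OF v] by (simp add: mark_prop_def)
  have ex: "exec 2 K N (mark_step (2 * R) k) s v = (mark_store k (vst c P v) (x v), 0)" if v: "v \<in> V" for v
    unfolding mark_step_def x_def
    using agg[where clf=vcl and r="vst c P" and s=s and val="mark_prop k" and m="\<lambda>_ _. []" and store="mark_store k"
      and T="2 * R", OF _ _ prK _ v] s cl_bounds diam by (simp add: sim_def)
  have xA: "x v = elected cs k (cl v)" if v: "v \<in> A" for v
    unfolding x_def elected_def
  proof (rule arg_cong[where f=Max], rule image_cong[OF refl])
    fix w assume w: "w \<in> {w \<in> V. cl w = cl v}"
    then have "w \<in> A" using act_cl[of w v] v AV by auto
    then show "mark_prop k (vst c P w) (?I w) =
       (if w \<in> A \<and> target k (cs (cl v)) \<noteq> 0 \<and> target k (cs (cl v)) \<in> set (pc w) then ident N w else 0)"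
      using w c[of w] vid_r[of w] by (simp add: mark_prop_def A_def)
  qed
  define P' where "P' v = (if x v = ident N v then insert (port_of (pc v) (target k (c v))) (P v) else P v)" for v
  have "sim (exec 2 K N (mark_step (2 * R) k) s) (vst c P')"
    unfolding sim_def using ex vid_r by (auto simp: mark_store_def P'_def vst_def)
  moreover have "P' v = pending cs (Suc k) v" if v: "v \<in> A" for v
  proof -
    have "{j. j < Suc k \<and> elected cs j (cl v) = ident N v} =
       (if elected cs k (cl v) = ident N v then insert k {j. j < k \<and> elected cs j (cl v) = ident N v}
        else {j. j < k \<and> elected cs j (cl v) = ident N v})"
      by (auto simp: less_Suc_eq)
    then show ?thesis using xA[OF v] c[OF v] P[OF v] by (simp add: P'_def pending_def)
  qed
  ultimately show ?thesis by blast
qed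

lemma mark_steps:
  assumes "sim s (vst c (\<lambda>_. {}))" and c: "\<And>v. v \<in> A \<Longrightarrow> c v = cs (cl v)"
  shows "\<exists>P'. sim (exec 2 K N (concat (map (mark_step (2 * R)) [0..<k])) s) (vst c P') \<and> (\<forall>v\<in>A. P' v = pending cs k v)"
proof (induction k)
  case 0
  then show ?case using assms(1) by (auto simp: pending_def)
next
  case (Suc k)
  then obtain P' where P': "sim (exec 2 K N (concat (map (mark_step (2 * R)) [0..<k])) s) (vst c P')"
    "\<And>v. v \<in> A \<Longrightarrow> P' v = pending cs k v" by blast
  show ?case using mark_step[OF P'(1) c P'(2)] by simp
qed

definition grouped :: "(nat \<Rightarrow> cstate) \<Rightarrow> (nat \<Rightarrow> nat set) \<Rightarrow> nat \<Rightarrow> vstate" where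
  "grouped c P v = regroup d D (vst c P v)"

lemma phase_exec:
  assumes "sim s r"
  obtains c P where "sim (exec 2 K N (phase_prog d D M hit (2 * R)) s) (grouped c P)"
    "\<And>v. v \<in> A \<Longrightarrow> c v = cg.result (cl v)" "\<And>v. v \<in> A \<Longrightarrow> P v = pending cg.result d v"
proof -
  have b: "bounded_ow (\<lambda>_. cinit)" by (simp add: bounded_ow_def cinit_def)
  obtain c where c: "sim (exec 2 K N (concat (map (sim_step (2 * R)) (phase_steps d D M hit))) (exec1 2 K N contact_step s))
      (vst c (\<lambda>_. {}))" "\<And>v. v \<in> A \<Longrightarrow> c v = cg.result (cl v)"
    using sim_steps[OF subset_refl contact[OF assms] _ b] by blast
  obtain P where P: "sim (exec 2 K N (concat (map (mark_step (2 * R)) [0..<d]))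
      (exec 2 K N (concat (map (sim_step (2 * R)) (phase_steps d D M hit))) (exec1 2 K N contact_step s))) (vst c P)"
    "\<And>v. v \<in> A \<Longrightarrow> P v = pending cg.result d v"
    using mark_steps[OF c(1,2)] by blast
  have "sim (exec 2 K N (phase_prog d D M hit (2 * R)) s) (grouped c P)"
    using P(1) by (simp add: phase_prog_def sim_def exec1_def grouped_def)
  then show thesis using that c(2) P(2) by blast
qed

end

section \<open>The clustering after one phase\<close>

locale phase_end = phase +
  fixes c :: "nat \<Rightarrow> cstate" and P :: "nat \<Rightarrow> nat set" and r' :: "nat \<Rightarrow> vstate"
  assumes c: "\<And>v. v \<in> A \<Longrightarrow> c v = cg.result (cl v)" and P: "\<And>v. v \<in> A \<Longrightarrow> P v = pending cg.result d v"
    and r': "\<And>v. v \<in> V \<Longrightarrow> r' v = grouped c P v"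
begin

abbreviation "cl' \<equiv> \<lambda>v. vcl (r' v)"

lemma r'_fields:
  assumes v: "v \<in> V"
  shows "vid (r' v) = vid (r v)" "cl' v = (if v \<in> A \<and> cg.ncen (cl v) \<noteq> 0 then cg.ncen (cl v) else cl v)"
    "vact (r' v) \<longleftrightarrow> v \<in> A \<and> cg.ncen (cl v) \<noteq> 0"
    "vmk (r' v) = (if v \<in> A \<and> cg.ncen (cl v) = 0 then vmk (r v) \<union> pending cg.result d v else vmk (r v))"
  using r'[OF v] c[of v] P[of v] v by (auto simp: grouped_def regroup_def A_def)

lemma cl'_cong: "v \<in> V \<Longrightarrow> w \<in> V \<Longrightarrow> cl v = cl w \<Longrightarrow> cl' v = cl' w"
  using act_cl[of v w] by (simp add: r'_fields(2))

lemma near': "w \<in> near cl k v \<Longrightarrow> w \<in> near cl' k v"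
  by (rule near_cong[OF cl'_cong])

text \<open>Centre to border, one crossing edge, border to centre. As both clusters receive the same
  new identifier, the walk stays inside the supercluster.\<close>

lemma center_dist:
  assumes u: "u \<in> U" and z: "z \<in> nb u" and eq: "cg.ncen u = cg.ncen z" "cg.ncen u \<noteq> 0"
    and a: "a \<in> V" "ident N a = u" and b: "b \<in> V" "ident N b = z"
  shows "b \<in> near cl' (2 * R + 1) a"
proof -
  obtain v w where vw: "v \<in> A" "w \<in> A" "{v, w} \<in> E" "cl v = u" "cl w = z" using z unfolding nb_def by blast
  have "cl' v = cl' w" using vw eq AV by (simp add: r'_fields(2))
  have v: "v \<in> near cl' R a" using center[OF AV[OF vw(1)]] vw(4) a ident_inj near' by metis
  have w: "w \<in> near cl' R b" using center[OF AV[OF vw(2)]] vw(5) b ident_inj near' by metis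
  have "w \<in> near cl' (R + 1) a" by (rule near_trans[OF v near_edge]) fact+
  from near_trans[OF this near_sym[OF w]] show ?thesis by (simp add: mult_2)
qed

text \<open>Two hops between old centres cost \<open>2 * (2 * R + 1)\<close>, and reaching the
  vertex inside its old cluster costs another \<open>R\<close>.\<close>

lemma center':
  assumes v: "v \<in> V"
  shows "\<exists>c\<in>V. ident N c = cl' v \<and> cl' c = cl' v \<and> v \<in> near cl' (5 * R + 2) c"
proof -
  obtain c where c: "c \<in> V" "ident N c = cl v" "cl c = cl v" "v \<in> near cl R c" using center[OF v] by metis
  show ?thesis
  proof (cases "v \<in> A \<and> cg.ncen (cl v) \<noteq> 0")
    case False
    then have "cl' v = cl v" by (simp only: r'_fields(2)[OF v] if_False)
    moreover have "cl' c = cl' v" using cl'_cong[OF c(1) v c(3)] .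
    moreover have "v \<in> near cl' (5 * R + 2) c" by (rule near_mono[OF near'[OF c(4)]]) simp
    ultimately show ?thesis using c by metis
  next
    case True
    define u where "u = cl v"
    define s where "s = cg.ncen u"
    have uU: "u \<in> U" using True U_cl by (simp add: u_def)
    have s0: "s \<noteq> 0" using True by (simp add: s_def u_def)
    from cg.ncen_center[OF uU] s0 have s: "s \<in> U" "cg.ncen s = s"
      "u = s \<or> u \<in> nb s \<or> (\<exists>z\<in>nb s. u \<in> nb z \<and> cg.ncen z = s)"
      unfolding s_def by blast+
    have center_of: "\<exists>c\<in>V. ident N c = z \<and> cl c = z" if zU: "z \<in> U" for z
    proof -
      obtain x where "x \<in> A" "z = cl x" using zU unfolding U_def by blast
      then show ?thesis using center[OF AV] by metis
    qed
    obtain b where b: "b \<in> V" "ident N b = s" "cl b = s" using center_of[OF s(1)] by blast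
    have cv: "cl' v = s" using True v by (simp add: r'_fields(2) s_def u_def)
    have "b \<in> A"
    proof -
      obtain x where "x \<in> A" "s = cl x" using s(1) unfolding U_def by blast
      then show ?thesis using act_cl[of b x] b AV by simp
    qed
    then have cb: "cl' b = s" using b s s0 by (simp add: r'_fields(2))
    have vc: "v \<in> near cl' R c" by (rule near'[OF c(4)])
    from s(3) have "v \<in> near cl' (5 * R + 2) b"
    proof (elim disjE bexE conjE)
      assume "u = s"
      then have "b = c" using b c ident_inj by (simp add: u_def)
      then show ?thesis using near_mono[OF vc] by simp
    next
      assume u: "u \<in> nb s"
      have "c \<in> near cl' (2 * R + 1) b"
        by (rule center_dist[OF s(1) u]) (use s s0 b c in \<open>auto simp: u_def s_def\<close>)
      from near_trans[OF this vc] show ?thesis by (rule near_mono) simp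
    next
      fix z assume z: "z \<in> nb s" "u \<in> nb z" "cg.ncen z = s"
      have zU: "z \<in> U" using cg.nbU[OF s(1)] z(1) by (rule subsetD)
      obtain e where e: "e \<in> V" "ident N e = z" using center_of[OF zU] by blast
      have 1: "e \<in> near cl' (2 * R + 1) b"
        by (rule center_dist[OF s(1) z(1)]) (use s s0 b e z in auto)
      have 2: "c \<in> near cl' (2 * R + 1) e"
        by (rule center_dist[OF zU z(2)]) (use s0 z e c in \<open>auto simp: u_def s_def\<close>)
      from near_trans[OF near_trans[OF 1 2] vc] show ?thesis by (rule near_mono) simp
    qed
    then show ?thesis using b cv cb by metis
  qed
qed

text \<open>An inactive cluster keeps its identifier, which must not collide with that of a
  surviving supercluster. It cannot, because a supercluster bears the identifier of an active
  cluster that is its own centre.\<close>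

lemma act_cl':
  assumes v: "v \<in> V" and w: "w \<in> V" and eq: "cl' v = cl' w" and a: "vact (r' v)"
  shows "vact (r' w)"
proof -
  have va: "v \<in> A" "cg.ncen (cl v) \<noteq> 0" using a v by (simp_all add: r'_fields(3))
  define s where "s = cg.ncen (cl v)"
  have s: "s \<in> U" "cg.ncen s = s" "s \<noteq> 0" using cg.ncen_center[OF U_cl[OF va(1)] va(2)] va by (simp_all add: s_def)
  have "cl' v = s" using va v by (simp add: r'_fields(2) s_def)
  show ?thesis
  proof (rule ccontr)
    assume n: "\<not> vact (r' w)"
    then have "\<not> (w \<in> A \<and> cg.ncen (cl w) \<noteq> 0)" by (simp only: r'_fields(3)[OF w] not_False_eq_True)
    then have "cl' w = cl w" by (simp only: r'_fields(2)[OF w] if_False)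
    then have "cl w = s" using eq \<open>cl' v = s\<close> by simp
    moreover obtain x where "x \<in> A" "s = cl x" using s(1) unfolding U_def by blast
    ultimately have "w \<in> A" using act_cl[OF w AV] by metis
    then show False using n w s \<open>cl w = s\<close> by (simp add: r'_fields(3))
  qed
qed

lemma card_active': "real (card (active_clusters r')) \<le> real (card U) * (17 / 16) / real (d + 1)"
proof -
  have "active_clusters r' \<subseteq> cg.ncen ` U - {0}"
  proof
    fix z assume "z \<in> active_clusters r'"
    then obtain v where "v \<in> V" "vact (r' v)" "z = cl' v" unfolding active_clusters_def by blast
    then show "z \<in> cg.ncen ` U - {0}" using U_cl by (auto simp: r'_fields(2,3))
  qed
  moreover have "finite (cg.ncen ` U - {0})" using cg.finU by simp
  ultimately have "card (active_clusters r') \<le> card (cg.ncen ` U - {0})" by (rule card_mono[rotated])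
  then show ?thesis using cg.card_ncen[OF D_eq] by (meson of_nat_mono order_trans)
qed

lemma pending_port:
  assumes v: "v \<in> A" and p: "p \<in> pending cg.result d v"
  obtains j where "j < card (chosen (cg.result (cl v)))" "elected cg.result j (cl v) = ident N v"
    "p = port_of (pc v) (target j (cg.result (cl v)))" "p < length (nbrs N v)"
    "pc v ! p = target j (cg.result (cl v))"
proof -
  obtain j where j: "elected cg.result j (cl v) = ident N v" "p = port_of (pc v) (target j (cg.result (cl v)))"
    using p unfolding pending_def by blast
  have nz: "elected cg.result j (cl v) \<noteq> 0" using j(1) ident_bounds[OF AV[OF v]] by auto
  from elected[OF U_cl[OF v] nz] obtain w where w: "w \<in> A" "ident N w = ident N v"
     "target j (cg.result (cl v)) \<noteq> 0" "target j (cg.result (cl v)) \<in> set (pc w)" using j(1) by metis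
  have "w = v" using w AV v ident_inj by blast
  then have "target j (cg.result (cl v)) \<in> set (pc v)" using w by simp
  from port_of[OF this] j have "p < length (nbrs N v)" "pc v ! p = target j (cg.result (cl v))" by auto
  moreover have "j < card (chosen (cg.result (cl v)))" using w(3) by (auto simp: target_def split: if_splits)
  ultimately show thesis using that j by blast
qed

definition retired :: "nat set" where "retired = {u \<in> U. cg.ncen u = 0}"

text \<open>Naming the edge by cluster and index alone reduces counting to the cardinality of an
  image; the vertex is recovered from the winning identifier.\<close>

definition elected_edge :: "nat \<Rightarrow> nat \<Rightarrow> nat set" where
  "elected_edge u j = (let v = (THE v. v \<in> V \<and> ident N v = elected cg.result j u)
     in {v, nbrs N v ! port_of (pc v) (target j (cg.result u))})"

lemma marked_new:
  "marked r' \<subseteq> marked r \<union> (\<Union>u\<in>retired. elected_edge u ` {..<card (chosen (cg.result u))})"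
proof
  fix e assume "e \<in> marked r'"
  then obtain v p where e: "e = {v, nbrs N v ! p}" "v \<in> V" "p \<in> vmk (r' v)" unfolding marked_def by blast
  show "e \<in> marked r \<union> (\<Union>u\<in>retired. elected_edge u ` {..<card (chosen (cg.result u))})"
  proof (cases "p \<in> vmk (r v)")
    case True
    then show ?thesis using e unfolding marked_def by blast
  next
    case False
    then have v: "v \<in> A" "cg.ncen (cl v) = 0" "p \<in> pending cg.result d v"
      using e by (auto simp: r'_fields(4) split: if_splits)
    from pending_port[OF v(1,3)] obtain j where j: "j < card (chosen (cg.result (cl v)))"
      "elected cg.result j (cl v) = ident N v" "p = port_of (pc v) (target j (cg.result (cl v)))" by metis
    have "e = elected_edge (cl v) j"
      unfolding elected_edge_def j(2) vertex_of_ident[OF e(2)] Let_def e(1) j(3) ..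
    moreover have "cl v \<in> retired" using v U_cl by (simp add: retired_def)
    ultimately show ?thesis using j(1) by blast
  qed
qed

lemma finite_marked: "finite (marked r)"
proof -
  have "marked r \<subseteq> (\<Union>v\<in>V. (\<lambda>p. {v, nbrs N v ! p}) ` {..<length (nbrs N v)})"
    using clustering unfolding marked_def clustering_def by blast
  then show ?thesis by (rule finite_subset) (use finV in auto)
qed

lemma card_marked': "real (card (marked r')) \<le> real (card (marked r)) + real (card U) * (real d - 1)"
proof -
  let ?X = "\<lambda>u. elected_edge u ` {..<card (chosen (cg.result u))}"
  have rU: "retired \<subseteq> U" "finite retired" using cg.finU by (auto simp: retired_def)
  have "card (marked r') \<le> card (marked r \<union> (\<Union>u\<in>retired. (?X u)))"
    by (rule card_mono[OF _ marked_new]) (use finite_marked rU in auto)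
  also have "\<dots> \<le> card (marked r) + card (\<Union>u\<in>retired. (?X u))"
    by (rule card_Un_le)
  also have "card (\<Union>u\<in>retired. (?X u)) \<le>
      (\<Sum>u\<in>retired. card ((?X u)))"
    by (rule card_UN_le[OF rU(2)])
  also have "\<dots> \<le> (\<Sum>u\<in>retired. d - 1)"
  proof (rule sum_mono)
    fix u assume "u \<in> retired"
    then have "card (chosen (cg.result u)) < d" using cg.ncen_retired[of u] by (simp add: retired_def)
    moreover have "card ((?X u)) \<le> card (chosen (cg.result u))"
      using card_image_le[of "{..<card (chosen (cg.result u))}"] by simp
    ultimately show "card ((?X u)) \<le> d - 1" by linarith
  qed
  also have "\<dots> \<le> card U * (d - 1)" using card_mono[OF cg.finU rU(1)] by simp
  finally have "card (marked r') \<le> card (marked r) + card U * (d - 1)" by simp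
  then have "real (card (marked r')) \<le> real (card (marked r) + card U * (d - 1))" by (rule of_nat_mono)
  then show ?thesis using d1 by (simp add: of_nat_diff)
qed

lemma marked_mono: "marked r \<subseteq> marked r'"
proof
  fix e assume "e \<in> marked r"
  then obtain v p where "e = {v, nbrs N v ! p}" "v \<in> V" "p \<in> vmk (r v)" unfolding marked_def by blast
  then show "e \<in> marked r'" using r'_fields(4)[of v] unfolding marked_def by (auto split: if_splits)
qed

text \<open>The given edge itself need not be marked: the elected vertex contributes some edge
  between the same two clusters.\<close>

lemma retired_edge:
  assumes e: "{v, w} \<in> E" and v: "v \<in> A" "cg.ncen (cl v) = 0" and w: "w \<in> A" and ne: "cl w \<noteq> cl v"
  obtains v1 w1 where "{v1, w1} \<in> marked r'" "v1 \<in> V" "w1 \<in> V" "cl v1 = cl v" "cl w1 = cl w"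
proof -
  let ?u = "cl v" and ?z = "cl w"
  have z: "?z \<in> nb ?u" using e v w ne unfolding nb_def by blast
  have chosen: "chosen (cg.result ?u) = nb ?u" "card (nb ?u) < d" using cg.ncen_retired[OF U_cl[OF v(1)] v(2)] by auto
  have fin: "finite (nb ?u)" by (rule cg.fin_nb[OF U_cl[OF v(1)]])
  then obtain j where j: "j < card (nb ?u)" "sorted_list_of_set (nb ?u) ! j = ?z"
    using z by (metis in_set_conv_nth set_sorted_list_of_set length_sorted_list_of_set)
  have t: "target j (cg.result ?u) = ?z" using j chosen by (simp add: target_def)
  have z0: "?z \<noteq> 0" using cl_bounds[OF AV[OF w]] by auto
  obtain p where p: "p < length (nbrs N v)" "nbrs N v ! p = w" using ex_port[OF e] by blast
  have "pc v ! p = ?z" using pc_nth[OF p(1)] p(2) v w by simp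
  then have "?z \<in> set (pc v)" using p(1) by (metis length_pc nth_mem)
  then have "elected cg.result j ?u \<noteq> 0" using elected_nonzero[OF v(1)] t z0 by metis
  from elected[OF U_cl[OF v(1)] this] obtain v1 where v1: "v1 \<in> A" "cl v1 = ?u" "ident N v1 = elected cg.result j ?u"
    "?z \<in> set (pc v1)" using t by metis
  define q where "q = port_of (pc v1) ?z"
  have q: "q < length (nbrs N v1)" "pc v1 ! q = ?z" using port_of[OF v1(4)] by (auto simp: q_def)
  have w1: "nbrs N v1 ! q \<in> A" "cl (nbrs N v1 ! q) = ?z" using q pc_nth[OF q(1)] z0 by (auto split: if_splits)
  have "q \<in> pending cg.result d v1"
    using v1 t j chosen unfolding pending_def q_def by (intro image_eqI[of _ _ j]) auto
  then have "q \<in> vmk (r' v1)" using v1 v(2) AV by (simp add: r'_fields(4))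
  then have "{v1, nbrs N v1 ! q} \<in> marked r'" using AV[OF v1(1)] unfolding marked_def by blast
  then show thesis using that v1 w1 AV by blast
qed

lemma cover':
  assumes e: "{v, w} \<in> E"
  shows "vact (r' v) \<and> vact (r' w) \<or> cl' v = cl' w \<or>
        (\<exists>v1 w1. {v1, w1} \<in> marked r' \<and> v1 \<in> V \<and> w1 \<in> V \<and> cl' v1 = cl' v \<and> cl' w1 = cl' w)"
proof -
  have V: "v \<in> V" "w \<in> V" using edgeV[OF e] by auto
  consider "cl v = cl w" | "vact (r' v)" "vact (r' w)" | "cl w \<noteq> cl v" "v \<in> A" "w \<in> A" "cg.ncen (cl v) = 0"
    | "cl w \<noteq> cl v" "v \<in> A" "w \<in> A" "cg.ncen (cl w) = 0" | "cl v \<noteq> cl w" "\<not> (v \<in> A \<and> w \<in> A)"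
    using r'_fields(3)[OF V(1)] r'_fields(3)[OF V(2)] by metis
  then show ?thesis
  proof cases
    case 1 then show ?thesis using cl'_cong[OF V] by simp
  next
    case 2 then show ?thesis by simp
  next
    case 3
    obtain v1 w1 where *: "{v1, w1} \<in> marked r'" "v1 \<in> V" "w1 \<in> V" "cl v1 = cl v" "cl w1 = cl w"
      by (rule retired_edge[OF e 3(2,4,3,1)])
    show ?thesis using *(1-3) cl'_cong[OF *(2) V(1) *(4)] cl'_cong[OF *(3) V(2) *(5)] by blast
  next
    case 4
    have "{w, v} \<in> E" using e by (simp add: insert_commute)
    from retired_edge[OF this 4(3,4,2) 4(1)[symmetric]] obtain v1 w1 where
      *: "{v1, w1} \<in> marked r'" "v1 \<in> V" "w1 \<in> V" "cl v1 = cl w" "cl w1 = cl v" .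
    have "{w1, v1} \<in> marked r'" using *(1) by (simp add: insert_commute)
    then show ?thesis using *(2,3) cl'_cong[OF *(2) V(2) *(4)] cl'_cong[OF *(3) V(1) *(5)] by blast
  next
    \<comment> \<open>An edge with an inactive end was already covered before the phase, and marks
      are never removed.\<close>
    case 5
    then have "\<not> (vact (r v) \<and> vact (r w))" using V by (simp add: A_def)
    then obtain v1 w1 where *: "{v1, w1} \<in> marked r" "v1 \<in> V" "w1 \<in> V" "cl v1 = cl v" "cl w1 = cl w"
      using 5(1) e clustering unfolding clustering_def by blast
    have "{v1, w1} \<in> marked r'" using *(1) marked_mono by (rule rev_subsetD)
    then show ?thesis using *(2,3) cl'_cong[OF *(2) V(1) *(4)] cl'_cong[OF *(3) V(2) *(5)] by blast
  qed
qed

lemma clustering': "clustering (5 * R + 2) r'"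
proof -
  have mk: "vmk (r' v) \<subseteq> {..<length (nbrs N v)}" if v: "v \<in> V" for v
  proof -
    have "vmk (r v) \<subseteq> {..<length (nbrs N v)}" using clustering v unfolding clustering_def by blast
    moreover have "pending cg.result d v \<subseteq> {..<length (nbrs N v)}" if "v \<in> A"
      using pending_port[OF that] by (meson lessThan_iff subsetI)
    ultimately show ?thesis using r'_fields(4)[OF v] by auto
  qed
  show ?thesis
    unfolding clustering_def
  proof (intro conjI)
    show "\<forall>v\<in>V. vid (r' v) = ident N v" using r'_fields(1) vid_r by simp
    show "\<forall>v\<in>V. \<exists>c\<in>V. ident N c = cl' v \<and> cl' c = cl' v \<and> v \<in> near cl' (5 * R + 2) c"
      by (rule ballI) (rule center')
    show "\<forall>v\<in>V. \<forall>w\<in>V. cl' v = cl' w \<longrightarrow> vact (r' v) = vact (r' w)"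
    proof (intro ballI impI)
      fix v w assume "v \<in> V" "w \<in> V" "cl' v = cl' w"
      then show "vact (r' v) = vact (r' w)" using act_cl'[of v w] act_cl'[of w v] by metis
    qed
    show "\<forall>v\<in>V. vmk (r' v) \<subseteq> {..<length (nbrs N v)}" by (rule ballI) (rule mk)
    show "\<forall>v w. {v, w} \<in> E \<longrightarrow> vact (r' v) \<and> vact (r' w) \<or> cl' v = cl' w \<or>
        (\<exists>v1 w1. {v1, w1} \<in> marked r' \<and> v1 \<in> V \<and> w1 \<in> V \<and> cl' v1 = cl' v \<and> cl' w1 = cl' w)"
      by (intro allI impI) (rule cover')
  qed
qed

end

context congest
begin

lemma phase_prog:
  assumes "sim s r" "clustering R r" "1 \<le> d" "D = 32 * d * d"
    and "\<And>u Z. u \<in> {1..K} \<Longrightarrow> Z \<subseteq> {1..K} - {u} \<Longrightarrow> card Z \<le> (d + 1) * D \<Longrightarrow> \<exists>s<M. hit u s \<and> (\<forall>z\<in>Z. \<not> hit z s)"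
  shows "\<exists>r'. sim (exec 2 K N (phase_prog d D M hit (2 * R)) s) r' \<and> clustering (5 * R + 2) r' \<and>
    real (card (active_clusters r')) \<le> real (card (active_clusters r)) * (17 / 16) / real (d + 1) \<and>
    real (card (marked r')) \<le> real (card (marked r)) + real (card (active_clusters r)) * (real d - 1)"
proof -
  interpret phase C N r R d D M hit by unfold_locales (fact assms(2-4) | rule assms(5), assumption+)+
  obtain c P where *: "sim (exec 2 K N (phase_prog d D M hit (2 * R)) s) (grouped c P)"
    "\<And>v. v \<in> A \<Longrightarrow> c v = cg.result (cl v)" "\<And>v. v \<in> A \<Longrightarrow> P v = pending cg.result d v"
    by (rule phase_exec[OF assms(1)]) blast
  interpret phase_end C N r R d D M hit c P "grouped c P" by unfold_locales (erule *(2), erule *(3), rule refl)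
  show ?thesis using *(1) clustering' card_active' card_marked' by blast
qed

end

section \<open>The degree schedule\<close>

primrec cluster_bound :: "real \<Rightarrow> nat list \<Rightarrow> real" where
  "cluster_bound b [] = b"
| "cluster_bound b (d # ds) = cluster_bound (b * (17 / 16) / real (d + 1)) ds"

primrec edge_cost :: "real \<Rightarrow> nat list \<Rightarrow> real" where
  "edge_cost b [] = 0"
| "edge_cost b (d # ds) = b * (real d - 1) + edge_cost (b * (17 / 16) / real (d + 1)) ds"

lemma cluster_bound_append: "cluster_bound b (ds @ es) = cluster_bound (cluster_bound b ds) es"
  by (induction ds arbitrary: b) simp_all

lemma edge_cost_append: "edge_cost b (ds @ es) = edge_cost b ds + edge_cost (cluster_bound b ds) es"
  by (induction ds arbitrary: b) simp_all

lemma cluster_bound_replicate: "cluster_bound b (replicate m d) = b * (17 / 16 / real (d + 1)) ^ m"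
  by (induction m arbitrary: b) simp_all

text \<open>For constant degree the cluster bounds decay geometrically; the constant 3 reproduces
  itself because \<open>1 + 3 * q \<le> 3\<close> for \<open>q \<le> 2 / 3\<close>.\<close>

lemma edge_cost_replicate:
  assumes "0 \<le> b" "1 \<le> d"
  shows "edge_cost b (replicate m d) \<le> 3 * b * (real d - 1)"
  using assms(1)
proof (induction m arbitrary: b)
  case 0
  then show ?case using assms(2) by simp
next
  case (Suc m)
  define q where "q = 17 / 16 / real (d + 1)"
  have q: "0 \<le> q" "q \<le> 2 / 3" using assms(2) by (auto simp: q_def field_simps)
  have "edge_cost b (replicate (Suc m) d) = b * (real d - 1) + edge_cost (b * q) (replicate m d)"
    by (simp add: q_def)
  also have "\<dots> \<le> b * (real d - 1) + 3 * (b * q) * (real d - 1)"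
    using Suc.IH[of "b * q"] Suc.prems q by simp
  also have "\<dots> = b * (real d - 1) * (1 + 3 * q)" by (simp add: algebra_simps)
  also have "\<dots> \<le> b * (real d - 1) * 3"
    using q Suc.prems assms(2) by (intro mult_left_mono) auto
  finally show ?case by simp
qed

text \<open>Bernoulli's inequality for exponents between 0 and 1. The tangent bound
  \<open>ln t \<le> t - 1\<close> is applied at two points whose mean with weights \<open>a\<close>
  and \<open>1 - a\<close> is 1.\<close>

lemma powr_le_linear:
  fixes x a :: real
  assumes "0 \<le> x" "0 \<le> a" "a \<le> 1"
  shows "(1 + x) powr a \<le> 1 + a * x"
proof -
  define m where "m = 1 + a * x"
  have m: "0 < m" using assms by (simp add: m_def add_pos_nonneg)
  have "ln ((1 + x) / m) \<le> (1 + x) / m - 1" "ln (1 / m) \<le> 1 / m - 1"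
    using m assms by (intro ln_le_minus_one; simp)+
  then have "a * ln ((1 + x) / m) + (1 - a) * ln (1 / m) \<le> a * ((1 + x) / m - 1) + (1 - a) * (1 / m - 1)"
    using assms by (intro add_mono mult_left_mono) auto
  also have "\<dots> = 0" using m by (simp add: field_simps) (simp add: m_def algebra_simps)
  finally have "a * ln (1 + x) \<le> ln m" using m assms by (simp add: ln_div algebra_simps)
  then have "exp (a * ln (1 + x)) \<le> m" using m by (metis exp_le_cancel_iff exp_ln)
  then show ?thesis using assms by (simp add: powr_def m_def)
qed

lemma powr_nonpos_le_1: "1 \<le> x \<Longrightarrow> e \<le> 0 \<Longrightarrow> x powr e \<le> (1::real)"
  using powr_mono[of e 0 x] by simp

text \<open>After \<open>i\<close> phases at most \<open>n (z0 - 1) / (growth z0 i - 1)\<close> clusters survive. Since \<open>5\<close>, the growth rate of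
  the radius, is at most \<open>(7 / 4)\<^sup>3\<close>, reaching a prescribed power of \<open>z0\<close> costs a radius that is only cubic
  in the exponent.\<close>

definition growth :: "real \<Rightarrow> nat \<Rightarrow> real" where
  "growth z0 i = z0 powr ((7 / 4) ^ i)"

text \<open>Solved from the wanted decay: \<open>d + 1\<close> has to reach \<open>17 / 16\<close>
  times the ratio of consecutive values of \<open>growth - 1\<close>, the \<open>17 / 16\<close>
  compensating the loss in a phase.\<close>

definition sched_degree :: "real \<Rightarrow> nat \<Rightarrow> nat" where
  "sched_degree z0 i = nat (max 1 (\<lceil>17 / 16 * (growth z0 (Suc i) - 1) / (growth z0 i - 1)\<rceil> - 1))"

text \<open>Once \<open>z i\<close> exceeds \<open>7 / 6\<close>, a phase shrinks
  \<open>z i powr (- 1 / 4)\<close> at least by this factor; the exponent is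
  \<open>- 1 / 4 * (7 / 4 - 1)\<close>.\<close>

definition "theta = (7 / 6 :: real) powr (- 3 / 16)"

lemma theta: "0 < theta" "theta < 1"
  unfolding theta_def using powr_less_one[of "7 / 6" "- 3 / 16"] by auto

section \<open>Growing degrees and their total cost\<close>

locale schedule =
  fixes z0 :: real
  assumes z0: "1 < z0"
begin

abbreviation "z \<equiv> growth z0"
abbreviation "deg \<equiv> sched_degree z0"

lemma z_gt: "1 < z i"
  using z0 by (simp add: growth_def gr_one_powr)

lemma z_Suc: "z (Suc i) = z i powr (7 / 4)"
  by (simp add: growth_def powr_powr mult.commute)

lemma deg_ge1: "1 \<le> deg i"
  by (simp add: sched_degree_def)

lemma deg_lower: "17 / 16 * (z (Suc i) - 1) / (z i - 1) \<le> real (deg i) + 1"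
  unfolding sched_degree_def by linarith

lemma deg_upper: "deg i = 1 \<or> real (deg i) < 17 / 16 * (z (Suc i) - 1) / (z i - 1)"
  unfolding sched_degree_def by linarith

text \<open>Together with \<open>deg_lower\<close> this makes the degrees grow at least like
  \<open>z i powr (3 / 4)\<close>, which ensures that the target degree is reached.\<close>

lemma z_ratio: "z i powr (3 / 4) * (z i - 1) \<le> z (Suc i) - 1"
proof -
  have "1 \<le> z i powr (3 / 4)" using z_gt[of i] by (simp add: ge_one_powr_ge_zero)
  moreover have "z (Suc i) = z i powr (3 / 4) * z i"
    unfolding z_Suc using z_gt[of i] powr_add[of "z i" "3 / 4" 1] by simp
  ultimately show ?thesis by (simp add: algebra_simps)
qed

text \<open>Degree 1 costs no edges, so only the indices with \<open>z i\<close> above \<open>7 / 6\<close> contribute to the cost,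
  and for these the cost decays geometrically.\<close>

lemma deg_small:
  assumes "z i \<le> 7 / 6" shows "deg i = 1"
proof (rule ccontr)
  assume "deg i \<noteq> 1"
  then have "2 \<le> deg i" using deg_ge1[of i] by linarith
  then have r: "2 < 17 / 16 * (z (Suc i) - 1) / (z i - 1)" using deg_upper[of i] \<open>deg i \<noteq> 1\<close> by linarith
  define x where "x = z i - 1"
  have x: "0 < x" "x \<le> 1 / 6" using z_gt[of i] assms by (simp_all add: x_def)
  have "z (Suc i) = (1 + x) powr (3 / 4) * (1 + x)"
    unfolding z_Suc x_def using z_gt[of i] powr_add[of "z i" "3 / 4" 1] by simp
  also have "\<dots> \<le> (1 + 3 / 4 * x) * (1 + x)"
    using powr_le_linear[of x "3 / 4"] x by (intro mult_right_mono) auto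
  also have "\<dots> = 1 + x * (7 / 4 + 3 / 4 * x)" by (simp add: field_simps)
  finally have "z (Suc i) - 1 \<le> x * (7 / 4 + 3 / 4 * x)" by simp
  then have "(z (Suc i) - 1) / x \<le> 7 / 4 + 3 / 4 * x" using x by (simp add: pos_divide_le_eq mult.commute)
  moreover have "17 / 16 * (z (Suc i) - 1) / (z i - 1) = 17 / 16 * ((z (Suc i) - 1) / x)" by (simp add: x_def)
  \<comment> \<open>The threshold \<open>7 / 6\<close> is made for this:
    \<open>17 / 16 * (7 / 4 + 3 / 4 * (1 / 6)) = 255 / 128 < 2\<close>.\<close>
  ultimately show False using r x by linarith
qed

text \<open>The cost is dominated by a telescoping difference. Above \<open>7 / 6\<close> one has
  \<open>z i \<le> 7 * (z i - 1)\<close>, so the quotient is at most \<open>17 / 16 * 49\<close>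
  times \<open>z i powr (7 / 4 - 2)\<close>; 60 is a rounded constant.\<close>

lemma cost_step:
  "(real (deg i) - 1) / (z i - 1) \<le> 60 / (1 - theta) * (z i powr (- 1 / 4) - z (Suc i) powr (- 1 / 4))"
proof -
  define y where "y = z i powr (- 1 / 4)"
  have zi: "1 < z i" by (rule z_gt)
  have y: "0 < y" "y \<le> 1" using zi by (auto simp: y_def powr_nonpos_le_1)
  have ys: "z (Suc i) powr (- 1 / 4) = y * z i powr (- 3 / 16)"
    unfolding z_Suc y_def powr_powr using powr_add[of "z i" "- 1 / 4" "- 3 / 16"] by simp
  show ?thesis
  proof (cases "z i \<le> 7 / 6")
    case True
    have "z i powr (- 3 / 16) \<le> 1" using zi by (simp add: powr_nonpos_le_1)
    then have "0 \<le> y - z (Suc i) powr (- 1 / 4)" unfolding ys using y by (simp add: mult_left_le)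
    then have "0 \<le> 60 / (1 - theta) * (y - z (Suc i) powr (- 1 / 4))" using theta by simp
    then show ?thesis using deg_small[OF True] by (simp add: y_def)
  next
    case False
    define x where "x = z i - 1"
    have x: "0 < x" "z i \<le> 7 * x" using False by (auto simp: x_def)
    have "real (deg i) - 1 \<le> 17 / 16 * (z (Suc i) - 1) / x"
    proof (cases "deg i = 1")
      case True
      then show ?thesis using z_gt[of "Suc i"] x by simp
    next
      case False
      then show ?thesis using deg_upper[of i] by (simp add: x_def)
    qed
    also have "\<dots> \<le> 17 / 16 * z i powr (7 / 4) / x"
      using x by (intro divide_right_mono mult_left_mono) (simp_all add: z_Suc)
    finally have "(real (deg i) - 1) / x \<le> 17 / 16 * z i powr (7 / 4) / x / x"
      using x by (intro divide_right_mono) auto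
    also have "\<dots> = 17 / 16 * z i powr (7 / 4) / x\<^sup>2" by (simp add: power2_eq_square)
    also have "\<dots> \<le> 17 / 16 * z i powr (7 / 4) / (z i / 7)\<^sup>2"
      using x zi by (intro divide_left_mono power_mono mult_pos_pos) auto
    also have "\<dots> = 17 / 16 * 49 * (z i powr (7 / 4) / (z i)\<^sup>2)" by (simp add: power2_eq_square)
    also have "z i powr (7 / 4) / (z i)\<^sup>2 = y"
      using zi powr_diff[of "z i" "7 / 4" 2] by (simp add: y_def)
    also have "17 / 16 * 49 * y \<le> 60 * y" using y by simp
    finally have 1: "(real (deg i) - 1) / x \<le> 60 * y" .
    have "z i powr (- 3 / 16) \<le> theta"
      unfolding theta_def using False by (intro powr_mono2') auto
    then have "z (Suc i) powr (- 1 / 4) \<le> y * theta" unfolding ys using y by simp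
    then have "y * (1 - theta) \<le> y - z (Suc i) powr (- 1 / 4)" by (simp add: algebra_simps)
    then have "y \<le> (y - z (Suc i) powr (- 1 / 4)) / (1 - theta)" using theta by (simp add: field_simps)
    then have "60 * y \<le> 60 * ((y - z (Suc i) powr (- 1 / 4)) / (1 - theta))" by (rule mult_left_mono) simp
    then have "60 * y \<le> 60 / (1 - theta) * (y - z (Suc i) powr (- 1 / 4))"
      by (simp only: times_divide_eq_left times_divide_eq_right)
    then show ?thesis using 1 unfolding x_def y_def by linarith
  qed
qed

lemma cost_sum: "(\<Sum>i<m. (real (deg i) - 1) / (z i - 1)) \<le> 60 / (1 - theta)"
proof -
  have "(\<Sum>i<m. (real (deg i) - 1) / (z i - 1)) \<le>
      (\<Sum>i<m. 60 / (1 - theta) * (z i powr (- 1 / 4) - z (Suc i) powr (- 1 / 4)))"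
    by (intro sum_mono cost_step)
  also have "\<dots> = 60 / (1 - theta) * (z 0 powr (- 1 / 4) - z m powr (- 1 / 4))"
    unfolding sum_distrib_left[symmetric]
    using sum_lessThan_telescope'[of "\<lambda>i. z i powr (- 1 / 4)" m] by simp
  also have "\<dots> \<le> 60 / (1 - theta) * 1"
  proof (rule mult_left_mono)
    have "z 0 powr (- 1 / 4) \<le> 1" using z_gt[of 0] by (simp add: powr_nonpos_le_1)
    then show "z 0 powr (- 1 / 4) - z m powr (- 1 / 4) \<le> 1" by (smt (verit) powr_ge_zero)
  qed (use theta in simp)
  finally show ?thesis by simp
qed

text \<open>The bounds are proved by one induction, because the cost of a phase is measured by the
  cluster bound reached so far.\<close>

lemma sched_bound:
  assumes b: "0 \<le> b"
  shows "0 \<le> cluster_bound b (map deg [0..<m])"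
    "cluster_bound b (map deg [0..<m]) \<le> b * (z 0 - 1) / (z m - 1)"
    "edge_cost b (map deg [0..<m]) \<le> b * (z 0 - 1) * (\<Sum>i<m. (real (deg i) - 1) / (z i - 1))"
proof -
  have *: "0 \<le> cluster_bound b (map deg [0..<m]) \<and> cluster_bound b (map deg [0..<m]) \<le> b * (z 0 - 1) / (z m - 1) \<and>
    edge_cost b (map deg [0..<m]) \<le> b * (z 0 - 1) * (\<Sum>i<m. (real (deg i) - 1) / (z i - 1))"
  proof (induction m)
    case 0
    then show ?case using b z_gt[of 0] by simp
  next
    case (Suc m)
    let ?B = "cluster_bound b (map deg [0..<m])"
    have zm: "0 < z m - 1" "0 < z (Suc m) - 1" using z_gt[of m] z_gt[of "Suc m"] by auto
    have "?B * (17 / 16) / real (deg m + 1) \<le> b * (z 0 - 1) / (z m - 1) * (17 / 16) / (17 / 16 * (z (Suc m) - 1) / (z m - 1))"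
      using Suc deg_lower[of m] zm b z_gt[of 0]
      by (intro frac_le mult_right_mono mult_nonneg_nonneg divide_nonneg_nonneg divide_pos_pos mult_pos_pos) auto
    also have "\<dots> = b * (z 0 - 1) / (z (Suc m) - 1)"
    proof -
      have "x / y * (17 / 16) / (17 / 16 * y' / y) = x / y'" if "0 < y" "0 < y'" for x y y' :: real
        using that by (simp add: field_simps)
      then show ?thesis using zm by blast
    qed
    finally have 1: "cluster_bound b (map deg [0..<Suc m]) \<le> b * (z 0 - 1) / (z (Suc m) - 1)"
      by (simp add: cluster_bound_append)
    have "?B * (real (deg m) - 1) \<le> b * (z 0 - 1) / (z m - 1) * (real (deg m) - 1)"
      using Suc deg_ge1[of m] by (intro mult_right_mono) auto
    then have "edge_cost b (map deg [0..<Suc m]) \<le>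
        b * (z 0 - 1) * (\<Sum>i<m. (real (deg i) - 1) / (z i - 1)) + b * (z 0 - 1) / (z m - 1) * (real (deg m) - 1)"
      using Suc by (simp add: edge_cost_append)
    also have "\<dots> = b * (z 0 - 1) * (\<Sum>i<Suc m. (real (deg i) - 1) / (z i - 1))"
      by (simp add: algebra_simps)
    finally show ?case using 1 Suc by (simp add: cluster_bound_append)
  qed
  then show "0 \<le> cluster_bound b (map deg [0..<m])"
    "cluster_bound b (map deg [0..<m]) \<le> b * (z 0 - 1) / (z m - 1)"
    "edge_cost b (map deg [0..<m]) \<le> b * (z 0 - 1) * (\<Sum>i<m. (real (deg i) - 1) / (z i - 1))" by blast+
qed

end

text \<open>The first term \<open>z0 = 1 + (n powr (1 / \<kappa>) - 1) / slack\<close> makes the total cost at most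
  \<open>n (n powr (1 / \<kappa>) - 1)\<close>, also when \<open>n powr (1 / \<kappa>)\<close> is close to 1.\<close>

definition "slack = 180 / (1 - theta)"

lemma slack: "180 \<le> slack"
  unfolding slack_def using theta by (simp add: field_simps)

text \<open>By minimality the previous power of \<open>7 / 4\<close> lies below \<open>a\<close>, so
  \<open>a ^ 3\<close> bounds the previous power of 5; the leading 5 pays for the last step.\<close>

lemma first_exceeding:
  assumes "1 \<le> a"
  obtains i where "a \<le> (7 / 4 :: real) ^ i" "5 ^ i \<le> 5 * a ^ 3"
proof -
  define i where "i = (LEAST i. a \<le> (7 / 4 :: real) ^ i)"
  obtain j where "a < (7 / 4 :: real) ^ j" using real_arch_pow[of "7 / 4" a] by auto
  then have i: "a \<le> (7 / 4) ^ i" unfolding i_def by (intro LeastI[of "\<lambda>i. a \<le> (7 / 4 :: real) ^ i" j]) simp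
  have "5 ^ i \<le> 5 * a ^ 3"
  proof (cases i)
    case 0
    then show ?thesis using one_le_power[OF assms, of 3] by simp
  next
    case (Suc k)
    have "k < i" using Suc by simp
    then have "\<not> a \<le> (7 / 4) ^ k" unfolding i_def by (rule not_less_Least)
    then have "((7 / 4) ^ k) ^ 3 \<le> a ^ 3" by (intro power_mono) auto
    moreover have "(5 :: real) ^ k \<le> ((7 / 4) ^ 3) ^ k" by (intro power_mono) (auto simp: power3_eq_cube)
    ultimately have "5 ^ k \<le> a ^ 3" by (simp add: power_mult[symmetric] mult.commute)
    then show ?thesis using Suc by simp
  qed
  with i that show thesis by blast
qed

text \<open>Each phase divides the bound at least by \<open>s\<close>, the square root of
  \<open>w\<close>; giving away half of the exponent absorbs the factor \<open>17 / 16\<close>.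
  About \<open>20 / \<rho>\<close> phases bring the bound down to 1, and the additional one makes it
  strict.\<close>

lemma constant_tail:
  fixes n :: nat and \<rho> w :: real
  defines "w \<equiv> real n powr (\<rho> / 10)"
  assumes n: "1 \<le> n" and \<rho>: "0 < \<rho>" and X: "1 \<le> X" "w \<le> real X + 1" and b: "0 \<le> b" "b \<le> real n"
  shows "cluster_bound b (replicate (nat \<lceil>20 / \<rho>\<rceil> + 1) X) < 1"
proof -
  define k where "k = nat \<lceil>20 / \<rho>\<rceil>"
  define q where "q = 17 / 16 / real (X + 1)"
  define s where "s = real n powr (\<rho> / 20)"
  have s: "1 \<le> s" "s * s = w" using n \<rho> by (auto simp: s_def w_def ge_one_powr_ge_zero powr_add[symmetric])
  have q: "0 < q" "q \<le> 17 / 32" using X by (auto simp: q_def field_simps)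
  \<comment> \<open>For small \<open>s\<close> the constant 2 suffices, since
    \<open>17 / 16 * (7 / 4) < 2 \<le> X + 1\<close>; otherwise
    \<open>17 / 16 * s \<le> s * s\<close>.\<close>
  have "17 / 16 * s \<le> real X + 1"
  proof (cases "s \<le> 7 / 4")
    case True
    then show ?thesis using X by linarith
  next
    case False
    then have "17 / 16 * s \<le> s * s" by (intro mult_right_mono) auto
    then show ?thesis using s X by linarith
  qed
  then have "q \<le> 1 / s" using s by (simp add: q_def field_simps)
  then have "q ^ k \<le> (1 / s) ^ k" using q by (intro power_mono) auto
  also have "\<dots> = 1 / s ^ k" by (simp add: power_one_over)
  also have "\<dots> \<le> 1 / real n"
  proof -
    have "20 / \<rho> \<le> real k" unfolding k_def by linarith
    then have "20 \<le> real k * \<rho>" using \<rho> by (simp only: pos_divide_le_eq)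
    then have "1 \<le> \<rho> / 20 * real k" by (simp add: mult.commute)
    then have "real n powr 1 \<le> real n powr (\<rho> / 20 * real k)" using n by (intro powr_mono) auto
    also have "\<dots> = s powr real k" by (simp add: s_def powr_powr)
    also have "\<dots> = s ^ k" using s by (simp add: powr_realpow)
    finally show ?thesis using n by (intro divide_left_mono) auto
  qed
  finally have "q ^ k \<le> 1 / real n" .
  then have "b * q ^ k \<le> real n * (1 / real n)" using b q by (intro mult_mono) auto
  then have "b * q ^ k \<le> 1" using n by simp
  then have "b * q ^ k * q \<le> 1 * (17 / 32)" using q b by (intro mult_mono) auto
  then show ?thesis unfolding cluster_bound_replicate q_def[symmetric] k_def[symmetric] power_add power_one_right mult.assoc
    by linarith
qed

text \<open>The separate summand \<open>real n\<close> in the edge bound is reserved for the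
  spanning trees of the final clusters.\<close>

lemma schedule_exists:
  fixes \<kappa> n :: nat and \<rho> :: real
  assumes \<kappa>: "2 \<le> \<kappa>" and \<rho>: "1 / real \<kappa> \<le> \<rho>" and n: "1 \<le> n"
  shows "\<exists>ds. (\<forall>d\<in>set ds. 1 \<le> d \<and> real d \<le> real n powr (\<rho> / 10)) \<and> cluster_bound (real n) ds < 1 \<and>
     real n + edge_cost (real n) ds \<le> real n powr (1 + 1 / real \<kappa>) \<and>
     5 ^ length ds \<le> 125 * (slack * (real \<kappa> * \<rho>)) ^ 3 * 5 powr (20 / \<rho>)"
proof -
  have \<rho>0: "0 < \<rho>" using \<kappa> \<rho> by (smt (verit) of_nat_0_less_iff zero_less_divide_1_iff zero_less_numeral order_less_le_trans)
  have \<kappa>\<rho>: "1 \<le> real \<kappa> * \<rho>" using \<rho> \<kappa> by (simp add: field_simps)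
  define a where "a = slack * (real \<kappa> * \<rho>)"
  have "1 * 1 \<le> slack * (real \<kappa> * \<rho>)" using slack \<kappa>\<rho> by (intro mult_mono) auto
  then have a1: "1 \<le> a" by (simp add: a_def)
  define w where "w = real n powr (\<rho> / 10)"
  define X where "X = nat \<lfloor>w\<rfloor>"
  have w1: "1 \<le> w" using n \<rho>0 by (simp add: w_def ge_one_powr_ge_zero)
  have X: "1 \<le> X" "real X \<le> w" "w \<le> real X + 1" using w1 by (auto simp: X_def) linarith+
  define m where "m = nat \<lceil>20 / \<rho>\<rceil> + 1"
  have tail: "cluster_bound b (replicate m X) < 1" if "0 \<le> b" "b \<le> real n" for b
    unfolding m_def by (rule constant_tail[OF n \<rho>0 X(1) X(3)[unfolded w_def] that])
  have "real m \<le> 20 / \<rho> + 2" using \<rho>0 by (simp add: m_def) linarith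
  then have "5 powr real m \<le> 5 powr (20 / \<rho> + 2)" by (intro powr_mono) auto
  then have m5: "5 ^ m \<le> 25 * 5 powr (20 / \<rho>)" by (simp add: powr_realpow powr_add)
  have nk: "real n * real n powr (1 / real \<kappa>) = real n powr (1 + 1 / real \<kappa>)" using n by (simp add: powr_add)
  have nk1: "1 \<le> real n powr (1 / real \<kappa>)" using n by (simp add: ge_one_powr_ge_zero)
  show ?thesis
  proof (cases "X = 1")
    case True
    \<comment> \<open>All degrees are 1 here, so the tail alone is enough and costs nothing. This
      covers \<open>n = 1\<close>, where \<open>z0\<close> would degenerate to 1.\<close>
    have "edge_cost (real n) (replicate m X) \<le> 0"
      using edge_cost_replicate[of "real n" X m] by (simp add: True)
    moreover have "real n * 1 \<le> real n powr (1 + 1 / real \<kappa>)" unfolding nk[symmetric] using nk1 by (intro mult_left_mono) auto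
    moreover have "25 * 1 * 5 powr (20 / \<rho>) \<le> 125 * a ^ 3 * 5 powr (20 / \<rho>)"
      using one_le_power[OF a1, of 3] by (intro mult_right_mono) auto
    ultimately have "5 ^ m \<le> 125 * a ^ 3 * 5 powr (20 / \<rho>)" "real n + edge_cost (real n) (replicate m X) \<le> real n powr (1 + 1 / real \<kappa>)"
      using m5 by linarith+
    then show ?thesis
      using X tail[of "real n"] unfolding w_def a_def by (intro exI[of _ "replicate m X"]) simp
  next
    case False
    then have w2: "2 \<le> w" using X by linarith
    have n2: "1 < real n"
    proof (rule ccontr)
      assume "\<not> 1 < real n"
      then have "real n = 1" using n by simp
      then show False using w2 by (simp add: w_def)
    qed
    define \<epsilon> where "\<epsilon> = real n powr (1 / real \<kappa>) - 1"
    have \<epsilon>: "0 < \<epsilon>" using n2 \<kappa> by (simp add: \<epsilon>_def gr_one_powr)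
    define z0 where "z0 = 1 + \<epsilon> / slack"
    have z0: "1 < z0" using \<epsilon> slack by (simp add: z0_def)
    interpret schedule z0 by unfold_locales (rule z0)
    note sch = sched_bound[of "real n", OF of_nat_0_le_iff]
    let ?z = "growth z0" and ?d = "sched_degree z0"
    obtain i where i: "a \<le> (7 / 4) ^ i" "5 ^ i \<le> 5 * a ^ 3" by (rule first_exceeding[OF a1])
    \<comment> \<open>Bernoulli gives \<open>z0 \<ge> n powr (1 / (\<kappa> * slack))\<close>, and
      \<open>a = slack * (\<kappa> * \<rho>)\<close> is the exponent that lifts this to
      \<open>n powr \<rho>\<close>. Its power \<open>3 / 4\<close> is at least \<open>w * w\<close>,
      which leaves room for the \<open>+ 1\<close> of the degree formula.\<close>
    have reach: "X \<le> ?d i"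
    proof -
      have "(1 + \<epsilon>) powr (1 / slack) \<le> z0"
        using powr_le_linear[of \<epsilon> "1 / slack"] \<epsilon> slack by (simp add: z0_def)
      then have "((1 + \<epsilon>) powr (1 / slack)) powr ((7 / 4) ^ i) \<le> ?z i"
        unfolding growth_def by (intro powr_mono2) auto
      moreover have "((1 + \<epsilon>) powr (1 / slack)) powr ((7 / 4) ^ i) = real n powr (1 / real \<kappa> * (1 / slack) * (7 / 4) ^ i)"
        by (simp add: \<epsilon>_def powr_powr)
      moreover have "real n powr \<rho> \<le> real n powr (1 / real \<kappa> * (1 / slack) * (7 / 4) ^ i)"
      proof (rule powr_mono)
        have "\<rho> = 1 / real \<kappa> * (1 / slack) * a" using slack \<kappa> by (simp add: a_def)
        also have "\<dots> \<le> 1 / real \<kappa> * (1 / slack) * (7 / 4) ^ i" using i slack by (intro mult_left_mono) auto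
        finally show "\<rho> \<le> 1 / real \<kappa> * (1 / slack) * (7 / 4) ^ i" .
      qed (use n in simp)
      ultimately have zi: "real n powr \<rho> \<le> ?z i" by linarith
      have "w * w \<le> (real n powr \<rho>) powr (3 / 4)"
        unfolding w_def powr_powr powr_add[symmetric] using n \<rho>0 by (intro powr_mono) auto
      also have "\<dots> \<le> ?z i powr (3 / 4)" using zi by (intro powr_mono2) auto
      also have "\<dots> \<le> (?z (Suc i) - 1) / (?z i - 1)"
        using z_ratio[of i] z_gt[of i] by (simp add: field_simps)
      also have "\<dots> \<le> 17 / 16 * (?z (Suc i) - 1) / (?z i - 1)"
        using z_gt[of i] z_gt[of "Suc i"] by (intro divide_right_mono) auto
      also have "\<dots> \<le> real (?d i) + 1" by (rule deg_lower)
      finally have "w * w \<le> real (?d i) + 1" .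
      moreover have "2 * w \<le> w * w" using w2 by (intro mult_right_mono) auto
      ultimately have "real X \<le> real (?d i)" using X w2 by linarith
      then show ?thesis by simp
    qed
    define I where "I = (LEAST i. X \<le> ?d i)"
    have I: "X \<le> ?d I" unfolding I_def by (rule LeastI[of "\<lambda>i. X \<le> ?d i", OF reach])
    have I_less: "?d j < X" if "j < I" for j using not_less_Least[OF that[unfolded I_def]] by simp
    have "I \<le> i" unfolding I_def by (rule Least_le[of "\<lambda>i. X \<le> ?d i", OF reach])
    then have "(5::real) ^ I \<le> 5 ^ i" by (intro power_increasing) auto
    then have I5: "5 ^ I \<le> 5 * a ^ 3" using i by linarith
    define B where "B = cluster_bound (real n) (map ?d [0..<I])"
    define ds where "ds = map ?d [0..<I] @ replicate m X"
    have Bn: "0 \<le> B" "B \<le> real n * (?z 0 - 1) / (?z I - 1)" using sch(1,2)[of I] by (simp_all add: B_def)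
    have zI: "0 < ?z I - 1" "?z 0 - 1 \<le> ?z I - 1"
    proof -
      show "0 < ?z I - 1" using z_gt[of I] by simp
      have "z0 powr 1 \<le> z0 powr ((7 / 4) ^ I)" using z0 by (intro powr_mono) auto
      then show "?z 0 - 1 \<le> ?z I - 1" by (simp add: growth_def)
    qed
    have "real n * (?z 0 - 1) / (?z I - 1) \<le> real n"
      using zI by (simp add: pos_divide_le_eq mult_left_mono)
    then have "cluster_bound (real n) ds < 1"
      using tail[of B] Bn by (simp add: ds_def cluster_bound_append B_def)
    moreover have "real n + edge_cost (real n) ds \<le> real n powr (1 + 1 / real \<kappa>)"
    proof -
      let ?g = "\<lambda>i. (real (?d i) - 1) / (?z i - 1)"
      have g0: "0 \<le> ?g i" for i using deg_ge1[of i] z_gt[of i] by (intro divide_nonneg_pos) auto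
      \<comment> \<open>The whole tail is charged like a term with index \<open>I\<close> of the
        cost sum: \<open>B\<close> is bounded through \<open>?z I\<close>, and
        \<open>X \<le> ?d I\<close>. Hence \<open>cost_sum\<close> for \<open>Suc I\<close> covers
        both parts of the schedule.\<close>
      have "edge_cost B (replicate m X) \<le> 3 * B * (real X - 1)" by (rule edge_cost_replicate[OF Bn(1) X(1)])
      also have "\<dots> \<le> 3 * (real n * (?z 0 - 1) / (?z I - 1)) * (real (?d I) - 1)"
        using Bn X(1) I by (intro mult_mono) auto
      also have "\<dots> = 3 * (real n * (?z 0 - 1)) * ?g I" by simp
      finally have "edge_cost (real n) ds \<le> real n * (?z 0 - 1) * (\<Sum>i<I. ?g i) + 3 * (real n * (?z 0 - 1)) * ?g I"
        using sch(3)[of I] by (simp add: ds_def edge_cost_append B_def)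
      also have "\<dots> \<le> 3 * (real n * (?z 0 - 1)) * (\<Sum>i<I. ?g i) + 3 * (real n * (?z 0 - 1)) * ?g I"
        using z_gt[of 0] g0 by (intro add_right_mono mult_right_mono sum_nonneg) auto
      also have "\<dots> = 3 * (real n * (?z 0 - 1)) * (\<Sum>i<Suc I. ?g i)" by (simp add: distrib_left)
      also have "\<dots> \<le> 3 * (real n * (?z 0 - 1)) * (60 / (1 - theta))"
        using cost_sum[of "Suc I"] z_gt[of 0] by (intro mult_left_mono) auto
      \<comment> \<open>\<open>slack\<close> is three times the bound of \<open>cost_sum\<close>;
        the three comes from \<open>edge_cost_replicate\<close>.\<close>
      also have "\<dots> = real n * (?z 0 - 1) * slack" by (simp add: slack_def)
      also have "?z 0 - 1 = \<epsilon> / slack" using z0 by (simp add: growth_def) (simp add: z0_def)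
      also have "real n * (\<epsilon> / slack) * slack = real n * \<epsilon>" using slack by simp
      finally show ?thesis unfolding nk[symmetric] by (simp add: \<epsilon>_def algebra_simps)
    qed
    moreover have "5 ^ length ds \<le> 125 * a ^ 3 * 5 powr (20 / \<rho>)"
    proof -
      have "5 ^ length ds = (5::real) ^ I * 5 ^ m" by (simp add: ds_def power_add)
      also have "\<dots> \<le> (5 * a ^ 3) * (25 * 5 powr (20 / \<rho>))" using I5 m5 a1 by (intro mult_mono) auto
      finally show ?thesis by simp
    qed
    moreover have "1 \<le> d \<and> real d \<le> w" if "d \<in> set ds" for d
    proof -
      have "1 \<le> d \<and> d \<le> X" using that X(1) deg_ge1 I_less by (auto simp: ds_def less_imp_le)
      then show ?thesis using X(2) by (auto intro: order_trans[OF of_nat_mono])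
    qed
    ultimately show ?thesis unfolding w_def a_def by blast
  qed
qed

section \<open>Spanning trees of the final clusters and the stretch\<close>

lemma hop_dist_le: "(u, v) \<in> adj H ^^ k \<Longrightarrow> hop_dist H u v \<le> enat k"
  unfolding hop_dist_def by (rule INF_lower) simp

lemma hop_dist_cases:
  obtains "hop_dist G u v = \<infinity>" | k where "hop_dist G u v = enat k" "(u, v) \<in> adj G ^^ k"
proof (cases "{k. (u, v) \<in> adj G ^^ k} = {}")
  case True
  then have "hop_dist G u v = \<infinity>" unfolding hop_dist_def by (simp add: top_enat_def)
  then show ?thesis using that by blast
next
  case False
  then have "hop_dist G u v \<in> enat ` {k. (u, v) \<in> adj G ^^ k}"
    unfolding hop_dist_def Inf_enat_def by (auto intro: LeastI)
  then show ?thesis using that by blast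
qed

text \<open>Bounded reachability replaces \<open>hop_dist\<close> in the construction, as it
  composes without infinite values.\<close>

definition joined :: "nat set set \<Rightarrow> nat \<Rightarrow> nat \<Rightarrow> nat \<Rightarrow> bool" where
  "joined H k u v \<longleftrightarrow> (\<exists>j\<le>k. (u, v) \<in> adj H ^^ j)"

lemma joined_refl [simp]: "joined H k u u"
  unfolding joined_def by (rule exI[of _ 0]) simp

lemma joined_mono: "joined H j u v \<Longrightarrow> j \<le> k \<Longrightarrow> joined H k u v"
  unfolding joined_def by (blast intro: le_trans)

lemma joined_trans: "joined H j u v \<Longrightarrow> joined H k v w \<Longrightarrow> joined H (j + k) u w"
proof -
  assume "joined H j u v" "joined H k v w"
  then obtain a b where "a \<le> j" "b \<le> k" "(u, v) \<in> adj H ^^ a" "(v, w) \<in> adj H ^^ b" by (auto simp: joined_def)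
  then have "a + b \<le> j + k" "(u, w) \<in> adj H ^^ (a + b)" by (auto simp: relpow_add)
  then show ?thesis by (auto simp: joined_def)
qed

lemma joined_edge: "{u, v} \<in> H \<Longrightarrow> joined H 1 u v"
  unfolding joined_def adj_def by (rule exI[of _ 1]) simp

lemma joined_sym: "joined H k u v \<Longrightarrow> joined H k v u"
proof -
  have "(u, v) \<in> adj H ^^ j \<Longrightarrow> (v, u) \<in> adj H ^^ j" for j
  proof (induction j arbitrary: v)
    case (Suc j)
    then obtain w where "(u, w) \<in> adj H ^^ j" "(w, v) \<in> adj H" by auto
    moreover have "(v, w) \<in> adj H" using calculation by (auto simp: adj_def insert_commute)
    ultimately show ?case using Suc.IH by (blast intro: relpow_Suc_I2)
  qed simp
  then show "joined H k u v \<Longrightarrow> joined H k v u" by (auto simp: joined_def)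
qed

lemma joined_subset: "joined H k u v \<Longrightarrow> H \<subseteq> H' \<Longrightarrow> joined H' k u v"
proof -
  assume "H \<subseteq> H'"
  then have "adj H \<subseteq> adj H'" by (auto simp: adj_def)
  then have "adj H ^^ j \<subseteq> adj H' ^^ j" for j by (induction j) auto
  then show "joined H k u v \<Longrightarrow> joined H' k u v" by (auto simp: joined_def)
qed

text \<open>It suffices to replace each single edge by a walk of length at most \<open>L\<close> and
  to concatenate along a shortest walk of \<open>G\<close>.\<close>

lemma is_spannerI:
  assumes "H \<subseteq> G" and edge: "\<And>u v. {u, v} \<in> G \<Longrightarrow> joined H L u v" and t: "1 \<le> t" "real L \<le> t"
  shows "is_spanner t V G H"
proof -
  have walk: "(u, v) \<in> adj G ^^ k \<Longrightarrow> joined H (k * L) u v" for u v k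
  proof (induction k arbitrary: v)
    case (Suc k)
    then obtain w where "(u, w) \<in> adj G ^^ k" "(w, v) \<in> adj G" by auto
    with joined_trans[OF Suc.IH[of w] edge[of w v]] show ?case by (simp add: adj_def add.commute)
  qed simp
  have "ereal_of_enat (hop_dist H u v) \<le> ereal t * ereal_of_enat (hop_dist G u v)" for u v
  proof (rule hop_dist_cases[of G u v])
    assume "hop_dist G u v = \<infinity>"
    then show ?thesis using t by simp
  next
    fix k assume k: "hop_dist G u v = enat k" "(u, v) \<in> adj G ^^ k"
    obtain j where j: "j \<le> k * L" "(u, v) \<in> adj H ^^ j" using walk[OF k(2)] by (auto simp: joined_def)
    have "hop_dist H u v \<le> enat (k * L)"
      using hop_dist_le[OF j(2)] j(1) by (meson enat_ord_simps(1) order_trans)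
    then have "ereal_of_enat (hop_dist H u v) \<le> ereal_of_enat (enat (k * L))" by (simp only: ereal_of_enat_le_iff)
    also have "\<dots> = ereal (real k * real L)" by simp
    also have "\<dots> \<le> ereal (t * real k)" using t by (simp add: mult.commute mult_right_mono)
    finally show ?thesis using k by simp
  qed
  then show ?thesis using assms by (simp add: is_spanner_def)
qed

definition root_step :: "(vstate \<times> nat) step" where
  "root_step = ((\<lambda>\<sigma> p. []), (\<lambda>\<sigma> ms. (fst \<sigma>, if vid (fst \<sigma>) = vcl (fst \<sigma>) then 1 else 0)))"

text \<open>A reached vertex ignores later messages, so it has at most one parent port. This bounds
  the tree edges by the number of vertices.\<close>

definition bfs_step :: "(vstate \<times> nat) step" where
  "bfs_step =
     ((\<lambda>\<sigma> p. if snd \<sigma> \<noteq> 0 then [vcl (fst \<sigma>)] else []),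
      (\<lambda>\<sigma> ms. if snd \<sigma> \<noteq> 0 \<or> [vcl (fst \<sigma>)] \<notin> set ms then \<sigma>
        else ((fst \<sigma>)\<lparr>vmk := insert (port_of ms [vcl (fst \<sigma>)]) (vmk (fst \<sigma>))\<rparr>, 1)))"

text \<open>Both ends must know a spanner edge, but so far possibly only the end that selected it
  does. The content \<open>[1]\<close> is a mere signal within the identifier range.\<close>

definition announce_step :: "(vstate \<times> nat) step" where
  "announce_step =
     ((\<lambda>\<sigma> p. if p \<in> vmk (fst \<sigma>) then [1] else []),
      (\<lambda>\<sigma> ms. ((fst \<sigma>)\<lparr>vmk := vmk (fst \<sigma>) \<union> {p. p < length ms \<and> ms ! p = [1]}\<rparr>, snd \<sigma>)))"

definition tree_prog :: "nat \<Rightarrow> (vstate \<times> nat) step list" where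
  "tree_prog T = root_step # replicate T bfs_step @ [announce_step]"

lemma length_tree_prog: "length (tree_prog T) = T + 2" by (simp add: tree_prog_def)

text \<open>Flooding for \<open>2 * R\<close> rounds reaches a whole cluster of radius \<open>R\<close>.\<close>

primrec phases_prog :: "nat \<Rightarrow> (nat \<times> nat \<times> (nat \<Rightarrow> nat \<Rightarrow> bool)) list \<Rightarrow> (vstate \<times> nat) step list" where
  "phases_prog R [] = []"
| "phases_prog R (x # xs) = (case x of (d, M, hit) \<Rightarrow>
     phase_prog d (32 * d * d) M hit (2 * R) @ phases_prog (5 * R + 2) xs)"

primrec radius :: "nat \<Rightarrow> nat \<Rightarrow> nat" where
  "radius R 0 = R"
| "radius R (Suc k) = radius (5 * R + 2) k"

lemma radius: "2 * radius R k + 1 = (2 * R + 1) * 5 ^ k"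
proof (induction k arbitrary: R)
  case (Suc k)
  show ?case unfolding radius.simps Suc.IH by (simp add: algebra_simps)
qed simp

definition start :: "nat \<Rightarrow> nat \<Rightarrow> vstate \<times> nat" where
  "start i deg = (\<lparr>vid = i, vcl = i, vact = True, vpc = [], vcs = cinit, vpend = {}, vmk = {}\<rparr>, 0)"

definition spanner_prog :: "(nat \<times> nat \<times> (nat \<Rightarrow> nat \<Rightarrow> bool)) list \<Rightarrow> (vstate \<times> nat) step list" where
  "spanner_prog xs = phases_prog 0 xs @ tree_prog (radius 0 (length xs))"

definition selective :: "nat \<Rightarrow> nat \<Rightarrow> nat \<Rightarrow> (nat \<Rightarrow> nat \<Rightarrow> bool) \<Rightarrow> bool" where
  "selective k m M hit \<longleftrightarrow> (\<forall>u\<in>{1..k}. \<forall>Z. Z \<subseteq> {1..k} - {u} \<and> card Z \<le> m \<longrightarrow>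
     (\<exists>s<M. hit u s \<and> (\<forall>z\<in>Z. \<not> hit z s)))"

section \<open>Breadth-first trees and composition of the phases\<close>

context congest
begin

definition port_edges :: "(nat \<Rightarrow> nat set) \<Rightarrow> nat set set" where
  "port_edges F = {{v, nbrs N v ! p} | v p. v \<in> V \<and> p \<in> F v}"

text \<open>\<open>F v\<close> holds the parent port, and \<open>a v\<close> tells whether
  \<open>v\<close> has been reached. Walks are required in \<open>port_edges F\<close>, so tree
  edges alone connect a reached vertex to its centre.\<close>

definition bfs_inv :: "(nat \<Rightarrow> vstate) \<Rightarrow> nat \<Rightarrow> (nat \<Rightarrow> vstate \<times> nat) \<Rightarrow> (nat \<Rightarrow> nat set) \<Rightarrow> (nat \<Rightarrow> nat) \<Rightarrow> bool" where
  "bfs_inv r k s F a \<longleftrightarrow> (\<forall>v\<in>V.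
     s v = ((r v)\<lparr>vmk := vmk (r v) \<union> F v\<rparr>, a v) \<and> (a v = 0 \<longrightarrow> F v = {}) \<and> (\<exists>q. F v \<subseteq> {q}) \<and>
     F v \<subseteq> {..<length (nbrs N v)} \<and>
     (\<forall>c\<in>V. ident N c = vcl (r v) \<longrightarrow>
        (v \<in> near (\<lambda>v. vcl (r v)) k c \<longrightarrow> a v \<noteq> 0) \<and> (a v \<noteq> 0 \<longrightarrow> joined (port_edges F) k c v)))"

lemma bfs_root:
  assumes s: "sim s r" and r: "clustering R r"
  shows "\<exists>a. bfs_inv r 0 (exec1 2 K N root_step s) (\<lambda>_. {}) a"
proof -
  define a where "a v = (if ident N v = vcl (r v) then 1 else 0 :: nat)" for v
  have "exec1 2 K N root_step s v = (r v, a v)" if "v \<in> V" for v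
    using s r that by (simp add: sim_def exec1_def root_step_def clustering_def a_def)
  moreover have "joined (port_edges (\<lambda>_. {})) 0 c v" if "v \<in> V" "c \<in> V" "ident N c = vcl (r v)" "a v \<noteq> 0" for v c
  proof -
    have "c = v" using that ident_inj[of c v] by (simp add: a_def split: if_splits)
    then show ?thesis by simp
  qed
  ultimately have "bfs_inv r 0 (exec1 2 K N root_step s) (\<lambda>_. {}) a"
    unfolding bfs_inv_def by (auto simp: a_def)
  then show ?thesis by blast
qed

lemma bfs_next:
  assumes r: "clustering R r" and inv: "bfs_inv r k s F a"
  shows "\<exists>F a. bfs_inv r (Suc k) (exec1 2 K N bfs_step s) F a"
proof -
  let ?cl = "\<lambda>v. vcl (r v)"
  let ?I = "inbox 2 K N (fst bfs_step) s"
  have sv: "s v = ((r v)\<lparr>vmk := vmk (r v) \<union> F v\<rparr>, a v)" if "v \<in> V" for v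
    using inv that unfolding bfs_inv_def by blast
  have clK: "?cl v \<in> {1..K}" if "v \<in> V" for v
    using r that ident_bounds unfolding clustering_def by metis
  have msg: "clip 2 K (fst bfs_step (s u) p) = (if a u \<noteq> 0 then [?cl u] else [])" if "u \<in> V" for u p
    using sv[OF that] clK[OF that] by (simp add: bfs_step_def clip_def)
  have inb: "?I v ! p = (if a (nbrs N v ! p) \<noteq> 0 then [?cl (nbrs N v ! p)] else [])" if "v \<in> V" "p < length (nbrs N v)" for v p
    using msg nth_nbrs(1)[OF that] that by (simp add: nth_inbox)
  have mem: "[?cl v] \<in> set (?I v) \<longleftrightarrow> (\<exists>u. {v, u} \<in> E \<and> a u \<noteq> 0 \<and> ?cl u = ?cl v)" if v: "v \<in> V" for v
  proof
    assume "[?cl v] \<in> set (?I v)"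
    then obtain p where p: "p < length (nbrs N v)" "?I v ! p = [?cl v]" by (auto simp: in_set_conv_nth)
    then show "\<exists>u. {v, u} \<in> E \<and> a u \<noteq> 0 \<and> ?cl u = ?cl v"
      using inb[OF v p(1)] nth_nbrs(2)[OF v p(1)] by (auto split: if_splits)
  next
    assume "\<exists>u. {v, u} \<in> E \<and> a u \<noteq> 0 \<and> ?cl u = ?cl v"
    then obtain u where u: "{v, u} \<in> E" "a u \<noteq> 0" "?cl u = ?cl v" by blast
    obtain p where p: "p < length (nbrs N v)" "nbrs N v ! p = u" using ex_port[OF u(1)] by blast
    then have "?I v ! p = [?cl v]" using inb[OF v p(1)] u by simp
    then show "[?cl v] \<in> set (?I v)" using p(1) by (metis length_inbox nth_mem)
  qed
  define new where "new v \<longleftrightarrow> a v = 0 \<and> [?cl v] \<in> set (?I v)" for v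
  define F' where "F' v = (if new v then {port_of (?I v) [?cl v]} else F v)" for v
  define a' where "a' v = (if new v then 1 else a v)" for v
  have par: "port_of (?I v) [?cl v] < length (nbrs N v) \<and> {v, nbrs N v ! port_of (?I v) [?cl v]} \<in> E \<and>
      a (nbrs N v ! port_of (?I v) [?cl v]) \<noteq> 0 \<and> ?cl (nbrs N v ! port_of (?I v) [?cl v]) = ?cl v"
    if v: "v \<in> V" "new v" for v
  proof -
    let ?p = "port_of (?I v) [?cl v]"
    have p: "?p < length (nbrs N v)" "?I v ! ?p = [?cl v]" using port_of[of "[?cl v]" "?I v"] v by (auto simp: new_def)
    then show ?thesis using inb[OF v(1) p(1)] nth_nbrs(2)[OF v(1) p(1)] by (auto split: if_splits)
  qed
  have F0: "a v = 0 \<Longrightarrow> F v = {}" if "v \<in> V" for v using inv that unfolding bfs_inv_def by blast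
  \<comment> \<open>Reached vertices keep their parents, so walks found in earlier rounds
    survive.\<close>
  have "F v \<subseteq> F' v" if "v \<in> V" for v using F0[OF that] by (auto simp: F'_def new_def)
  then have sub: "port_edges F \<subseteq> port_edges F'" unfolding port_edges_def by blast
  have "exec1 2 K N bfs_step s v = ((r v)\<lparr>vmk := vmk (r v) \<union> F' v\<rparr>, a' v)" if v: "v \<in> V" for v
    using sv[OF v] F0[OF v] by (simp add: exec1_def bfs_step_def F'_def a'_def new_def)
  moreover have "a' v = 0 \<longrightarrow> F' v = {}" if "v \<in> V" for v using F0[OF that] by (simp add: F'_def a'_def)
  moreover have "\<exists>q. F' v \<subseteq> {q}" if "v \<in> V" for v
    using inv that unfolding bfs_inv_def by (cases "new v") (auto simp: F'_def)
  moreover have "F' v \<subseteq> {..<length (nbrs N v)}" if "v \<in> V" for v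
    using inv par[OF that] that unfolding bfs_inv_def by (cases "new v") (auto simp: F'_def)
  moreover have "(v \<in> near ?cl (Suc k) c \<longrightarrow> a' v \<noteq> 0) \<and> (a' v \<noteq> 0 \<longrightarrow> joined (port_edges F') (Suc k) c v)"
    if v: "v \<in> V" and c: "c \<in> V" "ident N c = ?cl v" for v c
  proof (intro conjI impI)
    assume "v \<in> near ?cl (Suc k) c"
    then obtain u where u: "u \<in> near ?cl k c" "v = u \<or> {u, v} \<in> E \<and> ?cl u = ?cl v"
      unfolding near_Suc_right same_cluster_def by blast
    have uV: "u \<in> V" using near_subset[OF c(1)] u(1) by (rule subsetD)
    have "?cl u = ?cl v" using u(2) by auto
    then have "a u \<noteq> 0" using inv uV u(1) c unfolding bfs_inv_def by metis
    then show "a' v \<noteq> 0"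
      using u(2) mem[OF v] by (auto simp: a'_def new_def insert_commute)
  next
    assume a': "a' v \<noteq> 0"
    show "joined (port_edges F') (Suc k) c v"
    proof (cases "new v")
      case False
      then have "joined (port_edges F) k c v" using a' inv v c unfolding bfs_inv_def by (simp add: a'_def)
      then show ?thesis using joined_subset[OF _ sub] joined_mono by (meson le_SucI order_refl)
    next
      case True
      let ?u = "nbrs N v ! port_of (?I v) [?cl v]"
      have u: "{v, ?u} \<in> E" "a ?u \<noteq> 0" "?cl ?u = ?cl v" using par[OF v True] by auto
      then have "?u \<in> V" using edgeV by blast
      then have "joined (port_edges F) k c ?u" using inv u c unfolding bfs_inv_def by metis
      then have 1: "joined (port_edges F') k c ?u" using joined_subset sub by blast
      have "{v, ?u} \<in> port_edges F'" using True v unfolding port_edges_def F'_def by force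
      then have "joined (port_edges F') 1 ?u v" by (intro joined_edge) (simp add: insert_commute)
      from joined_trans[OF 1 this] show ?thesis by simp
    qed
  qed
  ultimately have "bfs_inv r (Suc k) (exec1 2 K N bfs_step s) F' a'" unfolding bfs_inv_def by blast
  then show ?thesis by blast
qed

lemma bfs:
  assumes "clustering R r" "bfs_inv r k s F a"
  shows "\<exists>F a. bfs_inv r (k + T) (exec 2 K N (replicate T bfs_step) s) F a"
  using assms(2)
proof (induction T arbitrary: k s F a)
  case (Suc T)
  from bfs_next[OF assms(1) Suc.prems] obtain F' a' where "bfs_inv r (Suc k) (exec1 2 K N bfs_step s) F' a'" by blast
  from Suc.IH[OF this] show ?case by simp
qed auto

text \<open>An edge of \<open>port_edges G\<close> was selected at one of its ends: at
  \<open>v\<close> the own port set shows it, and at the other end the signal arrives on the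
  corresponding port.\<close>

lemma announce:
  assumes s: "\<And>v. v \<in> V \<Longrightarrow> vmk (fst (s v)) = G v" and G: "\<And>v. v \<in> V \<Longrightarrow> G v \<subseteq> {..<length (nbrs N v)}"
    and K1: "1 \<le> K" and v: "v \<in> V"
  shows "vmk (fst (exec1 2 K N announce_step s v)) = {p. p < length (nbrs N v) \<and> {v, nbrs N v ! p} \<in> port_edges G}"
proof -
  let ?I = "inbox 2 K N (fst announce_step) s v"
  have I: "?I ! p = [1] \<longleftrightarrow> port_to N (nbrs N v ! p) v \<in> G (nbrs N v ! p)" if p: "p < length (nbrs N v)" for p
    using s[OF nth_nbrs(1)[OF v p]] K1 p by (simp add: nth_inbox announce_step_def clip_def)
  have "p \<in> G v \<or> port_to N (nbrs N v ! p) v \<in> G (nbrs N v ! p) \<longleftrightarrow> {v, nbrs N v ! p} \<in> port_edges G"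
    if p: "p < length (nbrs N v)" for p
  proof
    let ?u = "nbrs N v ! p"
    have e: "{v, ?u} \<in> E" "?u \<in> V" using nth_nbrs[OF v p] by auto
    {
      assume "p \<in> G v \<or> port_to N ?u v \<in> G ?u"
      then show "{v, ?u} \<in> port_edges G"
      proof
        assume "p \<in> G v" then show ?thesis using v unfolding port_edges_def by blast
      next
        assume "port_to N ?u v \<in> G ?u"
        then have "{?u, nbrs N ?u ! port_to N ?u v} \<in> port_edges G" using e(2) unfolding port_edges_def by blast
        then show ?thesis using port_to_nth(2)[OF e(1)] by (simp add: insert_commute)
      qed
    }
    assume "{v, ?u} \<in> port_edges G"
    then obtain x q where x: "{v, ?u} = {x, nbrs N x ! q}" "x \<in> V" "q \<in> G x" unfolding port_edges_def by blast
    have q: "q < length (nbrs N x)" using G x by blast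
    from x(1) consider "x = v" "nbrs N x ! q = ?u" | "x = ?u" "nbrs N x ! q = v" by (auto simp: doubleton_eq_iff)
    then show "p \<in> G v \<or> port_to N ?u v \<in> G ?u"
    proof cases
      case 1
      then have "q = p" using q p nbrs_distinct[OF v] nth_eq_iff_index_eq by metis
      then show ?thesis using x 1 by simp
    next
      case 2
      then have "q = port_to N ?u v" using q port_to_nth[OF e(1)] nbrs_distinct[OF e(2)] nth_eq_iff_index_eq by metis
      then show ?thesis using x 2 by simp
    qed
  qed
  moreover have "vmk (fst (exec1 2 K N announce_step s v)) = G v \<union> {p. p < length (nbrs N v) \<and> ?I ! p = [1]}"
    using s[OF v] by (simp add: exec1_def announce_step_def)
  ultimately show ?thesis using I G[OF v] by auto
qed

text \<open>A detour consists of a marked edge and a traversal of each of the two clusters through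
  its centre, \<open>2 * R\<close> each. Every vertex adds at most its parent edge.\<close>

lemma tree_prog:
  assumes s: "sim s r" and r: "clustering R r" and retired: "\<And>v. v \<in> V \<Longrightarrow> \<not> vact (r v)" and K1: "1 \<le> K"
  shows "\<exists>H. H \<subseteq> E \<and> card H \<le> card (marked r) + card V \<and> (\<forall>u v. {u, v} \<in> E \<longrightarrow> joined H (4 * R + 1) u v) \<and>
    (\<forall>v\<in>V. vmk (fst (exec 2 K N (tree_prog R) s v)) = {p. p < length (nbrs N v) \<and> {v, nbrs N v ! p} \<in> H})"
proof -
  let ?cl = "\<lambda>v. vcl (r v)"
  define s1 where "s1 = exec 2 K N (replicate R bfs_step) (exec1 2 K N root_step s)"
  obtain a0 where "bfs_inv r 0 (exec1 2 K N root_step s) (\<lambda>_. {}) a0" using bfs_root[OF s r] by blast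
  from bfs[OF r this, of R] obtain F a where inv: "bfs_inv r R s1 F a" by (auto simp: s1_def)
  define G where "G v = vmk (r v) \<union> F v" for v
  define H where "H = port_edges G"
  have mkG: "vmk (r v) \<subseteq> {..<length (nbrs N v)}" "F v \<subseteq> {..<length (nbrs N v)}" if "v \<in> V" for v
    using r inv that unfolding clustering_def bfs_inv_def by blast+
  have 1: "vmk (fst (s1 v)) = G v" if "v \<in> V" for v
  proof -
    have "s1 v = ((r v)\<lparr>vmk := vmk (r v) \<union> F v\<rparr>, a v)" using inv that unfolding bfs_inv_def by blast
    then show ?thesis by (simp add: G_def)
  qed
  have 2: "G v \<subseteq> {..<length (nbrs N v)}" if "v \<in> V" for v using mkG[OF that] by (simp add: G_def)
  have out: "vmk (fst (exec 2 K N (tree_prog R) s v)) = {p. p < length (nbrs N v) \<and> {v, nbrs N v ! p} \<in> H}" if "v \<in> V" for v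
    using announce[OF 1 2 K1 that] by (simp add: tree_prog_def s1_def H_def)
  have HE: "H \<subseteq> E"
  proof
    fix e assume "e \<in> H"
    then obtain v p where "e = {v, nbrs N v ! p}" "v \<in> V" "p \<in> G v" unfolding H_def port_edges_def by blast
    then show "e \<in> E" using nth_nbrs(2)[of v p] 2[of v] by auto
  qed
  have finE: "finite E" using edge_sub finV by (meson Pow_iff finite_Pow_iff finite_subset subsetI)
  have H_split: "H = marked r \<union> port_edges F" unfolding H_def port_edges_def marked_def G_def by blast
  obtain q where q: "F v \<subseteq> {q v}" if "v \<in> V" for v using inv unfolding bfs_inv_def by metis
  have "port_edges F \<subseteq> (\<lambda>v. {v, nbrs N v ! q v}) ` V"
  proof
    fix e assume "e \<in> port_edges F"
    then obtain v p where e: "e = {v, nbrs N v ! p}" "v \<in> V" "p \<in> F v" unfolding port_edges_def by blast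
    then have "p = q v" using q by blast
    then show "e \<in> (\<lambda>v. {v, nbrs N v ! q v}) ` V" using e by blast
  qed
  then have "card (port_edges F) \<le> card V" using finV by (meson surj_card_le)
  then have card: "card H \<le> card (marked r) + card V"
    unfolding H_split using card_Un_le[of "marked r" "port_edges F"] by linarith
  have to_center: "joined H R c v" if v: "v \<in> V" and c: "c \<in> V" "ident N c = ?cl v" for v c
  proof -
    obtain c' where "c' \<in> V" "ident N c' = ?cl v" "v \<in> near ?cl R c'"
      using r v unfolding clustering_def by blast
    then have "v \<in> near ?cl R c" using c ident_inj by metis
    then have "joined (port_edges F) R c v" using inv v c unfolding bfs_inv_def by blast
    then show ?thesis by (rule joined_subset) (simp add: H_split)
  qed
  have same: "joined H (2 * R) v w" if v: "v \<in> V" and w: "w \<in> V" "?cl v = ?cl w" for v w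
  proof -
    obtain c where c: "c \<in> V" "ident N c = ?cl v" using r v unfolding clustering_def by blast
    then have "ident N c = ?cl w" using w(2) by simp
    from joined_trans[OF joined_sym[OF to_center[OF v c]] to_center[OF w(1) c(1) this]]
    show ?thesis by (simp add: mult_2)
  qed
  have "joined H (4 * R + 1) u v" if e: "{u, v} \<in> E" for u v
  proof -
    have V: "u \<in> V" "v \<in> V" using edgeV[OF e] by auto
    have "\<not> vact (r u)" using retired V by blast
    then consider "?cl u = ?cl v" | u1 v1 where "{u1, v1} \<in> marked r" "u1 \<in> V" "v1 \<in> V" "?cl u1 = ?cl u" "?cl v1 = ?cl v"
      using r e unfolding clustering_def by blast
    then show ?thesis
    proof cases
      case 1
      show ?thesis by (rule joined_mono[OF same[OF V 1]]) simp
    next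
      case 2
      have "joined H 1 u1 v1" by (rule joined_edge) (use 2 H_split in auto)
      from joined_trans[OF joined_trans[OF same[OF V(1) 2(2) 2(4)[symmetric]] this] same[OF 2(3) V(2) 2(5)]]
      show ?thesis by (rule joined_mono) simp
    qed
  qed
  then show ?thesis using HE card out by blast
qed

text \<open>The number \<open>b\<close> is only an upper bound for the active clusters. This allows
  a schedule fixed in advance, which no processor has to adapt to the actual counts.\<close>

lemma phases_prog:
  assumes "sim s r" "clustering R r" "real (card (active_clusters r)) \<le> b"
    and "\<And>d M hit. (d, M, hit) \<in> set xs \<Longrightarrow> 1 \<le> d \<and> selective K ((d + 1) * (32 * d * d)) M hit"
  shows "\<exists>r'. sim (exec 2 K N (phases_prog R xs) s) r' \<and> clustering (radius R (length xs)) r' \<and>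
    real (card (active_clusters r')) \<le> cluster_bound b (map fst xs) \<and>
    real (card (marked r')) \<le> real (card (marked r)) + edge_cost b (map fst xs)"
  using assms
proof (induction xs arbitrary: s r R b)
  case Nil
  then show ?case by auto
next
  case (Cons x xs)
  obtain d M hit where x: "x = (d, M, hit)" by (cases x)
  have ok: "1 \<le> d" "selective K ((d + 1) * (32 * d * d)) M hit" using Cons.prems(4)[of d M hit] x by auto
  let ?b' = "b * (17 / 16) / real (d + 1)"
  obtain r' where r': "sim (exec 2 K N (phase_prog d (32 * d * d) M hit (2 * R)) s) r'" "clustering (5 * R + 2) r'"
    "real (card (active_clusters r')) \<le> real (card (active_clusters r)) * (17 / 16) / real (d + 1)"
    "real (card (marked r')) \<le> real (card (marked r)) + real (card (active_clusters r)) * (real d - 1)"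
    using phase_prog[OF Cons.prems(1,2) ok(1) refl, of M hit] ok(2) unfolding selective_def by blast
  have "real (card (active_clusters r)) * (17 / 16) / real (d + 1) \<le> ?b'"
    using Cons.prems(3) by (intro divide_right_mono mult_right_mono) auto
  then have "real (card (active_clusters r')) \<le> ?b'" using r'(3) by linarith
  from Cons.IH[OF r'(1,2) this Cons.prems(4)] obtain r'' where r'':
    "sim (exec 2 K N (phases_prog (5 * R + 2) xs) (exec 2 K N (phase_prog d (32 * d * d) M hit (2 * R)) s)) r''"
    "clustering (radius (5 * R + 2) (length xs)) r''"
    "real (card (active_clusters r'')) \<le> cluster_bound ?b' (map fst xs)"
    "real (card (marked r'')) \<le> real (card (marked r')) + edge_cost ?b' (map fst xs)" by auto
  have "real (card (active_clusters r)) * (real d - 1) \<le> b * (real d - 1)"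
    using Cons.prems(3) ok(1) by (intro mult_right_mono) auto
  then have "real (card (marked r'')) \<le> real (card (marked r)) + edge_cost b (map fst (x # xs))"
    using r''(4) r'(4) by (simp add: x)
  then show ?case using r'' by (auto simp: x)
qed

lemma start_clustering:
  defines "r \<equiv> \<lambda>v. fst (start (ident N v) (length (nbrs N v)))"
  shows "sim (init_state N start) r" "clustering 0 r" "card (active_clusters r) = card V" "marked r = {}"
proof -
  show "sim (init_state N start) r" by (simp add: sim_def init_state_def r_def start_def)
  show "clustering 0 r" by (auto simp: clustering_def r_def start_def)
  have "active_clusters r = ident N ` V" by (auto simp: active_clusters_def r_def start_def)
  then show "card (active_clusters r) = card V" using ident_inj by (simp add: card_image inj_on_def)
  show "marked r = {}" by (simp add: marked_def r_def start_def)
qed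

lemma spanner_prog:
  assumes xs: "\<And>d M hit. (d, M, hit) \<in> set xs \<Longrightarrow> 1 \<le> d \<and> selective K ((d + 1) * (32 * d * d)) M hit"
    and b: "cluster_bound (real (card V)) (map fst xs) < 1" and K1: "1 \<le> K" and t: "2 * 5 ^ length xs \<le> t"
  shows "\<exists>H. constructs_within (protocol_of 2 K start (spanner_prog xs) (\<lambda>\<sigma>. vmk (fst \<sigma>))) N (length (spanner_prog xs)) H \<and>
     is_spanner t V E H \<and> real (card H) \<le> real (card V) + edge_cost (real (card V)) (map fst xs)"
proof -
  let ?R = "radius 0 (length xs)"
  obtain r where r: "sim (exec 2 K N (phases_prog 0 xs) (init_state N start)) r" "clustering ?R r"
    "real (card (active_clusters r)) \<le> cluster_bound (real (card V)) (map fst xs)"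
    "real (card (marked r)) \<le> edge_cost (real (card V)) (map fst xs)"
    using phases_prog[OF start_clustering(1,2) _ xs, where b="real (card V)"] start_clustering(3,4) by auto
  have "finite (active_clusters r)" using finV by (simp add: active_clusters_def)
  \<comment> \<open>A cardinality below 1 is 0. So no vertex is active any more, as
    \<open>tree_prog\<close> demands.\<close>
  moreover have "card (active_clusters r) = 0" using r(3) b by linarith
  ultimately have "active_clusters r = {}" by simp
  then have "\<not> vact (r v)" if "v \<in> V" for v using that unfolding active_clusters_def by blast
  from tree_prog[OF r(1,2) this K1] obtain H where H: "H \<subseteq> E" "card H \<le> card (marked r) + card V"
    "\<And>u v. {u, v} \<in> E \<Longrightarrow> joined H (4 * ?R + 1) u v"
    "\<And>v. v \<in> V \<Longrightarrow> vmk (fst (exec 2 K N (spanner_prog xs) (init_state N start) v)) =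
       {p. p < length (nbrs N v) \<and> {v, nbrs N v ! p} \<in> H}"
    by (auto simp: spanner_prog_def)
  have "2 * ?R + 1 = 5 ^ length xs" using radius[of 0 "length xs"] by simp
  then have "real (2 * ?R + 1) = 5 ^ length xs" by simp
  \<comment> \<open>Since \<open>2 * ?R + 1 = 5 ^ length xs\<close>, the stretch
    \<open>4 * ?R + 1\<close> is \<open>2 * 5 ^ length xs - 1\<close>.\<close>
  then have L: "real (4 * ?R + 1) \<le> t" "1 \<le> t" using t by auto
  have "constructs_within (protocol_of 2 K start (spanner_prog xs) (\<lambda>\<sigma>. vmk (fst \<sigma>))) N (length (spanner_prog xs)) H"
    by (rule constructs_within_protocol_of) (use H(4) in auto)
  moreover have "is_spanner t V E H" by (rule is_spannerI[OF H(1,3) L(2,1)])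
  moreover have "real (card H) \<le> real (card V) + edge_cost (real (card V)) (map fst xs)" using H(2) r(4) by linarith
  ultimately show ?thesis by blast
qed

end

section \<open>Selective families from codes with few agreements\<close>

text \<open>Union bound over the \<open>a\<close>-element sets of agreeing positions; on the other
  \<open>L - a\<close> positions the word is free.\<close>

lemma card_agreeing_words:
  fixes w :: "nat \<Rightarrow> nat"
  assumes "a \<le> L" "1 \<le> q"
  shows "card {g \<in> {..<L} \<rightarrow>\<^sub>E {..<q}. a \<le> card {x. x < L \<and> g x = w x}} \<le> L ^ a * q ^ (L - a)"
proof -
  let ?W = "{..<L} \<rightarrow>\<^sub>E {..<q}" and ?S = "{S. S \<subseteq> {..<L} \<and> card S = a}"
  let ?B = "\<lambda>S. {g \<in> ?W. \<forall>x\<in>S. g x = w x}" and ?A = "{g \<in> ?W. a \<le> card {x. x < L \<and> g x = w x}}"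
  have finW: "finite ?W" by (rule finite_PiE) auto
  have finS: "finite ?S" by (rule finite_subset[of _ "Pow {..<L}"]) auto
  have "?A \<subseteq> (\<Union>S\<in>?S. (?B S))"
  proof
    fix g assume g: "g \<in> ?A"
    then have "a \<le> card {x. x < L \<and> g x = w x}" by simp
    then obtain S where S: "S \<subseteq> {x. x < L \<and> g x = w x}" "card S = a" by (rule obtain_subset_with_card_n)
    show "g \<in> (\<Union>S\<in>?S. (?B S))"
    proof (rule UN_I[of S])
      show "S \<in> ?S" using S by auto
      show "g \<in> (?B S)" using S(1) g by auto
    qed
  qed
  then have "card ?A \<le> card (\<Union>S\<in>?S. (?B S))"
    by (rule card_mono[rotated]) (intro finite_UN_I finS, simp add: finW)
  also have "\<dots> \<le> (\<Sum>S\<in>?S. card (?B S))" by (rule card_UN_le[OF finS])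
  also have "\<dots> \<le> (\<Sum>S\<in>?S. q ^ (L - a))"
  proof (rule sum_mono)
    fix S assume S: "S \<in> ?S"
    have "card (?B S) \<le> card (({..<L} - S) \<rightarrow>\<^sub>E {..<q})"
    proof (rule card_inj_on_le[of "\<lambda>g. restrict g ({..<L} - S)"])
      show "inj_on (\<lambda>g. restrict g ({..<L} - S)) (?B S)"
      proof (rule inj_onI)
        fix g h assume g: "g \<in> (?B S)" and h: "h \<in> (?B S)"
          and eq: "restrict g ({..<L} - S) = restrict h ({..<L} - S)"
        show "g = h"
        proof (rule PiE_ext[of g "{..<L}" "\<lambda>_. {..<q}"])
          fix x assume "x \<in> {..<L}"
          then show "g x = h x" using g h fun_cong[OF eq, of x] by (cases "x \<in> S") auto
        qed (use g h in auto)
      qed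
      show "(\<lambda>g. restrict g ({..<L} - S)) ` (?B S) \<subseteq> ({..<L} - S) \<rightarrow>\<^sub>E {..<q}" by auto
      show "finite (({..<L} - S) \<rightarrow>\<^sub>E {..<q})" by (rule finite_PiE) auto
    qed
    also have "\<dots> = q ^ (L - a)" using S finite_subset[of S "{..<L}"] by (simp add: card_PiE card_Diff_subset)
    finally show "card (?B S) \<le> q ^ (L - a)" .
  qed
  also have "\<dots> = (L choose a) * q ^ (L - a)" using n_subsets[of "{..<L}" a] by simp
  also have "\<dots> \<le> L ^ a * q ^ (L - a)" using binomial_le_pow[OF assms(1)] by (rule mult_le_mono1)
  finally show ?thesis .
qed

text \<open>Gilbert--Varshamov: codewords are chosen greedily.\<close>

lemma code_exists:
  assumes a: "a \<le> L" and q: "1 \<le> q" and K: "K * L ^ a \<le> q ^ a"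
  shows "\<exists>f. (\<forall>u\<in>{1..K}. \<forall>x<L. f u x < q) \<and>
    (\<forall>u\<in>{1..K}. \<forall>z\<in>{1..K}. u \<noteq> z \<longrightarrow> card {x. x < L \<and> f u x = f z x} < a)"
proof -
  let ?W = "{..<L} \<rightarrow>\<^sub>E {..<q}"
  let ?good = "\<lambda>m f. (\<forall>u\<in>{1..m}. f u \<in> ?W) \<and>
    (\<forall>u\<in>{1..m}. \<forall>z\<in>{1..m}. u \<noteq> z \<longrightarrow> card {x. x < L \<and> f u x = f z x} < a)"
  have "m \<le> K \<Longrightarrow> \<exists>f. ?good m f" for m
  proof (induction m)
    case (Suc m)
    then obtain f where f: "?good m f" by auto
    define B where "B = (\<Union>u\<in>{1..m}. {g \<in> ?W. a \<le> card {x. x < L \<and> g x = f u x}})"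
    have "card B \<le> (\<Sum>u\<in>{1..m}. card {g \<in> ?W. a \<le> card {x. x < L \<and> g x = f u x}})"
      unfolding B_def by (rule card_UN_le) simp
    also have "\<dots> \<le> (\<Sum>u\<in>{1..m}. L ^ a * q ^ (L - a))" by (intro sum_mono card_agreeing_words a q)
    also have "\<dots> = m * (L ^ a * q ^ (L - a))" by simp
    \<comment> \<open>By the size condition \<open>K\<close>, the words that clash with the
      \<open>m\<close> codewords found so far cannot fill the whole space, so another codeword
      exists.\<close>
    also have "\<dots> < q ^ L"
    proof (cases "L ^ a = 0")
      case True then show ?thesis using q by simp
    next
      case False
      then have "m * (L ^ a * q ^ (L - a)) < K * (L ^ a * q ^ (L - a))" using Suc.prems q by simp
      also have "\<dots> \<le> q ^ a * q ^ (L - a)" using K by (simp add: mult.assoc[symmetric])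
      also have "\<dots> = q ^ L" using a by (simp add: power_add[symmetric])
      finally show ?thesis .
    qed
    also have "q ^ L = card ?W" by (simp add: card_PiE)
    finally have "\<not> ?W \<subseteq> B"
      using card_mono[of B ?W] finite_subset[of B ?W] finite_PiE[of "{..<L}" "\<lambda>_. {..<q}"] by (force simp: B_def)
    then obtain g where g: "g \<in> ?W" "g \<notin> B" by blast
    have new: "card {x. x < L \<and> g x = f u x} < a" if "u \<in> {1..m}" for u
      using g that unfolding B_def by force
    have new': "card {x. x < L \<and> f u x = g x} < a" if "u \<in> {1..m}" for u
      using new[OF that] by (simp add: eq_commute)
    have "?good (Suc m) (f(Suc m := g))"
      using f g(1) new new' by (simp add: atLeastAtMostSuc_conv)
    then show ?case by blast
  qed auto
  then obtain f where "?good K f" by blast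
  then show ?thesis by (intro exI[of _ f]) (auto simp: PiE_iff)
qed

text \<open>Kautz-Singleton construction: a slot encodes a position and a letter, and
  \<open>u\<close> uses the slots spelling its codeword. At most \<open>m\<close> rivals spoil at
  most \<open>m * a\<close> positions, so one of the \<open>m * a + 1\<close> positions is
  free.\<close>

lemma selective_exists:
  assumes a: "1 \<le> a" and q: "1 \<le> q" and K: "K * (m * a + 1) ^ a \<le> q ^ a" and am: "1 \<le> m"
  shows "\<exists>hit. selective K m ((m * a + 1) * q) hit"
proof -
  let ?L = "m * a + 1"
  have "a \<le> ?L" using am by (simp add: le_SucI)
  from code_exists[OF this q K] obtain f where f: "\<And>u x. u \<in> {1..K} \<Longrightarrow> x < ?L \<Longrightarrow> f u x < q"
    "\<And>u z. u \<in> {1..K} \<Longrightarrow> z \<in> {1..K} \<Longrightarrow> u \<noteq> z \<Longrightarrow> card {x. x < ?L \<and> f u x = f z x} < a" by blast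
  define hit where "hit u s \<longleftrightarrow> f u (s div q) = s mod q" for u s
  have "\<exists>s<?L * q. hit u s \<and> (\<forall>z\<in>Z. \<not> hit z s)" if u: "u \<in> {1..K}" and Z: "Z \<subseteq> {1..K} - {u}" "card Z \<le> m" for u Z
  proof -
    let ?X = "\<Union>z\<in>Z. {x. x < ?L \<and> f u x = f z x}"
    have finZ: "finite Z" using Z(1) by (rule finite_subset) simp
    have "card ?X \<le> (\<Sum>z\<in>Z. card {x. x < ?L \<and> f u x = f z x})" by (rule card_UN_le[OF finZ])
    also have "\<dots> \<le> (\<Sum>z\<in>Z. a)"
    proof (rule sum_mono)
      fix z assume "z \<in> Z"
      then show "card {x. x < ?L \<and> f u x = f z x} \<le> a" using f(2)[OF u, of z] Z(1) by force
    qed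
    also have "\<dots> \<le> m * a" using Z(2) by simp
    finally have "card ?X < card {..<?L}" by simp
    then have "\<not> {..<?L} \<subseteq> ?X" using card_mono[of ?X "{..<?L}"] finZ by fastforce
    then obtain x where x: "x < ?L" "x \<notin> ?X" by blast
    let ?s = "x * q + f u x"
    have fx: "f u x < q" using f(1)[OF u x(1)] .
    have sd: "?s div q = x" "?s mod q = f u x" using fx by simp_all
    have "?s < (x + 1) * q" using fx by simp
    also have "\<dots> \<le> ?L * q" using x(1) by (intro mult_le_mono1) simp
    finally have "?s < ?L * q" .
    moreover have "hit u ?s" by (simp only: hit_def sd)
    moreover have "\<not> hit z ?s" if "z \<in> Z" for z
      using x that by (simp only: hit_def sd) auto
    ultimately show ?thesis by blast
  qed
  then show ?thesis unfolding selective_def by blast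
qed

section \<open>Running time\<close>

text \<open>Potential argument: \<open>J * (2 * R + 1)\<close> grows fivefold in a phase, and its
  increase pays for the rounds of that phase. Thus the last radius governs the total, without a
  factor for the number of phases.\<close>

lemma length_phases_prog:
  assumes "\<And>d M hit. (d, M, hit) \<in> set xs \<Longrightarrow> 2 * d + 32 * d * d + 2 + 2 * M \<le> J" and J: "1 \<le> J"
  shows "length (phases_prog R xs) + J * (2 * R + 1) \<le> J * (2 * radius R (length xs) + 1)"
  using assms(1)
proof (induction xs arbitrary: R)
  case (Cons x xs)
  obtain d M hit where x: "x = (d, M, hit)" by (cases x)
  have "length (phases_prog (5 * R + 2) xs) + J * (2 * (5 * R + 2) + 1) \<le> J * (2 * radius (5 * R + 2) (length xs) + 1)"
    by (rule Cons.IH) (use Cons.prems in auto)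
  moreover have "(2 * d + 32 * d * d + 2 + 2 * M) * (2 * R + 2) \<le> J * (2 * R + 2)"
    by (rule mult_le_mono1) (use Cons.prems x in auto)
  moreover have "2 + J * (2 * R + 2) + J * (2 * R + 1) \<le> J * (2 * (5 * R + 2) + 1)"
    using J by (simp add: algebra_simps)
  ultimately show ?case by (simp add: x length_phase_prog)
qed simp

lemma length_spanner_prog:
  assumes "\<And>d M hit. (d, M, hit) \<in> set xs \<Longrightarrow> 2 * d + 32 * d * d + 2 + 2 * M \<le> J" and J: "1 \<le> J"
  shows "length (spanner_prog xs) \<le> 3 * J * 5 ^ length xs"
proof -
  have r: "2 * radius 0 (length xs) + 1 = 5 ^ length xs" using radius[of 0 "length xs"] by simp
  have "length (phases_prog 0 xs) \<le> J * 5 ^ length xs"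
  proof -
    have "length (phases_prog 0 xs) + J * (2 * 0 + 1) \<le> J * (2 * radius 0 (length xs) + 1)"
      by (rule length_phases_prog) (use assms in blast)+
    then show ?thesis unfolding r by simp
  qed
  moreover have "radius 0 (length xs) + 2 \<le> 2 * 5 ^ length xs" using r one_le_power[of "5::nat" "length xs"] by linarith
  moreover have "2 * 5 ^ length xs \<le> 2 * J * 5 ^ length xs" using J by simp
  moreover have "length (spanner_prog xs) = length (phases_prog 0 xs) + (radius 0 (length xs) + 2)"
    by (simp add: spanner_prog_def length_tree_prog)
  ultimately show ?thesis by linarith
qed

text \<open>The number \<open>a\<close> of forbidden agreements is about \<open>10 / \<rho>\<close>,
  so that the alphabet size exceeds the code length \<open>p\<close> only by a factor of order
  \<open>(C * n) powr (1 / a) \<le> C * w\<close>. With \<open>p\<close> of order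
  \<open>w ^ 3 / \<rho>\<close> this yields \<open>w ^ 7\<close> slots up to constants and
  \<open>\<rho>\<close>.\<close>

lemma phase_parameters:
  fixes C n d :: nat and \<rho> :: real
  assumes C: "1 \<le> C" and n: "1 \<le> n" and \<rho>: "0 < \<rho>" "\<rho> \<le> 1" and d: "1 \<le> d" "real d \<le> real n powr (\<rho> / 10)"
  shows "\<exists>M hit. selective (C * n) ((d + 1) * (32 * d * d)) M hit \<and>
    real (2 * d + 32 * d * d + 2 + 2 * M) \<le> 2044936 * real C * real n powr \<rho> / \<rho>\<^sup>2"
proof -
  define w where "w = real n powr (\<rho> / 10)"
  have w1: "1 \<le> w" using d by (simp add: w_def)
  have dw: "real d \<le> w" using d by (simp add: w_def)
  define a where "a = nat \<lceil>10 / \<rho>\<rceil>"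
  have a: "10 / \<rho> \<le> real a" "real a \<le> 10 / \<rho> + 1"
  proof -
    show "10 / \<rho> \<le> real a" unfolding a_def by linarith
    have "0 \<le> 10 / \<rho>" using \<rho> by simp
    then show "real a \<le> 10 / \<rho> + 1" unfolding a_def by linarith
  qed
  have "1 \<le> 10 / \<rho>" using \<rho> by (simp add: field_simps)
  then have a1: "1 \<le> a" using a by linarith
  have a11: "real a \<le> 11 / \<rho>" using a \<rho> by (simp add: field_simps)
  define m where "m = (d + 1) * (32 * d * d)"
  have "0 < d" using d by simp
  then have m1: "1 \<le> m" by (simp add: m_def Suc_le_eq)
  define p where "p = m * a + 1"
  define y where "y = real (C * n) powr (1 / real a)"
  define q where "q = nat \<lceil>real p * y\<rceil>"
  have Cn: "1 \<le> real (C * n)" using C n by (simp add: mult_ge1_I flip: of_nat_mult)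
  have y1: "1 \<le> y" using Cn by (simp add: y_def ge_one_powr_ge_zero)
  have qp: "real p * y \<le> real q" "real q \<le> real p * y + 1"
  proof -
    show "real p * y \<le> real q" unfolding q_def by linarith
    have "0 \<le> real p * y" using y1 by simp
    then show "real q \<le> real p * y + 1" unfolding q_def by linarith
  qed
  have p1: "1 \<le> p" by (simp add: p_def)
  have py1: "1 * 1 \<le> real p * y" using p1 y1 by (intro mult_mono) auto
  have "y ^ a = y powr real a" using y1 by (simp add: powr_realpow)
  also have "\<dots> = real (C * n) powr (1 / real a * real a)" unfolding y_def powr_powr ..
  also have "1 / real a * real a = 1" using a1 by simp
  also have "real (C * n) powr 1 = real (C * n)" by simp
  finally have "y ^ a = real (C * n)" .
  then have "real (C * n) * real p ^ a = (real p * y) ^ a" by (simp add: power_mult_distrib)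
  also have "\<dots> \<le> real q ^ a" using qp py1 by (intro power_mono) auto
  finally have "real (C * n * p ^ a) \<le> real (q ^ a)" by simp
  then have K: "C * n * p ^ a \<le> q ^ a" by (simp only: of_nat_le_iff)
  have "1 \<le> q" using qp py1 by linarith
  from selective_exists[OF a1 this, of "C * n" m, OF K[unfolded p_def] m1]
  obtain hit where hit: "selective (C * n) m (p * q) hit" by (auto simp: p_def)
  have yw: "y \<le> real C * w"
  proof -
    have "y = real C powr (1 / real a) * real n powr (1 / real a)" by (simp add: y_def powr_mult)
    also have "\<dots> \<le> real C powr 1 * w"
      unfolding w_def
    proof (intro mult_mono powr_mono)
      show "1 / real a \<le> \<rho> / 10" using a a1 \<rho> by (simp add: field_simps)
    qed (use C n a1 in auto)
    finally show ?thesis using C by simp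
  qed
  have pw: "real p \<le> 715 * w ^ 3 / \<rho>"
  proof -
    have d1: "1 \<le> d * d * d" using d by simp
    have "m \<le> 64 * (d * d * d)"
    proof -
      have "m \<le> (d + d) * (32 * d * d)" unfolding m_def using d by (intro mult_le_mono) auto
      then show ?thesis by (simp add: algebra_simps)
    qed
    then have "m * a \<le> 64 * (d * d * d) * a" by (rule mult_le_mono1)
    moreover have "1 * 1 \<le> (d * d * d) * a" using d1 a1 by (intro mult_le_mono) auto
    ultimately have "p \<le> 65 * (d * d * d) * a" unfolding p_def by linarith
    then have "real p \<le> real (65 * (d * d * d) * a)" by (rule of_nat_mono)
    also have "\<dots> = 65 * real d ^ 3 * real a" by (simp add: power3_eq_cube)
    also have "\<dots> \<le> 65 * w ^ 3 * (11 / \<rho>)"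
      using dw a11 w1 by (intro mult_mono power_mono) auto
    finally show ?thesis by simp
  qed
  have "real q \<le> 2 * (real p * (real C * w))"
  proof -
    have "real p * y \<le> real p * (real C * w)" using yw by (intro mult_left_mono) auto
    then show ?thesis using qp py1 by linarith
  qed
  then have "real (p * q) \<le> real p * (2 * (real p * (real C * w)))"
    unfolding of_nat_mult by (intro mult_left_mono) auto
  also have "\<dots> = 2 * real C * w * (real p)\<^sup>2" by (simp add: power2_eq_square)
  also have "\<dots> \<le> 2 * real C * w * (715 * w ^ 3 / \<rho>)\<^sup>2"
    using pw w1 by (intro mult_left_mono power_mono) auto
  \<comment> \<open>\<open>1022450 = 2 * 715 ^ 2\<close>. Twice this, plus the 36 from
    \<open>small\<close>, gives the constant 2044936.\<close>
  also have "\<dots> = 1022450 * real C * (w ^ 7 / \<rho>\<^sup>2)" by (simp add: power2_eq_square eval_nat_numeral)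
  finally have M: "real (p * q) \<le> 1022450 * real C * (w ^ 7 / \<rho>\<^sup>2)" .
  have small: "real (2 * d + 32 * d * d + 2) \<le> 36 * real C * (w ^ 7 / \<rho>\<^sup>2)"
  proof -
    have "d \<le> d * d" "1 \<le> d * d" using d by auto
    then have "2 * d + 32 * d * d + 2 \<le> 36 * (d * d)" by linarith
    then have "real (2 * d + 32 * d * d + 2) \<le> real (36 * (d * d))" by (rule of_nat_mono)
    also have "\<dots> = 36 * real d ^ 2" by (simp add: power2_eq_square)
    also have "\<dots> \<le> 36 * w ^ 2" using dw by (intro mult_left_mono power_mono) auto
    also have "\<dots> \<le> 36 * w ^ 7" using w1 by (intro mult_left_mono power_increasing) auto
    also have "\<dots> = 36 * 1 * (w ^ 7 / 1)" by simp
    also have "\<dots> \<le> 36 * real C * (w ^ 7 / \<rho>\<^sup>2)"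
      using C \<rho> w1 by (intro mult_mono divide_left_mono) (auto simp: power_le_one)
    finally show ?thesis .
  qed
  have "w ^ 7 \<le> real n powr \<rho>"
  proof -
    have "w ^ 7 = real n powr (\<rho> / 10 * 7)" using w1 n powr_realpow[of w 7] by (simp add: w_def powr_powr)
    also have "\<dots> \<le> real n powr \<rho>" using n \<rho> by (intro powr_mono) auto
    finally show ?thesis .
  qed
  then have "w ^ 7 / \<rho>\<^sup>2 \<le> real n powr \<rho> / \<rho>\<^sup>2" by (intro divide_right_mono) auto
  then have "2044936 * real C * (w ^ 7 / \<rho>\<^sup>2) \<le> 2044936 * real C * (real n powr \<rho> / \<rho>\<^sup>2)"
    by (intro mult_left_mono) auto
  moreover have "real (2 * d + 32 * d * d + 2 + 2 * (p * q)) \<le> 2044936 * real C * (w ^ 7 / \<rho>\<^sup>2)"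
  proof -
    have "real (2 * d + 32 * d * d + 2 + 2 * (p * q)) = real (2 * d + 32 * d * d + 2) + 2 * real (p * q)" by simp
    then show ?thesis using M small unfolding mult.assoc by linarith
  qed
  ultimately have "real (2 * d + 32 * d * d + 2 + 2 * (p * q)) \<le> 2044936 * real C * real n powr \<rho> / \<rho>\<^sup>2"
    unfolding times_divide_eq_right by linarith
  then show ?thesis using hit unfolding m_def by blast
qed

text \<open>Only the exponents \<open>log 2 (\<kappa> * \<rho>)\<close> and \<open>1 / \<rho>\<close> matter: powers of \<open>1 / \<rho>\<close> are absorbed by \<open>c\<close>, and
  \<open>5 powr (20 / \<rho>)\<close> exceeds \<open>(4 / \<rho> + 1) powr (1 / \<rho>)\<close> only for \<open>\<rho>\<close> above an absolute constant.\<close>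

lemma stretch_bound:
  shows "\<exists>c>0. \<forall>(\<kappa>::nat) \<rho>. 1 \<le> real \<kappa> * \<rho> \<and> 0 < \<rho> \<and> \<rho> < 1 / 2 \<longrightarrow>
    250 * (slack * (real \<kappa> * \<rho>)) ^ 3 * 5 powr (20 / \<rho>) / \<rho>\<^sup>2 \<le>
      (4 / \<rho> + 1) powr (log 2 (real \<kappa> * \<rho>) + 1 / \<rho> + c)"
proof -
  \<comment> \<open>Since \<open>5 powr (20 / \<rho>) = B powr (1 / \<rho>)\<close>, this is the
    threshold for \<open>4 / \<rho> + 1\<close>. Below it \<open>1 / \<rho> < B\<close>, and the
    whole factor is at most the constant \<open>M\<close>.\<close>
  obtain B :: real where B: "B = 5 powr 20" by blast
  define M where "M = 5 powr (20 * B)"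
  have B1: "1 \<le> B" unfolding B by (rule ge_one_powr_ge_zero) auto
  have M1: "1 \<le> M" unfolding M_def by (rule ge_one_powr_ge_zero) (use B1 in auto)
  have s3: "1 \<le> slack ^ 3" using slack by (intro one_le_power) auto
  have "1 * 1 \<le> slack ^ 3 * M" using s3 M1 slack by (intro mult_mono) auto
  then have g: "1 < 250 * slack ^ 3 * M" by simp
  \<comment> \<open>The base is 9 because \<open>4 / \<rho> + 1\<close> is at least 9 for
    \<open>\<rho> < 1 / 2\<close>.\<close>
  define c where "c = log 9 (250 * slack ^ 3 * M)"
  have "0 < 250 * slack ^ 3 * M" using g by linarith
  then have c: "0 < c" "9 powr c = 250 * slack ^ 3 * M"
    unfolding c_def using g zero_less_log_cancel_iff[of 9 "250 * slack ^ 3 * M"] by (simp_all only: powr_log_cancel)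
  have "250 * (slack * (real \<kappa> * \<rho>)) ^ 3 * 5 powr (20 / \<rho>) / \<rho>\<^sup>2 \<le>
      (4 / \<rho> + 1) powr (log 2 (real \<kappa> * \<rho>) + 1 / \<rho> + (c + 2))"
    if h: "1 \<le> real \<kappa> * \<rho>" "0 < \<rho>" "\<rho> < 1 / 2" for \<kappa> :: nat and \<rho>
  proof -
    define \<beta> where "\<beta> = 4 / \<rho> + 1"
    define x where "x = real \<kappa> * \<rho>"
    have \<beta>: "9 \<le> \<beta>" "1 / \<rho> \<le> \<beta>" using h by (auto simp: \<beta>_def field_simps)
    have x: "1 \<le> x" using h by (simp add: x_def)
    have 1: "5 powr (20 / \<rho>) \<le> M * \<beta> powr (1 / \<rho>)"
    proof (cases "B \<le> \<beta>")
      case True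
      have "5 powr (20 / \<rho>) = B powr (1 / \<rho>)" unfolding B by (simp only: powr_powr times_divide_eq_right mult_1_right)
      also have "\<dots> \<le> \<beta> powr (1 / \<rho>)" using True B1 h by (intro powr_mono2) auto
      also have "\<dots> \<le> M * \<beta> powr (1 / \<rho>)" using M1 by (simp add: mult_le_cancel_right1)
      finally show ?thesis .
    next
      case False
      then have "20 / \<rho> \<le> 20 * B" using \<beta> by simp
      then have "5 powr (20 / \<rho>) \<le> M * 1" unfolding M_def by (simp add: powr_mono)
      also have "\<dots> \<le> M * \<beta> powr (1 / \<rho>)"
        using M1 \<beta> h by (intro mult_left_mono ge_one_powr_ge_zero) auto
      finally show ?thesis .
    qed
    have 2: "x ^ 3 \<le> \<beta> powr (log 2 x)"
    proof -
      have "x ^ 3 = x powr 3" using x by simp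
      also have "\<dots> = (2 powr log 2 x) powr 3" using x by simp
      also have "\<dots> = (2 powr 3) powr (log 2 x)" by (simp only: powr_powr mult.commute)
      also have "\<dots> \<le> \<beta> powr (log 2 x)" using \<beta> x by (intro powr_mono2) auto
      finally show ?thesis .
    qed
    have 3: "250 * slack ^ 3 * M \<le> \<beta> powr c" unfolding c(2)[symmetric] using \<beta> c(1) by (intro powr_mono2) auto
    \<comment> \<open>The factor \<open>1 / \<rho>\<^sup>2\<close> stems from the number of slots in
      a phase; it costs an additional 2 in the exponent.\<close>
    have 4: "1 / \<rho>\<^sup>2 \<le> \<beta> powr 2"
    proof -
      have "1 / \<rho>\<^sup>2 = (1 / \<rho>)\<^sup>2" by (simp add: power_one_over)
      also have "\<dots> \<le> \<beta>\<^sup>2" using \<beta> h by (intro power_mono) auto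
      finally show ?thesis using \<beta> by simp
    qed
    have "250 * (slack * x) ^ 3 * 5 powr (20 / \<rho>) / \<rho>\<^sup>2 = 250 * slack ^ 3 * x ^ 3 * 5 powr (20 / \<rho>) * (1 / \<rho>\<^sup>2)"
      by (simp add: power_mult_distrib)
    also have "\<dots> \<le> 250 * slack ^ 3 * x ^ 3 * (M * \<beta> powr (1 / \<rho>)) * (1 / \<rho>\<^sup>2)"
      using 1 slack x by (intro mult_right_mono mult_left_mono) auto
    also have "\<dots> = x ^ 3 * \<beta> powr (1 / \<rho>) * (250 * slack ^ 3 * M) * (1 / \<rho>\<^sup>2)" by (simp add: mult_ac)
    also have "\<dots> \<le> \<beta> powr (log 2 x) * \<beta> powr (1 / \<rho>) * \<beta> powr c * \<beta> powr 2"
      using 2 3 4 x slack M1 by (intro mult_mono mult_nonneg_nonneg) auto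
    also have "\<dots> = \<beta> powr (log 2 x + 1 / \<rho> + (c + 2))" by (simp only: powr_add mult.assoc)
    finally show ?thesis unfolding x_def \<beta>_def .
  qed
  then show ?thesis using c(1) by (intro exI[of _ "c + 2"]) auto
qed

theorem corollary3p13:
  fixes C :: nat
  assumes "1 \<le> C"
  shows "\<exists>(c::real) (c'::real) (B::nat) (A :: nat \<Rightarrow> nat \<Rightarrow> real \<Rightarrow> protocol).
    0 < c \<and> 0 < c' \<and>
    (\<forall>(\<kappa>::nat) (\<rho>::real) (N::network) (n::nat) (t::real).
       2 \<le> \<kappa> \<and> 1 / real \<kappa> \<le> \<rho> \<and> \<rho> < 1 / 2 \<and>
       congest_network C N \<and> connected_graph (verts N) (edges N) \<and> n = card (verts N) \<and>
       t = (4 / \<rho> + 1) powr (log 2 (real \<kappa> * \<rho>) + 1 / \<rho> + c)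
       \<longrightarrow>
       respects_bandwidth B C (A n \<kappa> \<rho>) N \<and>
       (\<exists>R H. constructs_within (A n \<kappa> \<rho>) N R H \<and>
          is_spanner t (verts N) (edges N) H \<and>
          real (card H) \<le> real n powr (1 + 1 / real \<kappa>) \<and>
          real R \<le> c' * real n powr \<rho> * t))"
proof -
  obtain c where c: "0 < c" and stretch: "\<And>(\<kappa>::nat) \<rho>. 1 \<le> real \<kappa> * \<rho> \<Longrightarrow> 0 < \<rho> \<Longrightarrow> \<rho> < 1 / 2 \<Longrightarrow>
    250 * (slack * (real \<kappa> * \<rho>)) ^ 3 * 5 powr (20 / \<rho>) / \<rho>\<^sup>2 \<le>
      (4 / \<rho> + 1) powr (log 2 (real \<kappa> * \<rho>) + 1 / \<rho> + c)"
    using stretch_bound by blast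
  define Q where "Q = 2044936 * real C"
  \<comment> \<open>A protocol may depend on \<open>n\<close>, \<open>\<kappa>\<close> and
    \<open>\<rho>\<close> only, so networks are quantified inside.\<close>
  define good where "good n \<kappa> \<rho> P \<longleftrightarrow> (\<forall>N. congest_network C N \<and> n = card (verts N) \<longrightarrow>
       respects_bandwidth 2 C P N \<and>
       (\<exists>R H. constructs_within P N R H \<and>
          is_spanner ((4 / \<rho> + 1) powr (log 2 (real \<kappa> * \<rho>) + 1 / \<rho> + c)) (verts N) (edges N) H \<and>
          real (card H) \<le> real n powr (1 + 1 / real \<kappa>) \<and>
          real R \<le> 3 * Q * real n powr \<rho> * (4 / \<rho> + 1) powr (log 2 (real \<kappa> * \<rho>) + 1 / \<rho> + c)))"
    for n \<kappa> :: nat and \<rho> :: real and P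
  have ex: "\<exists>P. good n \<kappa> \<rho> P" if h: "2 \<le> \<kappa>" "1 / real \<kappa> \<le> \<rho>" "\<rho> < 1 / 2" "1 \<le> n" for n \<kappa> \<rho>
  proof -
    define t where "t = (4 / \<rho> + 1) powr (log 2 (real \<kappa> * \<rho>) + 1 / \<rho> + c)"
    have "0 < 1 / real \<kappa>" using h by simp
    then have \<rho>: "0 < \<rho>" "\<rho> \<le> 1" using h by linarith+
    have \<kappa>\<rho>: "1 \<le> real \<kappa> * \<rho>" using h by (simp add: field_simps)
    obtain ds where ds: "\<forall>d\<in>set ds. 1 \<le> d \<and> real d \<le> real n powr (\<rho> / 10)" "cluster_bound (real n) ds < 1"
      "real n + edge_cost (real n) ds \<le> real n powr (1 + 1 / real \<kappa>)"
      "5 ^ length ds \<le> 125 * (slack * (real \<kappa> * \<rho>)) ^ 3 * 5 powr (20 / \<rho>)"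
      using schedule_exists[OF h(1,2,4)] by blast
    have "\<forall>d\<in>set ds. \<exists>x. selective (C * n) ((d + 1) * (32 * d * d)) (fst x) (snd x) \<and>
       real (2 * d + 32 * d * d + 2 + 2 * fst x) \<le> Q * real n powr \<rho> / \<rho>\<^sup>2"
      using phase_parameters[OF assms h(4) \<rho>] ds(1) unfolding Q_def by (metis fst_conv snd_conv)
    then obtain F where F: "\<And>d. d \<in> set ds \<Longrightarrow> selective (C * n) ((d + 1) * (32 * d * d)) (fst (F d)) (snd (F d)) \<and>
       real (2 * d + 32 * d * d + 2 + 2 * fst (F d)) \<le> Q * real n powr \<rho> / \<rho>\<^sup>2"
      by metis
    define xs where "xs = map (\<lambda>d. (d, F d)) ds"
    have fst_xs: "map fst xs = ds" by (simp add: xs_def comp_def)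
    define J where "J = nat \<lfloor>Q * real n powr \<rho> / \<rho>\<^sup>2\<rfloor>"
    have "1 * 1 * (1 / 1) \<le> Q * real n powr \<rho> * (1 / \<rho>\<^sup>2)"
      using assms h(4) \<rho> by (intro mult_mono divide_left_mono ge_one_powr_ge_zero) (auto simp: Q_def power_le_one)
    then have J: "1 \<le> J" "real J \<le> Q * real n powr \<rho> / \<rho>\<^sup>2" by (simp_all add: J_def) linarith+
    have len: "length (spanner_prog xs) \<le> 3 * J * 5 ^ length xs"
    proof (rule length_spanner_prog[OF _ J(1)])
      fix d M hit assume "(d, M, hit) \<in> set xs"
      then have "d \<in> set ds" "F d = (M, hit)" by (auto simp: xs_def)
      then have "real (2 * d + 32 * d * d + 2 + 2 * M) \<le> Q * real n powr \<rho> / \<rho>\<^sup>2"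
        using F[of d] by simp
      then show "2 * d + 32 * d * d + 2 + 2 * M \<le> J" unfolding J_def by linarith
    qed
    \<comment> \<open>The stretch bound asks for \<open>2 * 5 ^ length xs\<close> alone; the
      quotient by \<open>\<rho>\<^sup>2\<close> serves the number of rounds.\<close>
    have t: "2 * 5 ^ length xs / \<rho>\<^sup>2 \<le> t"
    proof -
      have "2 * 5 ^ length xs / \<rho>\<^sup>2 \<le> 2 * (125 * (slack * (real \<kappa> * \<rho>)) ^ 3 * 5 powr (20 / \<rho>)) / \<rho>\<^sup>2"
        using ds(4) by (intro divide_right_mono mult_left_mono) (simp_all add: xs_def)
      also have "\<dots> \<le> t" using stretch[OF \<kappa>\<rho> \<rho>(1) h(3)] by (simp add: t_def)
      finally show ?thesis .
    qed
    have t5: "2 * 5 ^ length xs \<le> t"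
    proof -
      have "2 * 5 ^ length xs / 1 \<le> 2 * 5 ^ length xs / \<rho>\<^sup>2"
        using \<rho> by (intro divide_left_mono) (auto simp: power_le_one)
      then show ?thesis using t by simp
    qed
    have "real (length (spanner_prog xs)) \<le> real (3 * J * 5 ^ length xs)" using len by (rule of_nat_mono)
    also have "\<dots> = 3 * real J * 5 ^ length xs" by simp
    also have "\<dots> \<le> 3 * (Q * real n powr \<rho> / \<rho>\<^sup>2) * 5 ^ length xs"
      using J(2) by (intro mult_right_mono mult_left_mono) auto
    also have "\<dots> = 3 * Q * real n powr \<rho> * (5 ^ length xs / \<rho>\<^sup>2)" by simp
    also have "\<dots> \<le> 3 * Q * real n powr \<rho> * t"
    proof (rule mult_left_mono)
      have "5 ^ length xs / \<rho>\<^sup>2 \<le> 2 * 5 ^ length xs / \<rho>\<^sup>2" by (intro divide_right_mono) auto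
      then show "5 ^ length xs / \<rho>\<^sup>2 \<le> t" using t by linarith
    qed (simp add: Q_def)
    finally have rounds: "real (length (spanner_prog xs)) \<le> 3 * Q * real n powr \<rho> * t" .
    have "good n \<kappa> \<rho> (protocol_of 2 (C * n) start (spanner_prog xs) (\<lambda>\<sigma>. vmk (fst \<sigma>)))"
      unfolding good_def t_def[symmetric]
    proof (intro allI impI, elim conjE)
      fix N assume N: "congest_network C N" and nN: "n = card (verts N)"
      interpret congest C N by unfold_locales (rule N)
      have K1: "1 \<le> C * card (verts N)" using assms h(4) nN by simp
      have "\<exists>H. constructs_within (protocol_of 2 (C * card (verts N)) start (spanner_prog xs) (\<lambda>\<sigma>. vmk (fst \<sigma>))) N
            (length (spanner_prog xs)) H \<and>
          is_spanner t (verts N) (edges N) H \<and>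
          real (card H) \<le> real (card (verts N)) + edge_cost (real (card (verts N))) (map fst xs)"
      proof (rule spanner_prog[OF _ _ K1 t5])
        fix d M hit assume "(d, M, hit) \<in> set xs"
        then have "d \<in> set ds" "F d = (M, hit)" by (auto simp: xs_def)
        then show "1 \<le> d \<and> selective (C * card (verts N)) ((d + 1) * (32 * d * d)) M hit"
          using F[OF \<open>d \<in> set ds\<close>] ds(1) unfolding nN by simp
      next
        show "cluster_bound (real (card (verts N))) (map fst xs) < 1" unfolding fst_xs nN[symmetric] by (rule ds(2))
      qed
      then obtain H where
        "constructs_within (protocol_of 2 (C * n) start (spanner_prog xs) (\<lambda>\<sigma>. vmk (fst \<sigma>))) N (length (spanner_prog xs)) H"
        "is_spanner t (verts N) (edges N) H" "real (card H) \<le> real n + edge_cost (real n) ds"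
        unfolding fst_xs nN[symmetric] by blast
      then show "respects_bandwidth 2 C (protocol_of 2 (C * n) start (spanner_prog xs) (\<lambda>\<sigma>. vmk (fst \<sigma>))) N \<and>
        (\<exists>R H. constructs_within (protocol_of 2 (C * n) start (spanner_prog xs) (\<lambda>\<sigma>. vmk (fst \<sigma>))) N R H \<and>
          is_spanner t (verts N) (edges N) H \<and> real (card H) \<le> real n powr (1 + 1 / real \<kappa>) \<and>
          real R \<le> 3 * Q * real n powr \<rho> * t)"
        using respects_bandwidth_protocol_of[of 2 C N, folded nN] ds(3) rounds by (meson order_trans)
    qed
    then show ?thesis by blast
  qed
  \<comment> \<open>A choice is legitimate since local computation is unrestricted: all processors
    use the same schedule and selective families, which are determined by known parameters.\<close>
  define A where "A n \<kappa> \<rho> = (SOME P. good n \<kappa> \<rho> P)" for n \<kappa> \<rho>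
  have A: "good n \<kappa> \<rho> (A n \<kappa> \<rho>)" if "2 \<le> \<kappa>" "1 / real \<kappa> \<le> \<rho>" "\<rho> < 1 / 2" "1 \<le> n" for n \<kappa> \<rho>
    unfolding A_def using ex[OF that] by (rule someI_ex)
  have n1: "1 \<le> card (verts N)" if "congest_network C N" "connected_graph (verts N) (edges N)" for N
    using that by (simp add: congest_network_def simple_graph_def connected_graph_def Suc_le_eq card_gt_0_iff)
  have "0 < 3 * Q" using assms by (simp add: Q_def)
  show ?thesis
  proof (rule exI[of _ c], rule exI[of _ "3 * Q"], rule exI[of _ 2], rule exI[of _ A], intro conjI allI impI)
    fix \<kappa> n :: nat and \<rho> t :: real and N :: network
    assume h: "2 \<le> \<kappa> \<and> 1 / real \<kappa> \<le> \<rho> \<and> \<rho> < 1 / 2 \<and> congest_network C N \<and>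
      connected_graph (verts N) (edges N) \<and> n = card (verts N) \<and>
      t = (4 / \<rho> + 1) powr (log 2 (real \<kappa> * \<rho>) + 1 / \<rho> + c)"
    then have "good n \<kappa> \<rho> (A n \<kappa> \<rho>)" using A n1 by simp
    then have *: "respects_bandwidth 2 C (A n \<kappa> \<rho>) N \<and>
       (\<exists>R H. constructs_within (A n \<kappa> \<rho>) N R H \<and> is_spanner t (verts N) (edges N) H \<and>
          real (card H) \<le> real n powr (1 + 1 / real \<kappa>) \<and> real R \<le> 3 * Q * real n powr \<rho> * t)"
      using h unfolding good_def by blast
    show "respects_bandwidth 2 C (A n \<kappa> \<rho>) N" using * by (rule conjunct1)
    show "\<exists>R H. constructs_within (A n \<kappa> \<rho>) N R H \<and> is_spanner t (verts N) (edges N) H \<and>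
          real (card H) \<le> real n powr (1 + 1 / real \<kappa>) \<and> real R \<le> 3 * Q * real n powr \<rho> * t"
      using * by (rule conjunct2)
  qed (use c \<open>0 < 3 * Q\<close> in simp_all)
qed

end
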